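(* Let $G$ be a non-abelian 3-generator $2\mathcal{E}$-group such that $\exp(G/G')=\exp(G')=2^r$. Then $G$ is isomorphic to one of the following groups: (i) $Q_8\times C_2$; (ii) $\langle x,y,z \mid x^4=y^4=[y,z]=1,\ x^2=z^2=[x,y],\ (xz)^2=y^2\rangle$; (iii) $\langle x,y,z \mid x^4=z^4=[y,z]=1,\ x^2=y^2=[x,y],\ [x,z]=z^2\rangle$; (iv) $G(2,r,r,[t_{ij}])$ where $[t_{ij}]\in GL(3,\mathbb{Z}_{2^r})$.
   Context: Commutators are $[g,h]=g^{-1}h^{-1}gh$; $G'$ is the derived subgroup, $Z(G)$ the center and $\exp$ denotes the exponent. A group is 2-Engel if $[[g,h],h]=1$ for all $g,h$. For a $p$-group $G$, $\Omega_r(G)=\langle g\in G : g^{p^r}=1\rangle$. A finite $p$-group $G$ is called a $p\mathcal{E}$-group if $G$ is 2-Engel and there is a non-negative integer $r$ such that $\exp(G/G')=p^r$ and $\Omega_r(G)\le Z(G)$; a $2\mathcal{E}$-group is the case $p=2$. $Q_8$ is the quaternion group of order 8 and $C_2$ the cyclic group of order 2. For a prime $p$, integers $1\le t\le r$ and a matrix $[t_{ij}]\in GL(3,\mathbb{Z}_{p^t})$, $G(p,r,t,[t_{ij}])$ denotes the group with generators $x,y,z$ and relations $$x^{p^{r+t}}=y^{p^{r+t}}=z^{p^{r+t}}=1,$$ $$[x^{p^t},y]=[x^{p^t},z]=[y^{p^t},x]=[y^{p^t},z]=[z^{p^t},x]=[z^{p^t},y]=1,$$ $$[x,y]=x^{p^rt_{11}}y^{p^rt_{12}}z^{p^rt_{13}},\quad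 [x,z]=x^{p^rt_{21}}y^{p^rt_{22}}z^{p^rt_{23}},\quad [y,z]=x^{p^rt_{31}}y^{p^rt_{32}}z^{p^rt_{33}},$$ where the $t_{ij}$ are replaced by integer representatives. *)

theory Defs
  imports
    "HOL-Algebra.Algebra"
    "HOL-Analysis.Finite_Cartesian_Product"
    "HOL-Number_Theory.Cong"
begin

section \<open>Finite \<open>p\<close>-groups and \<open>pE\<close>-groups\<close>

text \<open>
  The library's \<^const>\<open>derived\<close> is generated by the elements \<open>g h g\<^sup>-\<^sup>1 h\<^sup>-\<^sup>1\<close>. Over a subgroup these
  are the same elements as the \<open>[g, h] = g\<^sup>-\<^sup>1 h\<^sup>-\<^sup>1 g h\<close>, so it is the derived subgroup also for the
  commutator convention used here.
\<close>

definition commutator :: "('a, 'b) monoid_scheme \<Rightarrow> 'a \<Rightarrow> 'a \<Rightarrow> 'a" where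
  "commutator G g h = inv\<^bsub>G\<^esub> g \<otimes>\<^bsub>G\<^esub> inv\<^bsub>G\<^esub> h \<otimes>\<^bsub>G\<^esub> g \<otimes>\<^bsub>G\<^esub> h"

definition derived_subgroup :: "('a, 'b) monoid_scheme \<Rightarrow> 'a set" where
  "derived_subgroup G = derived G (carrier G)"

definition group_center :: "('a, 'b) monoid_scheme \<Rightarrow> 'a set" where
  "group_center G = {z \<in> carrier G. \<forall>g \<in> carrier G. z \<otimes>\<^bsub>G\<^esub> g = g \<otimes>\<^bsub>G\<^esub> z}"

text \<open>Only used for finite groups, where such an \<open>n\<close> exists.\<close>

definition group_exponent :: "('a, 'b) monoid_scheme \<Rightarrow> nat" where
  "group_exponent G = (LEAST n. 0 < n \<and> (\<forall>g \<in> carrier G. g [^]\<^bsub>G\<^esub> n = \<one>\<^bsub>G\<^esub>))"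

definition two_Engel :: "('a, 'b) monoid_scheme \<Rightarrow> bool" where
  "two_Engel G \<longleftrightarrow>
     (\<forall>g \<in> carrier G. \<forall>h \<in> carrier G. commutator G (commutator G g h) h = \<one>\<^bsub>G\<^esub>)"

definition Omega :: "nat \<Rightarrow> nat \<Rightarrow> ('a, 'b) monoid_scheme \<Rightarrow> 'a set" where
  "Omega p r G = generate G {g \<in> carrier G. g [^]\<^bsub>G\<^esub> (p ^ r) = \<one>\<^bsub>G\<^esub>}"

definition finite_p_group :: "nat \<Rightarrow> ('a, 'b) monoid_scheme \<Rightarrow> bool" where
  "finite_p_group p G \<longleftrightarrow>
     Factorial_Ring.prime p \<and> group G \<and> finite (carrier G) \<and> (\<exists>n. order G = p ^ n)"

definition pE_group :: "nat \<Rightarrow> ('a, 'b) monoid_scheme \<Rightarrow> bool" where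
  "pE_group p G \<longleftrightarrow> finite_p_group p G \<and> two_Engel G \<and>
     (\<exists>r. group_exponent (G Mod derived_subgroup G) = p ^ r \<and> Omega p r G \<subseteq> group_center G)"

text \<open>
  The minimal number of generators \<open>d(G)\<close>. A \<open>d\<close>-generator group is one with \<open>d(G) = d\<close>, not just
  \<open>d(G) \<le> d\<close>.
\<close>

definition generator_rank :: "('a, 'b) monoid_scheme \<Rightarrow> nat" where
  "generator_rank G =
     (LEAST n. \<exists>S \<subseteq> carrier G. finite S \<and> card S = n \<and> generate G S = carrier G)"


section \<open>Groups given by generators and relations\<close>

text \<open>
  A word over the generators \<open>'g\<close> is a list of letters; \<open>(a, True)\<close> stands for \<open>a\<close> and
  \<open>(a, False)\<close> for \<open>a\<^sup>-\<^sup>1\<close>. A pair \<open>(u, v)\<close> of words stands for the relation \<open>u = v\<close>. The presented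
  group consists of all words modulo the least congruence that contains the relations and the
  free cancellations. All elements of the type \<open>'g\<close> count as generators.
\<close>

type_synonym 'g word = "('g \<times> bool) list"

inductive word_equiv :: "('g word \<times> 'g word) set \<Rightarrow> 'g word \<Rightarrow> 'g word \<Rightarrow> bool"
  for R :: "('g word \<times> 'g word) set" where
  relation: "(u, v) \<in> R \<Longrightarrow> word_equiv R u v"
| cancel: "word_equiv R [(a, b), (a, \<not> b)] []"
| refl: "word_equiv R u u"
| sym: "word_equiv R u v \<Longrightarrow> word_equiv R v u"
| trans: "word_equiv R u v \<Longrightarrow> word_equiv R v w \<Longrightarrow> word_equiv R u w"
| append: "word_equiv R u u' \<Longrightarrow> word_equiv R v v' \<Longrightarrow> word_equiv R (u @ v) (u' @ v')"

definition word_class :: "('g word \<times> 'g word) set \<Rightarrow> 'g word \<Rightarrow> 'g word set" where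
  "word_class R u = {v. word_equiv R u v}"

definition presented_group :: "('g word \<times> 'g word) set \<Rightarrow> 'g word set monoid" where
  "presented_group R =
     \<lparr> carrier = range (word_class R),
       monoid.mult = (\<lambda>A B. \<Union>u \<in> A. \<Union>v \<in> B. word_class R (u @ v)),
       one = word_class R [] \<rparr>"

definition word_inv :: "'g word \<Rightarrow> 'g word" where
  "word_inv w = rev (map (\<lambda>(a, b). (a, \<not> b)) w)"

definition word_pow :: "'g word \<Rightarrow> int \<Rightarrow> 'g word" (infixr "^\<^sub>w" 80) where
  "w ^\<^sub>w k = (if 0 \<le> k then concat (replicate (nat k) w)
                else concat (replicate (nat (- k)) (word_inv w)))"

definition word_comm :: "'g word \<Rightarrow> 'g word \<Rightarrow> 'g word" where
  "word_comm u v = word_inv u @ word_inv v @ u @ v"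


subsection \<open>The presented group is a group with the expected universal property\<close>

lemma word_class_eq_iff: "word_class R u = word_class R v \<longleftrightarrow> word_equiv R u v"
proof
  assume "word_class R u = word_class R v"
  moreover have "v \<in> word_class R v" by (simp add: word_class_def word_equiv.refl)
  ultimately show "word_equiv R u v" by (simp add: word_class_def set_eq_iff)
next
  assume uv: "word_equiv R u v"
  have "word_equiv R u w \<longleftrightarrow> word_equiv R v w" for w
    using word_equiv.trans[OF uv, of w] word_equiv.trans[OF word_equiv.sym[OF uv], of w] by blast
  then show "word_class R u = word_class R v" by (simp add: word_class_def)
qed

lemma presented_group_carrier: "carrier (presented_group R) = range (word_class R)"
  by (simp add: presented_group_def)

lemma presented_group_one: "\<one>\<^bsub>presented_group R\<^esub> = word_class R []"
  by (simp add: presented_group_def)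

lemma presented_group_mult:
  "word_class R u \<otimes>\<^bsub>presented_group R\<^esub> word_class R v = word_class R (u @ v)"
proof -
  have "word_class R (u' @ v') = word_class R (u @ v)"
    if "u' \<in> word_class R u" "v' \<in> word_class R v" for u' v'
  proof -
    have "word_equiv R u u'" "word_equiv R v v'" using that by (simp_all add: word_class_def)
    then have "word_equiv R (u @ v) (u' @ v')" by (rule word_equiv.append)
    then show ?thesis by (simp only: word_class_eq_iff word_equiv.sym)
  qed
  then have "(\<Union>u' \<in> word_class R u. \<Union>v' \<in> word_class R v. word_class R (u' @ v')) =
      (\<Union>u' \<in> word_class R u. \<Union>v' \<in> word_class R v. word_class R (u @ v))"
    by simp
  moreover have "u \<in> word_class R u" "v \<in> word_class R v"
    by (simp_all add: word_class_def word_equiv.refl)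
  ultimately show ?thesis
    unfolding presented_group_def by (simp only: monoid.simps) blast
qed

lemma word_inv_equiv: "word_equiv R (word_inv u @ u) []"
proof (induction u)
  case Nil
  show ?case by (simp add: word_inv_def word_equiv.refl)
next
  case (Cons l u)
  obtain a b where l: "l = (a, b)" by (cases l)
  have c: "word_equiv R [(a, \<not> b), (a, b)] []"
    using word_equiv.cancel[of R a "\<not> b"] by simp
  have "word_equiv R (word_inv u @ ([(a, \<not> b), (a, b)] @ u)) (word_inv u @ ([] @ u))"
    by (intro word_equiv.append[OF word_equiv.refl] word_equiv.append[OF c word_equiv.refl])
  then have "word_equiv R (word_inv u @ ([(a, \<not> b), (a, b)] @ u)) (word_inv u @ u)"
    by simp
  from word_equiv.trans[OF this Cons.IH] show ?case
    by (simp add: word_inv_def l)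
qed

lemma presented_group_is_group: "group (presented_group R)"
proof (rule groupI)
  show "\<one>\<^bsub>presented_group R\<^esub> \<in> carrier (presented_group R)"
    by (simp add: presented_group_carrier presented_group_one)
next
  fix A assume "A \<in> carrier (presented_group R)"
  then obtain u where u: "A = word_class R u"
    unfolding presented_group_carrier by (rule rangeE)
  show "\<one>\<^bsub>presented_group R\<^esub> \<otimes>\<^bsub>presented_group R\<^esub> A = A"
    by (simp add: u presented_group_one presented_group_mult)
  have "word_class R (word_inv u) \<otimes>\<^bsub>presented_group R\<^esub> A = \<one>\<^bsub>presented_group R\<^esub>"
    by (simp add: u presented_group_one presented_group_mult word_class_eq_iff word_inv_equiv)
  moreover have "word_class R (word_inv u) \<in> carrier (presented_group R)"
    by (simp add: presented_group_carrier)
  ultimately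
  show "\<exists>B \<in> carrier (presented_group R). B \<otimes>\<^bsub>presented_group R\<^esub> A = \<one>\<^bsub>presented_group R\<^esub>"
    by (rule bexI)
next
  fix A B assume "A \<in> carrier (presented_group R)" "B \<in> carrier (presented_group R)"
  then obtain u v where AB: "A = word_class R u" "B = word_class R v"
    unfolding presented_group_carrier by (elim rangeE)
  show "A \<otimes>\<^bsub>presented_group R\<^esub> B \<in> carrier (presented_group R)"
    by (simp add: AB presented_group_mult presented_group_carrier)
  fix C assume "C \<in> carrier (presented_group R)"
  then obtain w where C: "C = word_class R w"
    unfolding presented_group_carrier by (rule rangeE)
  show "A \<otimes>\<^bsub>presented_group R\<^esub> B \<otimes>\<^bsub>presented_group R\<^esub> C =
      A \<otimes>\<^bsub>presented_group R\<^esub> (B \<otimes>\<^bsub>presented_group R\<^esub> C)"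
    by (simp add: AB C presented_group_mult)
qed

text \<open>The value of a word in a group, for a choice of values of the generators.\<close>

definition word_eval :: "('a, 'b) monoid_scheme \<Rightarrow> ('g \<Rightarrow> 'a) \<Rightarrow> 'g word \<Rightarrow> 'a" where
  "word_eval G f w =
     foldr (\<lambda>(a, b) g. (if b then f a else inv\<^bsub>G\<^esub> (f a)) \<otimes>\<^bsub>G\<^esub> g) w \<one>\<^bsub>G\<^esub>"

lemma (in group) word_eval_closed:
  assumes "\<And>a. f a \<in> carrier G"
  shows "word_eval G f w \<in> carrier G"
  using assms by (induction w) (auto simp: word_eval_def)

lemma (in group) word_eval_append:
  assumes "\<And>a. f a \<in> carrier G"
  shows "word_eval G f (u @ v) = word_eval G f u \<otimes> word_eval G f v"
proof (induction u)
  case Nil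
  have "word_eval G f [] = \<one>" by (simp add: word_eval_def)
  then show ?case using word_eval_closed[of f v, OF assms] by simp
next
  case (Cons l u)
  obtain a b where l: "l = (a, b)" by (cases l)
  have c: "(if b then f a else inv (f a)) \<in> carrier G" using assms by simp
  have "word_eval G f (l # w) = (if b then f a else inv (f a)) \<otimes> word_eval G f w" for w
    by (simp add: word_eval_def l)
  then show ?case
    using Cons m_assoc[OF c] word_eval_closed[of f, OF assms] by simp
qed

theorem (in group) presented_group_hom:
  assumes f: "\<And>a. f a \<in> carrier G"
    and R: "\<And>u v. (u, v) \<in> R \<Longrightarrow> word_eval G f u = word_eval G f v"
  obtains \<phi> where "\<phi> \<in> hom (presented_group R) G"
    and "\<And>w. \<phi> (word_class R w) = word_eval G f w"
proof -
  have eq: "word_eval G f u = word_eval G f v" if "word_equiv R u v" for u v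
    using that
  proof induction
    case (relation u v)
    then show ?case by (rule R)
  next
    case (cancel a b)
    then show ?case using f[of a] by (simp add: word_eval_def)
  next
    case (append u u' v v')
    then show ?case by (simp add: word_eval_append[of f, OF f])
  qed simp_all
  define \<phi> where "\<phi> A = word_eval G f (SOME w. w \<in> A)" for A
  have \<phi>: "\<phi> (word_class R w) = word_eval G f w" for w
  proof -
    have "w \<in> word_class R w" by (simp add: word_class_def word_equiv.refl)
    then have "(SOME v. v \<in> word_class R w) \<in> word_class R w" by (rule someI)
    then have "word_equiv R w (SOME v. v \<in> word_class R w)"
      by (simp only: word_class_def mem_Collect_eq)
    from eq[OF this] show ?thesis by (simp only: \<phi>_def)
  qed
  have "\<phi> \<in> hom (presented_group R) G"
  proof (rule homI)
    fix A assume "A \<in> carrier (presented_group R)"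
    then show "\<phi> A \<in> carrier G"
      using word_eval_closed[of f, OF f] by (auto simp: presented_group_def \<phi>)
  next
    fix A B assume "A \<in> carrier (presented_group R)" "B \<in> carrier (presented_group R)"
    then obtain u v where "A = word_class R u" "B = word_class R v"
      by (auto simp: presented_group_def)
    then show "\<phi> (A \<otimes>\<^bsub>presented_group R\<^esub> B) = \<phi> A \<otimes> \<phi> B"
      by (simp add: presented_group_mult \<phi> word_eval_append[of f, OF f])
  qed
  with \<phi> show thesis using that by blast
qed


section \<open>The groups of the classification\<close>

text \<open>
  \<open>Q\<^sub>8 = {\<plusminus>1, \<plusminus>i, \<plusminus>j, \<plusminus>k}\<close> as a set of Hamilton quaternions; \<open>(a, b, c, d)\<close> is
  \<open>a + b i + c j + d k\<close>.
\<close>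

fun hamilton_mult ::
  "int \<times> int \<times> int \<times> int \<Rightarrow> int \<times> int \<times> int \<times> int \<Rightarrow> int \<times> int \<times> int \<times> int" where
  "hamilton_mult (a, b, c, d) (a', b', c', d') =
     (a * a' - b * b' - c * c' - d * d',
      a * b' + b * a' + c * d' - d * c',
      a * c' - b * d' + c * a' + d * b',
      a * d' + b * c' - c * b' + d * a')"

definition quaternion_group :: "(int \<times> int \<times> int \<times> int) monoid" where
  "quaternion_group =
     \<lparr> carrier = {(1, 0, 0, 0), (-1, 0, 0, 0), (0, 1, 0, 0), (0, -1, 0, 0),
                  (0, 0, 1, 0), (0, 0, -1, 0), (0, 0, 0, 1), (0, 0, 0, -1)},
       monoid.mult = hamilton_mult,
       one = (1, 0, 0, 0) \<rparr>"

lemma hamilton_mult_assoc: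
  "hamilton_mult (hamilton_mult u v) w = hamilton_mult u (hamilton_mult v w)"
  by (cases u; cases v; cases w) (simp add: algebra_simps)

lemma quaternion_group_is_group: "group quaternion_group"
proof (rule groupI)
  have "\<forall>u \<in> carrier quaternion_group. \<forall>v \<in> carrier quaternion_group.
          u \<otimes>\<^bsub>quaternion_group\<^esub> v \<in> carrier quaternion_group"
    by (simp add: quaternion_group_def)
  then show "u \<otimes>\<^bsub>quaternion_group\<^esub> v \<in> carrier quaternion_group"
    if "u \<in> carrier quaternion_group" "v \<in> carrier quaternion_group" for u v
    using that by blast
  have "\<forall>u \<in> carrier quaternion_group. \<exists>v \<in> carrier quaternion_group.
          v \<otimes>\<^bsub>quaternion_group\<^esub> u = \<one>\<^bsub>quaternion_group\<^esub>"
    by (simp add: quaternion_group_def)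
  then show "\<exists>v \<in> carrier quaternion_group. v \<otimes>\<^bsub>quaternion_group\<^esub> u = \<one>\<^bsub>quaternion_group\<^esub>"
    if "u \<in> carrier quaternion_group" for u
    using that by blast
  show "\<one>\<^bsub>quaternion_group\<^esub> \<otimes>\<^bsub>quaternion_group\<^esub> u = u" for u
    by (cases u) (simp add: quaternion_group_def)
  show "\<one>\<^bsub>quaternion_group\<^esub> \<in> carrier quaternion_group"
    by (simp add: quaternion_group_def)
  show "u \<otimes>\<^bsub>quaternion_group\<^esub> v \<otimes>\<^bsub>quaternion_group\<^esub> w =
      u \<otimes>\<^bsub>quaternion_group\<^esub> (v \<otimes>\<^bsub>quaternion_group\<^esub> w)" for u v w
    by (simp add: quaternion_group_def hamilton_mult_assoc)
qed

datatype gen3 = Gen_x | Gen_y | Gen_z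

abbreviation wx :: "gen3 word" where "wx \<equiv> [(Gen_x, True)]"
abbreviation wy :: "gen3 word" where "wy \<equiv> [(Gen_y, True)]"
abbreviation wz :: "gen3 word" where "wz \<equiv> [(Gen_z, True)]"

text \<open>
  \<open>\<langle>x, y, z | x\<^sup>4 = y\<^sup>4 = [y, z] = 1, x\<^sup>2 = z\<^sup>2 = [x, y], (x z)\<^sup>2 = y\<^sup>2\<rangle>\<close>
\<close>

definition group_ii :: "gen3 word set monoid" where
  "group_ii = presented_group
     {(wx ^\<^sub>w 4, []), (wy ^\<^sub>w 4, []), (word_comm wy wz, []),
      (wx ^\<^sub>w 2, wz ^\<^sub>w 2), (wz ^\<^sub>w 2, word_comm wx wy),
      ((wx @ wz) ^\<^sub>w 2, wy ^\<^sub>w 2)}"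

text \<open>
  \<open>\<langle>x, y, z | x\<^sup>4 = z\<^sup>4 = [y, z] = 1, x\<^sup>2 = y\<^sup>2 = [x, y], [x, z] = z\<^sup>2\<rangle>\<close>
\<close>

definition group_iii :: "gen3 word set monoid" where
  "group_iii = presented_group
     {(wx ^\<^sub>w 4, []), (wz ^\<^sub>w 4, []), (word_comm wy wz, []),
      (wx ^\<^sub>w 2, wy ^\<^sub>w 2), (wy ^\<^sub>w 2, word_comm wx wy),
      (word_comm wx wz, wz ^\<^sub>w 2)}"

text \<open>
  \<open>GL(3, \<int>\<^sub>m)\<close>, where a matrix over \<open>\<int>\<^sub>m\<close> is represented by the integer matrix whose entries are
  the residues in \<open>{0..<m}\<close>.
\<close>

definition GL3_mod :: "int \<Rightarrow> (int ^ 3 ^ 3) set" where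
  "GL3_mod m = {T. (\<forall>i j. T $ i $ j \<in> {0..<m}) \<and>
     (\<exists>S :: int ^ 3 ^ 3. \<forall>i j. [(T ** S) $ i $ j = mat 1 $ i $ j] (mod m) \<and>
                              [(S ** T) $ i $ j = mat 1 $ i $ j] (mod m))}"

text \<open>
  The group \<open>G(p, r, t, [t\<^sub>i\<^sub>j])\<close>, meant for \<open>p\<close> prime, \<open>1 \<le> t \<le> r\<close> and
  \<open>[t\<^sub>i\<^sub>j] \<in> GL(3, \<int>\<^sub>m)\<close> with \<open>m = p\<^sup>t\<close>.
\<close>

definition group_G :: "nat \<Rightarrow> nat \<Rightarrow> nat \<Rightarrow> int ^ 3 ^ 3 \<Rightarrow> gen3 word set monoid" where
  "group_G p r t T =
     (let q = int p ^ r; s = int p ^ t; n = int p ^ (r + t);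
          row = (\<lambda>i. wx ^\<^sub>w (q * T $ i $ 1) @ wy ^\<^sub>w (q * T $ i $ 2) @ wz ^\<^sub>w (q * T $ i $ 3))
      in presented_group
       {(wx ^\<^sub>w n, []), (wy ^\<^sub>w n, []), (wz ^\<^sub>w n, []),
        (word_comm (wx ^\<^sub>w s) wy, []), (word_comm (wx ^\<^sub>w s) wz, []),
        (word_comm (wy ^\<^sub>w s) wx, []), (word_comm (wy ^\<^sub>w s) wz, []),
        (word_comm (wz ^\<^sub>w s) wx, []), (word_comm (wz ^\<^sub>w s) wy, []),
        (word_comm wx wy, row 1), (word_comm wx wz, row 2), (word_comm wy wz, row 3)})"

end

theory Submission
  imports Defs "HOL-Analysis.Cartesian_Space"
begin

text \<open>
  Put \<open>n = 2\<^sup>r\<close>. The derived subgroup has exponent \<open>n\<close>, so it lies in \<open>\<Omega>\<^sub>r(G)\<close>, which is central; hence \<open>G\<close>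
  has class 2, and with \<open>x\<close>, \<open>y\<close>, \<open>z\<close> generating \<open>G\<close> the group \<open>G'\<close> consists of the products of powers
  of \<open>[x, y]\<close>, \<open>[x, z]\<close>, \<open>[y, z]\<close>. The map \<open>g \<mapsto> g\<^sup>n\<close> goes into \<open>G'\<close>, and \<open>g\<^sup>n = 1\<close> forces \<open>g\<close> to be
  central. Let \<open>d\<close> be the dimension of the space of \<open>(n/2)\<close>-th powers of elements of \<open>G'\<close>
  over the field of two elements.

  For \<open>r \<ge> 2\<close> the map \<open>g \<mapsto> g\<^sup>n\<close> is linear on the products of \<open>(n/2)\<close>-th powers of the generators. Its
  kernel consists of central elements; if \<open>d \<le> 2\<close> it is too large for that, and if \<open>d = 3\<close> it is
  trivial, so that \<open>x\<^sup>n\<close>, \<open>y\<^sup>n\<close>, \<open>z\<^sup>n\<close> is a basis of \<open>G'\<close>: this is case (iv).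
  For \<open>r = 1\<close> squaring is a quadratic map from \<open>G\<close> modulo \<open>G'\<close> to \<open>G'\<close> whose polar form is
  the commutator; \<open>d = 1\<close> gives (i), \<open>d = 2\<close> gives (ii) and (iii), and for \<open>d = 3\<close> some generating
  triple has independent squares, which is (iv) again.
\<close>

section \<open>Words in a group\<close>

text \<open>No order of a presented group is ever computed. The relations hold in \<open>G\<close>,
  so the presented group \<open>H\<close> maps onto \<open>G\<close>. Every element of
  \<open>H\<close> is collected to \<open>x^i y^j z^k\<close>; in \<open>G\<close> such a word can
  vanish only if \<open>n\<close> divides \<open>i\<close>, \<open>j\<close>, \<open>k\<close>,
  which is seen mostly by commuting it with generators. What is left is a comparison of relations
  between \<open>n\<close>-th powers. Independence is tested only on \<open>n/2\<close>-th powers,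
  where it is linear algebra over the field of two elements, and is lifted from there to the
  integers modulo \<open>n\<close>. A basis is then recognised by counting, since \<open>G'\<close>
  has at most \<open>n^3\<close> elements. The split at \<open>r = 1\<close> comes from
  \<open>(uv)^n = u^n v^n [v,u]^(n(n-1)/2)\<close>: for \<open>v\<close> an \<open>n/2\<close>-th
  power the correction has an exponent divisible by \<open>(n/2)^2\<close>, a multiple of
  \<open>n\<close> exactly for \<open>r \<ge> 2\<close>. At \<open>r = 1\<close> it survives and
  makes squaring quadratic, whence the exceptional groups. If \<open>d \<le> 2\<close>, a kernel
  element, being central, gives relations between the \<open>n/2\<close>-th powers of the
  commutators; after a change of generators that makes \<open>[y,z]^(n/2)\<close> trivial, these
  contradict the value of \<open>d\<close>.\<close>

lemma (in group) word_eval_inv: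
  assumes f: "\<And>a. f a \<in> carrier G"
  shows "word_eval G f (word_inv w) = inv (word_eval G f w)"
proof (induction w)
  case Nil
  show ?case by (simp add: word_eval_def word_inv_def)
next
  case (Cons l w)
  obtain a b where l: "l = (a, b)" by (cases l)
  have "word_inv (l # w) = word_inv w @ [(a, \<not> b)]" by (simp add: word_inv_def l)
  moreover have "word_eval G f (l # w) = (if b then f a else inv (f a)) \<otimes> word_eval G f w"
    by (simp add: word_eval_def l)
  moreover have "word_eval G f [(a, \<not> b)] = inv (if b then f a else inv (f a))"
    using f by (simp add: word_eval_def)
  ultimately show ?case
    using f word_eval_closed[of f w, OF f]
    by (simp only: word_eval_append[of f, OF f] Cons) (simp add: inv_mult_group)
qed

lemma (in group) word_eval_pow:
  assumes f: "\<And>a. f a \<in> carrier G"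
  shows "word_eval G f (w ^\<^sub>w k) = word_eval G f w [^] k"
proof -
  have nat: "word_eval G f (concat (replicate m v)) = word_eval G f v [^] m" for m v
  proof (induction m)
    case 0
    show ?case by (simp add: word_eval_def)
  next
    case (Suc m)
    have "word_eval G f v \<otimes> word_eval G f v [^] m = word_eval G f v [^] m \<otimes> word_eval G f v"
      using word_eval_closed[of f v, OF f] nat_pow_comm[of "word_eval G f v" 1 m] by simp
    with Suc show ?case by (simp add: word_eval_append[of f, OF f])
  qed
  show ?thesis
  proof (cases "0 \<le> k")
    case True
    then show ?thesis
      using nat[of "nat k" w] int_pow_int[of G "word_eval G f w" "nat k"]
      by (simp add: word_pow_def)
  next
    case False
    then have "word_eval G f w [^] k = inv (word_eval G f w [^] nat (- k))"
      using int_pow_neg_int[of "word_eval G f w" "nat (- k)"] word_eval_closed[of f w, OF f] by simp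
    with False show ?thesis
      using nat[of "nat (- k)" "word_inv w"] word_eval_closed[of f w, OF f]
      by (simp only: word_pow_def word_eval_inv[of f, OF f] nat_pow_inv if_False)
  qed
qed

lemma (in group) word_eval_comm:
  assumes f: "\<And>a. f a \<in> carrier G"
  shows "word_eval G f (word_comm u v) = commutator G (word_eval G f u) (word_eval G f v)"
  using word_eval_closed[of f u, OF f] word_eval_closed[of f v, OF f]
  unfolding word_comm_def commutator_def word_eval_append[of f, OF f] word_eval_inv[of f, OF f]
  by (simp add: m_assoc)

lemma word_class_inv:
  "word_class R (word_inv u) = inv\<^bsub>presented_group R\<^esub> word_class R u"
proof -
  interpret H: group "presented_group R" by (rule presented_group_is_group)
  have "word_class R (word_inv u) \<otimes>\<^bsub>presented_group R\<^esub> word_class R u = \<one>\<^bsub>presented_group R\<^esub>"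
    by (simp add: presented_group_one presented_group_mult word_class_eq_iff word_inv_equiv)
  then show ?thesis
    by (metis H.inv_equality presented_group_carrier rangeI)
qed

text \<open>With this, general facts about \<open>word_eval\<close> apply inside the presented group
  itself, so each defining relation becomes an equation between powers and commutators of the
  generators.\<close>

lemma word_class_eq_word_eval:
  "word_class R w = word_eval (presented_group R) (\<lambda>a. word_class R [(a, True)]) w"
proof (induction w)
  case Nil
  show ?case by (simp add: word_eval_def presented_group_one)
next
  case (Cons l w)
  obtain a b where l: "l = (a, b)" by (cases l)
  have "word_class R (l # w) = word_class R [l] \<otimes>\<^bsub>presented_group R\<^esub> word_class R w"
    by (simp add: presented_group_mult)
  moreover have "word_class R [(a, False)] = inv\<^bsub>presented_group R\<^esub> word_class R [(a, True)]"
    using word_class_inv[of R "[(a, True)]"] by (simp add: word_inv_def)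
  ultimately show ?case
    using Cons by (cases b) (simp_all add: l word_eval_def)
qed

lemma word_class_relation:
  assumes "(u, v) \<in> R"
  shows "word_eval (presented_group R) (\<lambda>a. word_class R [(a, True)]) u =
    word_eval (presented_group R) (\<lambda>a. word_class R [(a, True)]) v"
  using word_equiv.relation[OF assms]
  by (simp flip: word_class_eq_word_eval add: word_class_eq_iff)

lemma (in group) word_eval_in_generate:
  assumes "\<And>a. f a \<in> carrier G"
  shows "word_eval G f w \<in> generate G (range f)"
proof (induction w)
  case Nil
  show ?case by (simp add: word_eval_def generate.one)
next
  case (Cons l w)
  obtain a b where l: "l = (a, b)" by (cases l)
  have "(if b then f a else inv (f a)) \<in> generate G (range f)"
    by (auto intro: generate.incl generate.inv)
  with Cons show ?case by (simp add: word_eval_def l generate.eng)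
qed

lemma generate_presented_group:
  "generate (presented_group R) (range (\<lambda>a. word_class R [(a, True)])) = carrier (presented_group R)"
proof -
  interpret H: group "presented_group R" by (rule presented_group_is_group)
  have "word_class R w \<in> generate (presented_group R) (range (\<lambda>a. word_class R [(a, True)]))" for w
    by (subst word_class_eq_word_eval) (simp add: H.word_eval_in_generate presented_group_carrier)
  then show ?thesis
    using H.generate_incl[of "range (\<lambda>a. word_class R [(a, True)])"]
    by (auto simp: presented_group_carrier)
qed

lemma range_gen3: "range f = {f Gen_x, f Gen_y, f Gen_z}"
proof -
  have "UNIV = {Gen_x, Gen_y, Gen_z}"
    using gen3.exhaust by blast
  then show ?thesis by (metis image_empty image_insert)
qed


section \<open>Commutators and central elements\<close>

context group
begin

abbreviation comm :: "'a \<Rightarrow> 'a \<Rightarrow> 'a" where "comm \<equiv> commutator G"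
abbreviation ZZ :: "'a set" where "ZZ \<equiv> group_center G"

lemma comm_closed [simp, intro]:
  "g \<in> carrier G \<Longrightarrow> h \<in> carrier G \<Longrightarrow> comm g h \<in> carrier G"
  by (simp add: commutator_def)

lemma center_closed: "c \<in> ZZ \<Longrightarrow> c \<in> carrier G"
  by (simp add: group_center_def)

lemma center_comm: "c \<in> ZZ \<Longrightarrow> g \<in> carrier G \<Longrightarrow> g \<otimes> c = c \<otimes> g"
  by (simp add: group_center_def)

lemma center_lcomm:
  "c \<in> ZZ \<Longrightarrow> g \<in> carrier G \<Longrightarrow> h \<in> carrier G \<Longrightarrow> g \<otimes> (c \<otimes> h) = c \<otimes> (g \<otimes> h)"
  by (simp add: center_comm center_closed flip: m_assoc)

lemma subgroup_center: "subgroup ZZ G"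
proof
  show "inv c \<in> ZZ" if "c \<in> ZZ" for c
  proof -
    have c: "c \<in> carrier G" using that by (rule center_closed)
    have "inv c \<otimes> g = g \<otimes> inv c" if g: "g \<in> carrier G" for g
      using center_comm[OF \<open>c \<in> ZZ\<close> g] c g
      by (metis inv_closed inv_solve_left inv_solve_right m_assoc m_closed)
    then show ?thesis using c by (simp add: group_center_def)
  qed
  show "c \<otimes> d \<in> ZZ" if "c \<in> ZZ" "d \<in> ZZ" for c d
  proof -
    have "c \<otimes> d \<otimes> g = g \<otimes> (c \<otimes> d)" if g: "g \<in> carrier G" for g
      using center_comm[OF \<open>d \<in> ZZ\<close> g] center_lcomm[OF \<open>c \<in> ZZ\<close> g, of d]
        center_closed[OF \<open>c \<in> ZZ\<close>] center_closed[OF \<open>d \<in> ZZ\<close>] g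
      by (simp add: m_assoc)
    moreover have "c \<otimes> d \<in> carrier G" using that by (simp add: center_closed)
    ultimately show ?thesis unfolding group_center_def by blast
  qed
qed (auto simp: group_center_def)

lemma center_one [simp]: "\<one> \<in> ZZ"
  by (rule subgroup.one_closed[OF subgroup_center])

lemma center_mult: "c \<in> ZZ \<Longrightarrow> d \<in> ZZ \<Longrightarrow> c \<otimes> d \<in> ZZ"
  by (rule subgroup.m_closed[OF subgroup_center])

lemma center_inv: "c \<in> ZZ \<Longrightarrow> inv c \<in> ZZ"
  by (rule subgroup.m_inv_closed[OF subgroup_center])

lemma center_pow: "c \<in> ZZ \<Longrightarrow> c [^] (k::int) \<in> ZZ"
  by (rule subgroup_int_pow_closed[OF subgroup_center])

lemma mult_comm_eq:
  "g \<in> carrier G \<Longrightarrow> h \<in> carrier G \<Longrightarrow> h \<otimes> g \<otimes> comm g h = g \<otimes> h"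
  by (simp add: commutator_def m_assoc) (simp add: inv_solve_left flip: m_assoc)

text \<open>Identifies a commutator by one product equation without inverses; the commutators of the
  presented groups and of the quaternion example are computed this way.\<close>

lemma comm_eqI:
  "g \<in> carrier G \<Longrightarrow> h \<in> carrier G \<Longrightarrow> c \<in> carrier G \<Longrightarrow> g \<otimes> h = h \<otimes> g \<otimes> c \<Longrightarrow> comm g h = c"
  by (metis comm_closed l_cancel m_closed mult_comm_eq)

lemma comm_eq_one_iff:
  "g \<in> carrier G \<Longrightarrow> h \<in> carrier G \<Longrightarrow> comm g h = \<one> \<longleftrightarrow> g \<otimes> h = h \<otimes> g"
  by (metis comm_eqI mult_comm_eq one_closed m_closed r_one)

lemma comm_self: "g \<in> carrier G \<Longrightarrow> comm g g = \<one>"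
  by (simp add: comm_eq_one_iff)

lemma comm_swap: "g \<in> carrier G \<Longrightarrow> h \<in> carrier G \<Longrightarrow> comm h g = inv (comm g h)"
  by (simp add: commutator_def inv_mult_group m_assoc)

text \<open>In any group \<open>[g g', h]\<close> is the conjugate of \<open>[g, h]\<close> by
  \<open>g'\<close>, times \<open>[g', h]\<close>. Only the commutator that gets conjugated has to
  be central.\<close>

lemma comm_mult_left:
  assumes "g \<in> carrier G" "g' \<in> carrier G" "h \<in> carrier G" "comm g h \<in> ZZ"
  shows "comm (g \<otimes> g') h = comm g h \<otimes> comm g' h"
proof (rule comm_eqI)
  have "g \<otimes> g' \<otimes> h = g \<otimes> (h \<otimes> g' \<otimes> comm g' h)"
    using assms by (simp only: m_assoc mult_comm_eq m_closed)
  also have "\<dots> = (h \<otimes> g \<otimes> comm g h) \<otimes> (g' \<otimes> comm g' h)"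
    using assms by (simp only: mult_comm_eq[of g h]) (simp add: m_assoc)
  also have "\<dots> = h \<otimes> (g \<otimes> g') \<otimes> (comm g h \<otimes> comm g' h)"
    using assms center_lcomm[of "comm g h" g' "comm g' h"] by (simp add: m_assoc)
  finally show "g \<otimes> g' \<otimes> h = h \<otimes> (g \<otimes> g') \<otimes> (comm g h \<otimes> comm g' h)" .
qed (use assms in auto)

lemma comm_inv_left:
  assumes "g \<in> carrier G" "h \<in> carrier G" "comm g h \<in> ZZ"
  shows "comm (inv g) h = inv (comm g h)"
proof -
  have "\<one> = comm g h \<otimes> comm (inv g) h"
    using comm_mult_left[of g "inv g" h] comm_eq_one_iff[of \<one> h] assms by simp
  then show ?thesis
    using assms by (metis comm_closed inv_closed inv_equality inv_inv)
qed

lemma comm_pow_left: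
  assumes g: "g \<in> carrier G" and h: "h \<in> carrier G" and c: "comm g h \<in> ZZ"
  shows "comm (g [^] (k::int)) h = comm g h [^] k"
proof (cases k rule: int_cases2)
  have nat: "comm (g [^] (m::nat)) h = comm g h [^] m" for m
  proof (induction m)
    case 0
    then show ?case using h by (simp add: comm_eq_one_iff)
  next
    case (Suc m)
    have "comm (g \<otimes> g [^] m) h = comm g h \<otimes> comm g h [^] m"
      using Suc assms by (simp add: comm_mult_left)
    moreover have "g \<otimes> g [^] m = g [^] Suc m" "comm g h \<otimes> comm g h [^] m = comm g h [^] Suc m"
      using assms nat_pow_comm[of g 1 m] nat_pow_comm[of "comm g h" 1 m] by simp_all
    ultimately show ?case by simp
  qed
  {
    case (nonneg m)
    then show ?thesis using nat by (simp add: int_pow_int)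
  next
    case (nonpos m)
    have "comm (g [^] m) h \<in> ZZ"
      using nat[of m] center_pow[OF c, of "int m"] by (simp add: int_pow_int)
    then show ?thesis
      using nonpos nat assms by (simp add: int_pow_neg_int comm_inv_left)
  }
qed

lemma comm_mult_right:
  assumes "g \<in> carrier G" "h \<in> carrier G" "h' \<in> carrier G" "comm g h \<in> ZZ"
  shows "comm g (h \<otimes> h') = comm g h \<otimes> comm g h'"
proof -
  have "comm h g \<in> ZZ" using assms comm_swap[of g h] by (simp add: center_inv)
  then show ?thesis
    using assms comm_swap[of "h \<otimes> h'" g] comm_swap[of h g] comm_swap[of h' g]
    by (simp add: comm_mult_left inv_mult_group center_comm center_inv)
qed

lemma comm_pow_right:
  assumes "g \<in> carrier G" "h \<in> carrier G" "comm g h \<in> ZZ"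
  shows "comm g (h [^] (k::int)) = comm g h [^] k"
proof -
  have "comm h g \<in> ZZ" using assms comm_swap[of g h] by (simp add: center_inv)
  then show ?thesis
    using assms comm_swap[of "h [^] k" g] comm_swap[of h g]
    by (simp add: comm_pow_left int_pow_inv)
qed

lemma pow_comm_shift:
  assumes "g \<in> carrier G" "h \<in> carrier G" "comm g h \<in> ZZ"
  shows "g [^] (k::int) \<otimes> h = h \<otimes> g [^] k \<otimes> comm g h [^] k"
proof -
  have "h \<otimes> g [^] k \<otimes> comm (g [^] k) h = g [^] k \<otimes> h"
    by (rule mult_comm_eq) (use assms in auto)
  then show ?thesis by (simp only: comm_pow_left[OF assms])
qed

end

section \<open>Normal forms\<close>

text \<open>Serves two purposes: as the collected form of a word in three non-commuting generators,
  and, for central arguments, as an integer linear combination written multiplicatively.\<close>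

definition monom3 :: "('a, 'b) monoid_scheme \<Rightarrow> 'a \<Rightarrow> 'a \<Rightarrow> 'a \<Rightarrow> int \<Rightarrow> int \<Rightarrow> int \<Rightarrow> 'a" where
  "monom3 G x y z i j k = x [^]\<^bsub>G\<^esub> i \<otimes>\<^bsub>G\<^esub> y [^]\<^bsub>G\<^esub> j \<otimes>\<^bsub>G\<^esub> z [^]\<^bsub>G\<^esub> k"

context group
begin

lemma monom3_closed [simp, intro]:
  "x \<in> carrier G \<Longrightarrow> y \<in> carrier G \<Longrightarrow> z \<in> carrier G \<Longrightarrow> monom3 G x y z i j k \<in> carrier G"
  by (simp add: monom3_def)

lemma monom3_center:
  "x \<in> ZZ \<Longrightarrow> y \<in> ZZ \<Longrightarrow> z \<in> ZZ \<Longrightarrow> monom3 G x y z i j k \<in> ZZ"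
  by (simp add: monom3_def center_mult center_pow)

text \<open>Only the powers in the right factor are central; the left factor may be any collected
  word, which can thus absorb central powers without producing commutators.\<close>

lemma monom3_mult_center:
  assumes "x \<in> carrier G" "y \<in> carrier G" "z \<in> carrier G"
    and "x [^] i' \<in> ZZ" "y [^] j' \<in> ZZ" "z [^] k' \<in> ZZ"
  shows "monom3 G x y z i j k \<otimes> monom3 G x y z i' j' k' = monom3 G x y z (i + i') (j + j') (k + k')"
proof -
  let ?X = "x [^] i'" and ?Y = "y [^] j'" and ?Z = "z [^] k'"
  have "monom3 G x y z i j k \<otimes> monom3 G x y z i' j' k' =
      x [^] i \<otimes> (y [^] j \<otimes> (z [^] k \<otimes> (?X \<otimes> (?Y \<otimes> ?Z))))"
    using assms by (simp add: monom3_def m_assoc)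
  also have "\<dots> = x [^] i \<otimes> (y [^] j \<otimes> (?X \<otimes> (?Y \<otimes> (z [^] k \<otimes> ?Z))))"
    using assms by (simp only: center_lcomm[of _ "z [^] k"] m_closed int_pow_closed)
  also have "\<dots> = x [^] i \<otimes> (?X \<otimes> (y [^] j \<otimes> (?Y \<otimes> (z [^] k \<otimes> ?Z))))"
    using assms by (simp only: center_lcomm[of ?X "y [^] j"] m_closed int_pow_closed)
  also have "\<dots> = (x [^] i \<otimes> ?X) \<otimes> ((y [^] j \<otimes> ?Y) \<otimes> (z [^] k \<otimes> ?Z))"
    using assms by (simp add: m_assoc)
  also have "\<dots> = monom3 G x y z (i + i') (j + j') (k + k')"
    using assms by (simp add: monom3_def int_pow_mult m_assoc)
  finally show ?thesis .
qed

lemma monom3_mult: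
  "x \<in> ZZ \<Longrightarrow> y \<in> ZZ \<Longrightarrow> z \<in> ZZ \<Longrightarrow>
    monom3 G x y z i j k \<otimes> monom3 G x y z i' j' k' = monom3 G x y z (i + i') (j + j') (k + k')"
  by (rule monom3_mult_center) (auto intro: center_closed center_pow)

lemma monom3_zero [simp]: "monom3 G x y z 0 0 0 = \<one>"
  by (simp add: monom3_def)

lemma monom3_inv:
  assumes "x \<in> ZZ" "y \<in> ZZ" "z \<in> ZZ"
  shows "inv (monom3 G x y z i j k) = monom3 G x y z (- i) (- j) (- k)"
  using monom3_mult[of x y z "- i" "- j" "- k" i j k] assms
  by (intro inv_equality) (auto intro: center_closed)

lemma monom3_pow:
  assumes "x \<in> ZZ" "y \<in> ZZ" "z \<in> ZZ"
  shows "monom3 G x y z i j k [^] (m::int) = monom3 G x y z (i * m) (j * m) (k * m)"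
proof -
  let ?X = "x [^] i" and ?Y = "y [^] j" and ?Z = "z [^] k"
  have c: "?X \<in> ZZ" "?Y \<in> ZZ" "?Z \<in> ZZ" using assms by (auto intro: center_pow)
  note c' = c[THEN center_closed]
  have "(?X \<otimes> ?Y \<otimes> ?Z) [^] m = (?X \<otimes> ?Y) [^] m \<otimes> ?Z [^] m"
    using c c' by (intro int_pow_mult_distrib center_comm) auto
  also have "(?X \<otimes> ?Y) [^] m = ?X [^] m \<otimes> ?Y [^] m"
    using c c' by (intro int_pow_mult_distrib center_comm) auto
  finally show ?thesis
    using assms[THEN center_closed] by (simp add: monom3_def int_pow_pow)
qed

lemma monom3_subgroup:
  assumes "x \<in> ZZ" "y \<in> ZZ" "z \<in> ZZ"
  shows "subgroup (range (\<lambda>(i, j, k). monom3 G x y z i j k)) G"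
proof
  show "range (\<lambda>(i, j, k). monom3 G x y z i j k) \<subseteq> carrier G"
    using assms by (auto intro: center_closed)
  have "\<one> = (\<lambda>(i, j, k). monom3 G x y z i j k) (0, 0, 0)" by simp
  then show "\<one> \<in> range (\<lambda>(i, j, k). monom3 G x y z i j k)" by blast
next
  fix g h
  assume "g \<in> range (\<lambda>(i, j, k). monom3 G x y z i j k)" "h \<in> range (\<lambda>(i, j, k). monom3 G x y z i j k)"
  then obtain i j k i' j' k' where "g = monom3 G x y z i j k" "h = monom3 G x y z i' j' k'"
    by auto
  then have "g \<otimes> h = (\<lambda>(i, j, k). monom3 G x y z i j k) (i + i', j + j', k + k')"
    using assms by (simp add: monom3_mult)
  then show "g \<otimes> h \<in> range (\<lambda>(i, j, k). monom3 G x y z i j k)" by blast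
next
  fix g
  assume "g \<in> range (\<lambda>(i, j, k). monom3 G x y z i j k)"
  then obtain i j k where "g = monom3 G x y z i j k" by auto
  then have "inv g = (\<lambda>(i, j, k). monom3 G x y z i j k) (- i, - j, - k)"
    using assms by (simp add: monom3_inv)
  then show "inv g \<in> range (\<lambda>(i, j, k). monom3 G x y z i j k)" by blast
qed

section \<open>Collecting words, and isomorphism with a presented group\<close>

lemma generate_right_induct:
  assumes "g \<in> generate G S" and S: "S \<subseteq> carrier G"
    and "P \<one>"
    and step: "\<And>g s (e::int). g \<in> carrier G \<Longrightarrow> P g \<Longrightarrow> s \<in> S \<Longrightarrow> P (g \<otimes> s [^] e)"
  shows "P g"
proof -
  \<comment> \<open>An arbitrary left factor is carried along, so that the product case of
    \<open>generate\<close> is handled by applying the two induction hypotheses one after the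
    other.\<close>
  have "\<forall>h \<in> carrier G. P h \<longrightarrow> P (h \<otimes> g)"
    using assms(1)
  proof induction
    case one
    then show ?case by simp
  next
    case (incl s)
    then show ?case using step[of _ s 1] S by auto
  next
    case (inv s)
    then show ?case using step[of _ s "-1"] S by (auto simp: int_pow_neg)
  next
    case (eng g1 g2)
    then have "g1 \<in> carrier G" "g2 \<in> carrier G" using S generate_in_carrier by auto
    with eng show ?case by (simp flip: m_assoc)
  qed
  moreover have "g \<in> carrier G" using assms(1) S generate_in_carrier by blast
  ultimately show ?thesis using \<open>P \<one>\<close> by auto
qed

text \<open>Collection from the right: a new power \<open>s [^] e\<close> is moved left past the
  later generators. The commutators that arise lie in the central subgroup \<open>N\<close>
  generated by the \<open>n\<close>-th powers of the generators, and are absorbed by adding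
  multiples of \<open>n\<close> to the exponents. Finiteness does not enter, so the lemma applies to
  a presented group of unknown size.\<close>

lemma monom3_normal_form:
  fixes n :: int
  assumes xyz: "x \<in> carrier G" "y \<in> carrier G" "z \<in> carrier G"
    and gen: "generate G {x, y, z} = carrier G"
    and pow: "x [^] n \<in> ZZ" "y [^] n \<in> ZZ" "z [^] n \<in> ZZ"
    and c1: "comm x y = monom3 G x y z (n * i1) (n * j1) (n * k1)"
    and c2: "comm x z = monom3 G x y z (n * i2) (n * j2) (n * k2)"
    and c3: "comm y z = monom3 G x y z (n * i3) (n * j3) (n * k3)"
    and g: "g \<in> carrier G"
  shows "\<exists>i j k. g = monom3 G x y z i j k"
proof -
  have powm: "x [^] (n * m) \<in> ZZ" "y [^] (n * m) \<in> ZZ" "z [^] (n * m) \<in> ZZ" for m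
    using pow xyz by (simp_all flip: int_pow_pow add: center_pow)
  define N where "N = range (\<lambda>(i, j, k). monom3 G (x [^] n) (y [^] n) (z [^] n) i j k)"
  have N: "subgroup N G"
    unfolding N_def using pow by (rule monom3_subgroup)
  have mN: "monom3 G x y z (n * i) (n * j) (n * k) \<in> N" for i j k
  proof -
    have "monom3 G x y z (n * i) (n * j) (n * k) = (\<lambda>(i, j, k). monom3 G (x [^] n) (y [^] n) (z [^] n) i j k) (i, j, k)"
      using xyz by (simp add: monom3_def int_pow_pow)
    then show ?thesis unfolding N_def by blast
  qed
  have NZ: "N \<subseteq> ZZ" using pow by (auto simp: N_def monom3_center)
  define S where "S = range (\<lambda>(i, j, k). monom3 G x y z i j k)"
  have SI: "monom3 G x y z i j k \<in> S" for i j k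
    using rangeI[of "\<lambda>(i, j, k). monom3 G x y z i j k" "(i, j, k)"] by (simp add: S_def)
  have SN: "g \<otimes> c \<in> S" if gc: "g \<in> S" "c \<in> N" for g c
  proof -
    obtain i j k i' j' k' where g: "g = monom3 G x y z i j k"
      and c: "c = monom3 G (x [^] n) (y [^] n) (z [^] n) i' j' k'"
      using gc by (auto simp: S_def N_def)
    have "c = monom3 G x y z (n * i') (n * j') (n * k')"
      using xyz by (simp add: c monom3_def int_pow_pow)
    then have "g \<otimes> c = monom3 G x y z (i + n * i') (j + n * j') (k + n * k')"
      using xyz powm by (simp only: g monom3_mult_center)
    then show ?thesis by (simp add: SI)
  qed
  have commN: "comm y x \<in> N" "comm z x \<in> N" "comm z y \<in> N"
    using c1 c2 c3 xyz comm_swap[of x y] comm_swap[of x z] comm_swap[of y z]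
    by (simp_all add: subgroup.m_inv_closed[OF N] mN)
  have commpow: "comm (g [^] i) (h [^] e) \<in> N"
    if "comm g h \<in> N" "g \<in> carrier G" "h \<in> carrier G" for g h and i e :: int
  proof -
    have c: "comm g h \<in> ZZ" using that NZ by blast
    have "comm g (h [^] e) = comm g h [^] e" using that c by (simp add: comm_pow_right)
    moreover have "comm g h [^] e \<in> ZZ" using c by (rule center_pow)
    ultimately have "comm (g [^] i) (h [^] e) = (comm g h [^] e) [^] i"
      using that by (simp add: comm_pow_left)
    with that show ?thesis by (simp add: subgroup_int_pow_closed[OF N])
  qed
  have "g \<in> S"
  proof (rule generate_right_induct[of g "{x, y, z}"])
    show "g \<in> generate G {x, y, z}" using g gen by simp
    show "{x, y, z} \<subseteq> carrier G" using xyz by simp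
    show "\<one> \<in> S" using SI[of 0 0 0] by simp
    fix g s and e :: int
    assume "g \<in> S" and s: "s \<in> {x, y, z}"
    then obtain i j k where g: "g = monom3 G x y z i j k" by (auto simp: S_def)
    let ?X = "x [^] i" and ?Y = "y [^] j" and ?Z = "z [^] k"
    consider "s = x" | "s = y" | "s = z" using s by blast
    then show "g \<otimes> s [^] e \<in> S"
    proof cases
      case 1
      \<comment> \<open>A power of \<open>x\<close> has to pass both \<open>?Z\<close> and
        \<open>?Y\<close>, leaving \<open>?d\<close> and \<open>?c\<close>; a power of
        \<open>y\<close> passes only \<open>?Z\<close>, and a power of \<open>z\<close>
        nothing.\<close>
      let ?c = "comm ?Y (x [^] e)" and ?d = "comm ?Z (x [^] e)"
      have cd: "?c \<in> N" "?d \<in> N" using commN xyz by (simp_all add: commpow)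
      then have "?c \<in> ZZ" "?d \<in> ZZ" using NZ by auto
      have d: "?Z \<otimes> x [^] e = x [^] e \<otimes> ?Z \<otimes> ?d" and c: "?Y \<otimes> x [^] e = x [^] e \<otimes> ?Y \<otimes> ?c"
        using xyz by (simp_all only: mult_comm_eq int_pow_closed)
      have cZ: "?c \<otimes> (?Z \<otimes> ?d) = ?Z \<otimes> (?c \<otimes> ?d)"
        using xyz \<open>?c \<in> ZZ\<close> by (intro center_lcomm[symmetric]) auto
      have "g \<otimes> s [^] e = ?X \<otimes> (?Y \<otimes> (?Z \<otimes> x [^] e))"
        using xyz by (simp add: g 1 monom3_def m_assoc)
      also have "\<dots> = ?X \<otimes> ((?Y \<otimes> x [^] e) \<otimes> (?Z \<otimes> ?d))"
        using xyz by (simp only: d) (simp add: m_assoc)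
      also have "\<dots> = ?X \<otimes> (x [^] e \<otimes> (?Y \<otimes> (?c \<otimes> (?Z \<otimes> ?d))))"
        using xyz by (simp only: c) (simp add: m_assoc)
      also have "\<dots> = monom3 G x y z (i + e) j k \<otimes> ?c \<otimes> ?d"
        using xyz by (simp only: cZ) (simp add: monom3_def int_pow_mult m_assoc)
      finally show ?thesis using cd by (simp add: SN SI)
    next
      case 2
      let ?d = "comm ?Z (y [^] e)"
      have d: "?d \<in> N" using commN xyz by (simp add: commpow)
      have "g \<otimes> s [^] e = ?X \<otimes> (?Y \<otimes> (?Z \<otimes> y [^] e))"
        using xyz by (simp add: g 2 monom3_def m_assoc)
      also have "?Z \<otimes> y [^] e = y [^] e \<otimes> ?Z \<otimes> ?d"
        using xyz by (simp only: mult_comm_eq int_pow_closed)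
      also have "?X \<otimes> (?Y \<otimes> (y [^] e \<otimes> ?Z \<otimes> ?d)) = monom3 G x y z i (j + e) k \<otimes> ?d"
        using xyz by (simp add: monom3_def int_pow_mult m_assoc)
      finally show ?thesis using d by (simp add: SN SI)
    next
      case 3
      have "g \<otimes> s [^] e = monom3 G x y z i j (k + e)"
        using xyz by (simp add: g 3 monom3_def int_pow_mult m_assoc)
      then show ?thesis by (simp add: SI)
    qed
  qed
  then show ?thesis by (auto simp: S_def)
qed

text \<open>The canonical map from \<open>H\<close> is onto because \<open>x\<close>,
  \<open>y\<close>, \<open>z\<close> generate \<open>G\<close>. Injectivity is split in two:
  \<open>kernel1\<close>, a statement about \<open>G\<close> alone, forces a kernel element in
  normal form to have exponents divisible by \<open>n\<close>; \<open>kernel2\<close> says that a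
  relation of \<open>G\<close> between \<open>n\<close>-th powers already follows from the
  presentation.\<close>

lemma presented_group_iso:
  fixes n :: int and R :: "(gen3 word \<times> gen3 word) set"
  defines "H \<equiv> presented_group R"
    and "xH \<equiv> word_class R wx" and "yH \<equiv> word_class R wy" and "zH \<equiv> word_class R wz"
  assumes xyz: "x \<in> carrier G" "y \<in> carrier G" "z \<in> carrier G"
    and gen: "generate G {x, y, z} = carrier G"
    and R: "\<And>u v. (u, v) \<in> R \<Longrightarrow>
      word_eval G (case_gen3 x y z) u = word_eval G (case_gen3 x y z) v"
    and pow: "xH [^]\<^bsub>H\<^esub> n \<in> group_center H" "yH [^]\<^bsub>H\<^esub> n \<in> group_center H" "zH [^]\<^bsub>H\<^esub> n \<in> group_center H"
    and c: "commutator H xH yH = monom3 H xH yH zH (n * i1) (n * j1) (n * k1)"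
      "commutator H xH zH = monom3 H xH yH zH (n * i2) (n * j2) (n * k2)"
      "commutator H yH zH = monom3 H xH yH zH (n * i3) (n * j3) (n * k3)"
    and kernel1: "\<And>i j k. monom3 G x y z i j k = \<one> \<Longrightarrow> n dvd i \<and> n dvd j \<and> n dvd k"
    and kernel2: "\<And>i j k. monom3 G x y z (n * i) (n * j) (n * k) = \<one> \<Longrightarrow>
      monom3 H xH yH zH (n * i) (n * j) (n * k) = \<one>\<^bsub>H\<^esub>"
  shows "G \<cong> H"
proof -
  interpret H: group H unfolding H_def by (rule presented_group_is_group)
  have f: "case_gen3 x y z a \<in> carrier G" for a using xyz by (cases a) auto
  obtain \<phi> where hom: "\<phi> \<in> hom H G"
    and \<phi>: "\<And>w. \<phi> (word_class R w) = word_eval G (case_gen3 x y z) w"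
    using presented_group_hom[of "case_gen3 x y z" R, OF f R] unfolding H_def by blast
  interpret \<phi>: group_hom H G \<phi> using hom by unfold_locales
  have XYZ: "xH \<in> carrier H" "yH \<in> carrier H" "zH \<in> carrier H"
    by (simp_all add: xH_def yH_def zH_def H_def presented_group_carrier)
  have genH: "generate H {xH, yH, zH} = carrier H"
    using generate_presented_group[of R] by (simp only: range_gen3 xH_def yH_def zH_def H_def)
  have \<phi>xH: "\<phi> xH = x" "\<phi> yH = y" "\<phi> zH = z"
    using xyz by (simp_all add: xH_def yH_def zH_def \<phi> word_eval_def)
  have \<phi>m: "\<phi> (monom3 H xH yH zH i j k) = monom3 G x y z i j k" for i j k
    using XYZ by (simp add: monom3_def \<phi>.hom_int_pow \<phi>xH)
  have "\<phi> ` carrier H = carrier G"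
    using \<phi>.generate_img[of "{xH, yH, zH}"] XYZ by (simp add: genH gen \<phi>xH)
  moreover have "g = \<one>\<^bsub>H\<^esub>" if g1: "g \<in> carrier H" and g2: "\<phi> g = \<one>" for g
  proof -
    obtain i j k where g: "g = monom3 H xH yH zH i j k"
      using H.monom3_normal_form[OF XYZ genH pow c g1] by blast
    have "monom3 G x y z i j k = \<one>" using g2 g \<phi>m by simp
    moreover from kernel1[OF this] obtain i' j' k' where "i = n * i'" "j = n * j'" "k = n * k'"
      by (auto elim!: dvdE)
    ultimately show ?thesis using kernel2 g by simp
  qed
  then have "inj_on \<phi> (carrier H)"
    by (intro \<phi>.inj_on_one_iff[THEN iffD2]) blast
  ultimately have "\<phi> \<in> iso H G" using hom by (auto simp: iso_def bij_betw_def)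
  then have "H \<cong> G" by (auto simp: is_iso_def)
  then show ?thesis by (rule H.iso_sym)
qed

end

section \<open>Recognising the groups of the classification\<close>

lemma word_eval_Nil: "word_eval G f [] = \<one>\<^bsub>G\<^esub>"
  by (simp add: word_eval_def)

lemma word_eval_Cons:
  "word_eval G f ((a, b) # w) = (if b then f a else inv\<^bsub>G\<^esub> f a) \<otimes>\<^bsub>G\<^esub> word_eval G f w"
  by (simp add: word_eval_def)

lemmas (in group) word_eval_simps =
  word_eval_append word_eval_pow word_eval_comm

lemma (in group) center_if_generators:
  assumes gen: "generate G S = carrier G" and S: "S \<subseteq> carrier G"
    and c: "c \<in> carrier G" and comm: "\<And>s. s \<in> S \<Longrightarrow> c \<otimes> s = s \<otimes> c"
  shows "c \<in> ZZ"
proof -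
  have "c \<otimes> g = g \<otimes> c" if "g \<in> generate G S" for g
    using that
  proof induction
    case one
    then show ?case using c by simp
  next
    case (incl s)
    then show ?case by (rule comm)
  next
    case (inv s)
    then have "s \<in> carrier G" using S by blast
    moreover from this have "commutator G s c = \<one>"
      using comm[OF inv] c by (simp add: comm_eq_one_iff)
    ultimately have "commutator G (inv s) c = \<one>" using c by (simp add: comm_inv_left)
    with c \<open>s \<in> carrier G\<close> show ?case by (simp add: comm_eq_one_iff)
  next
    case (eng g h)
    have gh: "g \<in> carrier G" "h \<in> carrier G"
      by (rule generate_in_carrier[OF S eng.hyps(1)], rule generate_in_carrier[OF S eng.hyps(2)])
    then have "commutator G g c = \<one>" "commutator G h c = \<one>"
      using eng.IH[symmetric] c by (simp_all only: comm_eq_one_iff)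
    then have "commutator G (g \<otimes> h) c = \<one>"
      using comm_mult_left[OF gh c] by (simp only: center_one r_one one_closed)
    with c gh show ?case by (simp only: comm_eq_one_iff m_closed)
  qed
  then show ?thesis using c unfolding gen group_center_def by blast
qed

lemma (in group) commutes_with_pow:
  "g \<in> carrier G \<Longrightarrow> h \<in> carrier G \<Longrightarrow> g \<otimes> h = h \<otimes> g \<Longrightarrow> g [^] (k::int) \<otimes> h = h \<otimes> g [^] k"
proof -
  assume gh: "g \<in> carrier G" "h \<in> carrier G" and "g \<otimes> h = h \<otimes> g"
  then have "comm g h = \<one>" by (simp only: comm_eq_one_iff)
  then show ?thesis using pow_comm_shift[of g h k] gh by simp
qed

text \<open>Names the classes of the three letters as elements of \<open>H\<close>, so that the
  relations can be used as equations in an ordinary group.\<close>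

locale gen3_presentation = group H
  for R :: "(gen3 word \<times> gen3 word) set" and H :: "gen3 word set monoid" (structure) and x y z +
  assumes H: "H = presented_group R"
    and gens: "x = word_class R wx" "y = word_class R wy" "z = word_class R wz"
begin

lemma gens_closed [simp]: "x \<in> carrier H" "y \<in> carrier H" "z \<in> carrier H"
  by (simp_all add: gens H presented_group_carrier)

lemma generate_gens: "generate H {x, y, z} = carrier H"
  using generate_presented_group[of R] by (simp only: range_gen3 gens H)

lemma relation:
  assumes "(u, v) \<in> R"
  shows "word_eval H (case_gen3 x y z) u = word_eval H (case_gen3 x y z) v"
proof -
  have "case_gen3 x y z = (\<lambda>a. word_class R [(a, True)])"
    by (rule ext) (simp add: gens split: gen3.split)
  with word_class_relation[OF assms] show ?thesis by (simp only: H)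
qed

lemma val_closed: "case_gen3 x y z a \<in> carrier H"
  by (cases a) simp_all

lemma centerI:
  assumes "c \<in> carrier H" "c \<otimes> x = x \<otimes> c" "c \<otimes> y = y \<otimes> c" "c \<otimes> z = z \<otimes> c"
  shows "c \<in> ZZ"
  using assms by (intro center_if_generators[OF generate_gens]) auto

end

lemma gen3_presentation:
  "gen3_presentation R (presented_group R) (word_class R wx) (word_class R wy) (word_class R wz)"
proof -
  interpret group "presented_group R" by (rule presented_group_is_group)
  show ?thesis by unfold_locales simp_all
qed

text \<open>In the presented group the relations make the \<open>n\<close>-th powers of the
  generators central of order dividing \<open>n\<close>, so a monomial in them is trivial once its
  exponents are multiples of \<open>n\<close>. By the last hypothesis a monomial in the
  \<open>n\<close>-th powers is trivial in \<open>G\<close> only under the same condition.\<close>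

lemma (in group) iso_group_G:
  fixes T :: "int ^ 3 ^ 3" and r :: nat
  defines "n \<equiv> 2 ^ r :: int"
  assumes xyz: "x \<in> carrier G" "y \<in> carrier G" "z \<in> carrier G"
    and gen: "generate G {x, y, z} = carrier G"
    and pow: "x [^] n \<in> ZZ" "y [^] n \<in> ZZ" "z [^] n \<in> ZZ"
    and pow2: "x [^] (n * n) = \<one>" "y [^] (n * n) = \<one>" "z [^] (n * n) = \<one>"
    and c: "comm x y = monom3 G x y z (n * T $ 1 $ 1) (n * T $ 1 $ 2) (n * T $ 1 $ 3)"
      "comm x z = monom3 G x y z (n * T $ 2 $ 1) (n * T $ 2 $ 2) (n * T $ 2 $ 3)"
      "comm y z = monom3 G x y z (n * T $ 3 $ 1) (n * T $ 3 $ 2) (n * T $ 3 $ 3)"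
    and kernel1: "\<And>i j k. monom3 G x y z i j k = \<one> \<Longrightarrow> n dvd i \<and> n dvd j \<and> n dvd k"
    and kernel2: "\<And>i j k. monom3 G x y z (n * i) (n * j) (n * k) = \<one> \<Longrightarrow> n dvd i \<and> n dvd j \<and> n dvd k"
  shows "G \<cong> group_G 2 r r T"
proof -
  define row where "row i = wx ^\<^sub>w (n * T $ i $ 1) @ wy ^\<^sub>w (n * T $ i $ 2) @ wz ^\<^sub>w (n * T $ i $ 3)" for i :: 3
  define R where "R = {(wx ^\<^sub>w (n * n), []), (wy ^\<^sub>w (n * n), []), (wz ^\<^sub>w (n * n), []),
        (word_comm (wx ^\<^sub>w n) wy, []), (word_comm (wx ^\<^sub>w n) wz, []),
        (word_comm (wy ^\<^sub>w n) wx, []), (word_comm (wy ^\<^sub>w n) wz, []),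
        (word_comm (wz ^\<^sub>w n) wx, []), (word_comm (wz ^\<^sub>w n) wy, []),
        (word_comm wx wy, row 1), (word_comm wx wz, row 2), (word_comm wy wz, row 3)}"
  have R: "group_G 2 r r T = presented_group R"
    by (simp add: group_G_def R_def row_def n_def power_add Let_def)
  define xH where "xH = word_class R wx"
  define yH where "yH = word_class R wy"
  define zH where "zH = word_class R wz"
  define H where "H = presented_group R"
  interpret H: gen3_presentation R H xH yH zH
    unfolding H_def xH_def yH_def zH_def by (rule gen3_presentation)
  note simps = word_eval_Nil word_eval_Cons H.word_eval_simps[of "case_gen3 xH yH zH", OF H.val_closed]
  have rel: "xH [^]\<^bsub>H\<^esub> (n * n) = \<one>\<^bsub>H\<^esub>" "yH [^]\<^bsub>H\<^esub> (n * n) = \<one>\<^bsub>H\<^esub>" "zH [^]\<^bsub>H\<^esub> (n * n) = \<one>\<^bsub>H\<^esub>"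
    "H.comm (xH [^]\<^bsub>H\<^esub> n) yH = \<one>\<^bsub>H\<^esub>" "H.comm (xH [^]\<^bsub>H\<^esub> n) zH = \<one>\<^bsub>H\<^esub>"
    "H.comm (yH [^]\<^bsub>H\<^esub> n) xH = \<one>\<^bsub>H\<^esub>" "H.comm (yH [^]\<^bsub>H\<^esub> n) zH = \<one>\<^bsub>H\<^esub>"
    "H.comm (zH [^]\<^bsub>H\<^esub> n) xH = \<one>\<^bsub>H\<^esub>" "H.comm (zH [^]\<^bsub>H\<^esub> n) yH = \<one>\<^bsub>H\<^esub>"
    using H.relation[of "wx ^\<^sub>w (n * n)" "[]"] H.relation[of "wy ^\<^sub>w (n * n)" "[]"] H.relation[of "wz ^\<^sub>w (n * n)" "[]"]
      H.relation[of "word_comm (wx ^\<^sub>w n) wy" "[]"] H.relation[of "word_comm (wx ^\<^sub>w n) wz" "[]"]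
      H.relation[of "word_comm (wy ^\<^sub>w n) wx" "[]"] H.relation[of "word_comm (wy ^\<^sub>w n) wz" "[]"]
      H.relation[of "word_comm (wz ^\<^sub>w n) wx" "[]"] H.relation[of "word_comm (wz ^\<^sub>w n) wy" "[]"]
    by (simp_all add: R_def simps)
  have "H.comm xH yH = monom3 H xH yH zH (n * T $ 1 $ 1) (n * T $ 1 $ 2) (n * T $ 1 $ 3)"
      "H.comm xH zH = monom3 H xH yH zH (n * T $ 2 $ 1) (n * T $ 2 $ 2) (n * T $ 2 $ 3)"
      "H.comm yH zH = monom3 H xH yH zH (n * T $ 3 $ 1) (n * T $ 3 $ 2) (n * T $ 3 $ 3)"
    using H.relation[of "word_comm wx wy" "row 1"] H.relation[of "word_comm wx wz" "row 2"]
       H.relation[of "word_comm wy wz" "row 3"]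
    by (simp_all add: R_def simps row_def monom3_def H.m_assoc)
  note relc = this
  have cen: "xH [^]\<^bsub>H\<^esub> n \<in> H.ZZ" "yH [^]\<^bsub>H\<^esub> n \<in> H.ZZ" "zH [^]\<^bsub>H\<^esub> n \<in> H.ZZ"
    using rel by (intro H.centerI; simp add: H.comm_eq_one_iff H.commutes_with_pow[OF _ _ HOL.refl])+
  have val: "case_gen3 x y z a \<in> carrier G" for a using xyz by (cases a) auto
  have cen': "comm (g [^] n) h = \<one>" if "g [^] n \<in> ZZ" "h \<in> carrier G" for g h
    using that center_comm[of "g [^] n" h] by (simp add: comm_eq_one_iff center_closed)
  have sat: "word_eval G (case_gen3 x y z) u = word_eval G (case_gen3 x y z) v" if "(u, v) \<in> R" for u v
    using that xyz pow pow2 c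
    by (auto simp: R_def row_def word_eval_Nil word_eval_Cons word_eval_simps[of "case_gen3 x y z", OF val] monom3_def m_assoc cen')
  have npow: "monom3 H xH yH zH (n * i) (n * j) (n * k) = \<one>\<^bsub>H\<^esub>" if "n dvd i \<and> n dvd j \<and> n dvd k" for i j k
    using that rel(1-3)
    by (auto elim!: dvdE simp: monom3_def mult.assoc[symmetric] simp flip: H.int_pow_pow)
  have "G \<cong> presented_group R"
    by (rule presented_group_iso[OF xyz gen sat cen[unfolded H_def xH_def yH_def zH_def]
          relc[unfolded H_def xH_def yH_def zH_def]])
      (use kernel1 kernel2 npow in \<open>auto simp: H_def xH_def yH_def zH_def\<close>)
  then show ?thesis by (simp add: R)
qed


section \<open>The exceptional groups, where squares take the role of \<open>n\<close>-th
  powers\<close>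

lemma (in group) pow_eq_one_if_dvd:
  "g \<in> carrier G \<Longrightarrow> g [^] (m::int) = \<one> \<Longrightarrow> m dvd k \<Longrightarrow> g [^] k = \<one>"
  by (auto elim!: dvdE simp flip: int_pow_pow)

context group
begin

lemma comm_monom3_right:
  assumes "g \<in> carrier G" "x \<in> carrier G" "y \<in> carrier G" "z \<in> carrier G"
    and "comm g x \<in> ZZ" "comm g y \<in> ZZ" "comm g z \<in> ZZ"
  shows "comm g (monom3 G x y z i j k) = monom3 G (comm g x) (comm g y) (comm g z) i j k"
  using assms by (simp add: monom3_def comm_mult_right comm_pow_right center_pow center_mult)

lemma central_commutes:
  "c \<in> ZZ \<Longrightarrow> g \<in> carrier G \<Longrightarrow> comm g c = \<one>"
  by (simp add: comm_eq_one_iff center_closed center_comm)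

lemma comm_one [simp]: "g \<in> carrier G \<Longrightarrow> comm g \<one> = \<one>"
  by (simp add: central_commutes)

text \<open>Commuting the trivial word with \<open>x\<close> gives
  \<open>[x,y]^j [x,z]^k = 1\<close>, commuting it with \<open>y\<close> gives
  \<open>[x,y]^(-i) = 1\<close>; independence modulo 2 then yields all three parities.\<close>

lemma even_exponents_rank2:
  assumes xyz: "x \<in> carrier G" "y \<in> carrier G" "z \<in> carrier G"
    and c: "comm x y \<in> ZZ" "comm x z \<in> ZZ" "comm y z = \<one>"
    and ind: "\<And>i j. comm x y [^] (i::int) \<otimes> comm x z [^] (j::int) = \<one> \<Longrightarrow> even i \<and> even j"
    and one: "monom3 G x y z i j k = \<one>"
  shows "even i \<and> even j \<and> even k"
proof -
  have "monom3 G \<one> (comm x y) (comm x z) i j k = \<one>"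
    using comm_monom3_right[of x x y z i j k] xyz c by (simp add: one comm_self)
  then have "comm x y [^] j \<otimes> comm x z [^] k = \<one>" using xyz by (simp add: monom3_def)
  then have "even j \<and> even k" by (rule ind)
  moreover have "monom3 G (inv (comm x y)) \<one> \<one> i j k = \<one>"
    using comm_monom3_right[of y x y z i j k] xyz c
    by (simp add: one comm_self comm_swap[of x y] center_inv)
  then have "comm x y [^] (- i) \<otimes> comm x z [^] (0::int) = \<one>"
    using xyz by (simp add: monom3_def int_pow_neg int_pow_inv)
  then have "even (- i)" using ind by blast
  ultimately show ?thesis by simp
qed

lemma monom3_double:
  assumes "x \<in> carrier G" "y \<in> carrier G" "z \<in> carrier G"
  shows "monom3 G x y z (2 * i) (2 * j) (2 * k) =
    monom3 G (x [^] (2::int)) (y [^] (2::int)) (z [^] (2::int)) i j k"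
  using assms by (simp add: monom3_def int_pow_pow)

lemma monom3_collect12:
  assumes "a \<in> ZZ" "b \<in> ZZ"
  shows "monom3 G a a b i j k = a [^] (i + j) \<otimes> b [^] k"
  using assms by (simp add: monom3_def int_pow_mult center_closed)

lemma monom3_collect13:
  assumes "a \<in> ZZ" "b \<in> ZZ"
  shows "monom3 G a b a i j k = a [^] (i + k) \<otimes> b [^] j"
proof -
  have "b [^] j \<otimes> a [^] k = a [^] k \<otimes> b [^] j"
    using assms by (intro center_comm) (auto intro: center_closed center_pow)
  with assms show ?thesis by (simp add: monom3_def int_pow_mult center_closed m_assoc)
qed

lemma square_eq: "g \<in> carrier G \<Longrightarrow> g [^] (2::int) = g \<otimes> g"
  using int_pow_mult[of g 1 1] by simp

lemma pow_even: "g \<in> carrier G \<Longrightarrow> g [^] (2::int) = \<one> \<Longrightarrow> even k \<Longrightarrow> g [^] (k::int) = \<one>"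
  by (rule pow_eq_one_if_dvd)

lemma pow_odd:
  assumes g: "g \<in> carrier G" and sq: "g [^] (2::int) = \<one>" and "odd k"
  shows "g [^] (k::int) = g"
proof -
  obtain m where k: "k = 2 * m + 1" using \<open>odd k\<close> by (rule oddE)
  have "g [^] k = g [^] (2 * m) \<otimes> g"
    unfolding k using g int_pow_mult[of g "2 * m" 1] by simp
  then show ?thesis using pow_even[OF g sq, of "2 * m"] g by simp
qed

lemma pow4_eq: "g \<in> carrier G \<Longrightarrow> g [^] (4::int) = (g [^] (2::int)) [^] (2::int)"
  by (simp add: int_pow_pow)

lemma comm_square_right:
  "g \<in> carrier G \<Longrightarrow> h \<in> carrier G \<Longrightarrow> comm g h \<in> ZZ \<Longrightarrow> comm g h [^] (2::int) = \<one> \<Longrightarrow>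
    comm g (h [^] (2::int)) = \<one>"
  by (simp add: comm_pow_right)

text \<open>The presentation states neither that \<open>x^2\<close> and \<open>y^2\<close> are
  central nor that \<open>[x,z] = y^2\<close>; both have to be derived in \<open>H\<close>. The
  element \<open>x^2 = z^2\<close> commutes with \<open>x\<close>, with \<open>z\<close>, and
  through \<open>[y,z] = 1\<close> with \<open>y\<close>. Hence \<open>[x,y]\<close> is central and
  \<open>[x,y^2] = [x,y]^2 = x^4 = 1\<close>, so \<open>y^2\<close> is central too.\<close>

lemma iso_group_ii:
  assumes xyz: "x \<in> carrier G" "y \<in> carrier G" "z \<in> carrier G"
    and gen: "generate G {x, y, z} = carrier G"
    and cen: "x [^] (2::int) \<in> ZZ" "y [^] (2::int) \<in> ZZ"
    and c: "comm x y = x [^] (2::int)" "comm x z = y [^] (2::int)" "comm y z = \<one>"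
    and xz: "x [^] (2::int) = z [^] (2::int)"
    and pow4: "x [^] (4::int) = \<one>" "y [^] (4::int) = \<one>"
    and ind: "\<And>i j. comm x y [^] (i::int) \<otimes> comm x z [^] (j::int) = \<one> \<Longrightarrow> even i \<and> even j"
  shows "G \<cong> group_ii"
proof -
  define R where "R = {(wx ^\<^sub>w 4, []), (wy ^\<^sub>w 4, []), (word_comm wy wz, []),
      (wx ^\<^sub>w 2, wz ^\<^sub>w 2), (wz ^\<^sub>w 2, word_comm wx wy),
      ((wx @ wz) ^\<^sub>w 2, wy ^\<^sub>w 2)}"
  define xH where "xH = word_class R wx"
  define yH where "yH = word_class R wy"
  define zH where "zH = word_class R wz"
  define H where "H = presented_group R"
  interpret H: gen3_presentation R H xH yH zH
    unfolding H_def xH_def yH_def zH_def by (rule gen3_presentation)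
  note simps = word_eval_Nil word_eval_Cons H.word_eval_simps[of "case_gen3 xH yH zH", OF H.val_closed]
  let ?A = "xH [^]\<^bsub>H\<^esub> (2::int)" and ?B = "yH [^]\<^bsub>H\<^esub> (2::int)"
  have rel: "xH [^]\<^bsub>H\<^esub> (4::int) = \<one>\<^bsub>H\<^esub>" "yH [^]\<^bsub>H\<^esub> (4::int) = \<one>\<^bsub>H\<^esub>" "H.comm yH zH = \<one>\<^bsub>H\<^esub>"
    and xzH: "?A = zH [^]\<^bsub>H\<^esub> (2::int)"
    and "zH [^]\<^bsub>H\<^esub> (2::int) = H.comm xH yH"
    and xz2: "(xH \<otimes>\<^bsub>H\<^esub> zH) [^]\<^bsub>H\<^esub> (2::int) = ?B"
    using H.relation[of "wx ^\<^sub>w 4" "[]"] H.relation[of "wy ^\<^sub>w 4" "[]"] H.relation[of "word_comm wy wz" "[]"]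
      H.relation[of "wx ^\<^sub>w 2" "wz ^\<^sub>w 2"] H.relation[of "wz ^\<^sub>w 2" "word_comm wx wy"]
      H.relation[of "(wx @ wz) ^\<^sub>w 2" "wy ^\<^sub>w 2"]
    by (simp_all add: R_def simps)
  then have cxy: "H.comm xH yH = ?A" by simp
  have yz: "zH \<otimes>\<^bsub>H\<^esub> yH = yH \<otimes>\<^bsub>H\<^esub> zH"
    using rel(3) by (simp add: H.comm_eq_one_iff)
  have A: "?A \<in> H.ZZ"
  proof (rule H.centerI)
    show "?A \<otimes>\<^bsub>H\<^esub> xH = xH \<otimes>\<^bsub>H\<^esub> ?A"
      by (simp add: H.commutes_with_pow)
    show "?A \<otimes>\<^bsub>H\<^esub> zH = zH \<otimes>\<^bsub>H\<^esub> ?A"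
      unfolding xzH by (simp add: H.commutes_with_pow)
    show "?A \<otimes>\<^bsub>H\<^esub> yH = yH \<otimes>\<^bsub>H\<^esub> ?A"
      unfolding xzH using yz by (simp add: H.commutes_with_pow)
  qed simp
  have A2: "?A \<otimes>\<^bsub>H\<^esub> ?A = \<one>\<^bsub>H\<^esub>" and B2: "?B [^]\<^bsub>H\<^esub> (2::int) = \<one>\<^bsub>H\<^esub>"
    using rel H.square_eq[of ?A] by (simp_all add: H.pow4_eq)
  have B: "?B \<in> H.ZZ"
  proof (rule H.centerI)
    show "?B \<otimes>\<^bsub>H\<^esub> yH = yH \<otimes>\<^bsub>H\<^esub> ?B"
      by (simp add: H.commutes_with_pow)
    show "?B \<otimes>\<^bsub>H\<^esub> zH = zH \<otimes>\<^bsub>H\<^esub> ?B"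
      using yz by (simp add: H.commutes_with_pow)
    have "H.comm xH ?B = \<one>\<^bsub>H\<^esub>"
      using A rel(1) by (intro H.comm_square_right) (simp_all add: cxy H.pow4_eq)
    then show "?B \<otimes>\<^bsub>H\<^esub> xH = xH \<otimes>\<^bsub>H\<^esub> ?B"
      by (simp add: H.comm_eq_one_iff)
  qed simp
  have cxz: "H.comm xH zH = ?B"
  proof (rule H.comm_eqI)
    \<comment> \<open>Write \<open>y^2\<close> as \<open>(xz)^2\<close>. In
      \<open>zx(xz)(xz)\<close> the central \<open>x^2\<close> moves to the front, the two adjacent
      \<open>z\<close> give \<open>z^2 = x^2\<close>, and \<open>x^4 = 1\<close> leaves
      \<open>xz\<close>.\<close>
    have "zH \<otimes>\<^bsub>H\<^esub> xH \<otimes>\<^bsub>H\<^esub> ?B = zH \<otimes>\<^bsub>H\<^esub> (?A \<otimes>\<^bsub>H\<^esub> (zH \<otimes>\<^bsub>H\<^esub> xH \<otimes>\<^bsub>H\<^esub> zH))"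
      by (simp add: H.square_eq H.m_assoc flip: xz2)
    also have "\<dots> = ?A \<otimes>\<^bsub>H\<^esub> (zH \<otimes>\<^bsub>H\<^esub> (zH \<otimes>\<^bsub>H\<^esub> xH \<otimes>\<^bsub>H\<^esub> zH))"
      using A by (intro H.center_lcomm) simp_all
    also have "\<dots> = ?A \<otimes>\<^bsub>H\<^esub> (zH [^]\<^bsub>H\<^esub> (2::int) \<otimes>\<^bsub>H\<^esub> (xH \<otimes>\<^bsub>H\<^esub> zH))"
      by (simp add: H.square_eq[of zH] H.m_assoc)
    also have "\<dots> = (?A \<otimes>\<^bsub>H\<^esub> ?A) \<otimes>\<^bsub>H\<^esub> (xH \<otimes>\<^bsub>H\<^esub> zH)"
      unfolding xzH[symmetric] by (simp add: H.m_assoc)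
    finally show "xH \<otimes>\<^bsub>H\<^esub> zH = zH \<otimes>\<^bsub>H\<^esub> xH \<otimes>\<^bsub>H\<^esub> ?B"
      by (simp add: A2)
  qed simp_all
  have relc: "H.comm xH yH = monom3 H xH yH zH (2 * 1) (2 * 0) (2 * 0)"
    "H.comm xH zH = monom3 H xH yH zH (2 * 0) (2 * 1) (2 * 0)"
    "H.comm yH zH = monom3 H xH yH zH (2 * 0) (2 * 0) (2 * 0)"
    by (simp_all add: monom3_def cxy cxz rel)
  have val: "case_gen3 x y z a \<in> carrier G" for a using xyz by (cases a) auto
  have xz2G: "(x \<otimes> z) [^] (2::int) = y [^] (2::int)"
  proof -
    have "(x \<otimes> z) [^] (2::int) = x \<otimes> (z \<otimes> x \<otimes> z)"
      using xyz by (simp add: square_eq m_assoc)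
    also have "\<dots> = x \<otimes> (z \<otimes> (z \<otimes> x \<otimes> comm x z))"
      using xyz by (simp only: mult_comm_eq) (simp add: m_assoc)
    also have "\<dots> = x \<otimes> (z [^] (2::int) \<otimes> (x \<otimes> comm x z))"
      using xyz by (simp add: square_eq m_assoc)
    also have "\<dots> = x [^] (2::int) \<otimes> (x [^] (2::int) \<otimes> y [^] (2::int))"
      using xyz cen by (simp add: center_lcomm xz[symmetric] c) (simp add: square_eq m_assoc)
    also have "\<dots> = x [^] (4::int) \<otimes> y [^] (2::int)"
      using xyz by (simp add: pow4_eq square_eq[of "x [^] (2::int)"] m_assoc)
    finally show ?thesis using pow4 xyz by simp
  qed
  have sat: "word_eval G (case_gen3 x y z) u = word_eval G (case_gen3 x y z) v" if "(u, v) \<in> R" for u v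
    using that xyz c xz pow4 xz2G
    by (auto simp: R_def word_eval_Nil word_eval_Cons word_eval_simps[of "case_gen3 x y z", OF val])
  have k1: "2 dvd i \<and> 2 dvd j \<and> 2 dvd k" if "monom3 G x y z i j k = \<one>" for i j k :: int
    by (rule even_exponents_rank2[OF xyz _ _ c(3) ind that]) (use cen c in simp_all)
  have k2: "monom3 H xH yH zH (2 * i) (2 * j) (2 * k) = \<one>\<^bsub>H\<^esub>"
    if "monom3 G x y z (2 * i) (2 * j) (2 * k) = \<one>" for i j k
  proof -
    \<comment> \<open>Since \<open>z^2 = x^2\<close>, the exponents \<open>i\<close> and
      \<open>k\<close> merge, in \<open>G\<close> as well as in \<open>H\<close>; only the parities
      of \<open>i + k\<close> and \<open>j\<close> matter.\<close>
    have "comm x y [^] (i + k) \<otimes> comm x z [^] j = \<one>"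
      using that xyz monom3_collect13[OF cen, of i j k] by (simp add: monom3_double c flip: xz)
    then have "even (i + k)" "even j" by (auto dest: ind)
    moreover have "monom3 H xH yH zH (2 * i) (2 * j) (2 * k) = ?A [^]\<^bsub>H\<^esub> (i + k) \<otimes>\<^bsub>H\<^esub> ?B [^]\<^bsub>H\<^esub> j"
      using H.monom3_collect13[OF A B] by (simp add: H.monom3_double flip: xzH)
    ultimately show ?thesis
      using H.pow_even[of ?A "i + k"] H.pow_even[of ?B j] B2 A2 H.square_eq[of ?A] by simp
  qed
  have zHc: "zH [^]\<^bsub>H\<^esub> (2::int) \<in> H.ZZ" using A xzH by simp
  have "G \<cong> presented_group R"
    by (rule presented_group_iso[OF xyz gen sat A[unfolded H_def xH_def yH_def zH_def]
          B[unfolded H_def xH_def yH_def zH_def] zHc[unfolded H_def xH_def yH_def zH_def]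
          relc[unfolded H_def xH_def yH_def zH_def]])
      (use k1 k2 in \<open>auto simp: H_def xH_def yH_def zH_def\<close>)
  then show ?thesis by (simp add: R_def group_ii_def)
qed

text \<open>As for the previous group, the relations contain no centrality. That of
  \<open>x^2 = y^2\<close> follows as before; that of \<open>z^2\<close> is hidden in the relation
  \<open>[x,z] = z^2\<close> and needs \<open>z^4 = 1\<close>.\<close>

lemma iso_group_iii:
  assumes xyz: "x \<in> carrier G" "y \<in> carrier G" "z \<in> carrier G"
    and gen: "generate G {x, y, z} = carrier G"
    and cen: "x [^] (2::int) \<in> ZZ" "z [^] (2::int) \<in> ZZ"
    and c: "comm x y = x [^] (2::int)" "comm x z = z [^] (2::int)" "comm y z = \<one>"
    and xy: "x [^] (2::int) = y [^] (2::int)"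
    and pow4: "x [^] (4::int) = \<one>" "z [^] (4::int) = \<one>"
    and ind: "\<And>i j. comm x y [^] (i::int) \<otimes> comm x z [^] (j::int) = \<one> \<Longrightarrow> even i \<and> even j"
  shows "G \<cong> group_iii"
proof -
  define R where "R = {(wx ^\<^sub>w 4, []), (wz ^\<^sub>w 4, []), (word_comm wy wz, []),
      (wx ^\<^sub>w 2, wy ^\<^sub>w 2), (wy ^\<^sub>w 2, word_comm wx wy),
      (word_comm wx wz, wz ^\<^sub>w 2)}"
  define xH where "xH = word_class R wx"
  define yH where "yH = word_class R wy"
  define zH where "zH = word_class R wz"
  define H where "H = presented_group R"
  interpret H: gen3_presentation R H xH yH zH
    unfolding H_def xH_def yH_def zH_def by (rule gen3_presentation)
  note simps = word_eval_Nil word_eval_Cons H.word_eval_simps[of "case_gen3 xH yH zH", OF H.val_closed]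
  let ?A = "xH [^]\<^bsub>H\<^esub> (2::int)" and ?B = "zH [^]\<^bsub>H\<^esub> (2::int)"
  have rel: "xH [^]\<^bsub>H\<^esub> (4::int) = \<one>\<^bsub>H\<^esub>" "zH [^]\<^bsub>H\<^esub> (4::int) = \<one>\<^bsub>H\<^esub>" "H.comm yH zH = \<one>\<^bsub>H\<^esub>"
    and xyH: "?A = yH [^]\<^bsub>H\<^esub> (2::int)"
    and "yH [^]\<^bsub>H\<^esub> (2::int) = H.comm xH yH"
    and cxz: "H.comm xH zH = ?B"
    using H.relation[of "wx ^\<^sub>w 4" "[]"] H.relation[of "wz ^\<^sub>w 4" "[]"] H.relation[of "word_comm wy wz" "[]"]
      H.relation[of "wx ^\<^sub>w 2" "wy ^\<^sub>w 2"] H.relation[of "wy ^\<^sub>w 2" "word_comm wx wy"]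
      H.relation[of "word_comm wx wz" "wz ^\<^sub>w 2"]
    by (simp_all add: R_def simps)
  then have cxy: "H.comm xH yH = ?A" by simp
  have yz: "yH \<otimes>\<^bsub>H\<^esub> zH = zH \<otimes>\<^bsub>H\<^esub> yH"
    using rel(3) by (simp add: H.comm_eq_one_iff)
  have A: "?A \<in> H.ZZ"
  proof (rule H.centerI)
    show "?A \<otimes>\<^bsub>H\<^esub> xH = xH \<otimes>\<^bsub>H\<^esub> ?A"
      by (simp add: H.commutes_with_pow)
    show "?A \<otimes>\<^bsub>H\<^esub> yH = yH \<otimes>\<^bsub>H\<^esub> ?A"
      unfolding xyH by (simp add: H.commutes_with_pow)
    show "?A \<otimes>\<^bsub>H\<^esub> zH = zH \<otimes>\<^bsub>H\<^esub> ?A"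
      unfolding xyH using yz by (simp add: H.commutes_with_pow)
  qed simp
  have A2: "?A [^]\<^bsub>H\<^esub> (2::int) = \<one>\<^bsub>H\<^esub>" and B2: "?B [^]\<^bsub>H\<^esub> (2::int) = \<one>\<^bsub>H\<^esub>"
    using rel by (simp_all add: H.pow4_eq)
  have B: "?B \<in> H.ZZ"
  proof (rule H.centerI)
    show "?B \<otimes>\<^bsub>H\<^esub> zH = zH \<otimes>\<^bsub>H\<^esub> ?B"
      by (simp add: H.commutes_with_pow)
    show "?B \<otimes>\<^bsub>H\<^esub> yH = yH \<otimes>\<^bsub>H\<^esub> ?B"
      using yz by (simp add: H.commutes_with_pow)
    \<comment> \<open>From \<open>xz = zx z^2\<close> one \<open>z\<close> cancels, so
      \<open>zxz = x\<close>. Applying this twice gives \<open>z^2 x z^2 = x\<close>, and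
      \<open>z^4 = 1\<close> turns this into commutation.\<close>
    have "zH \<otimes>\<^bsub>H\<^esub> xH \<otimes>\<^bsub>H\<^esub> (zH \<otimes>\<^bsub>H\<^esub> zH) = xH \<otimes>\<^bsub>H\<^esub> zH"
      using H.mult_comm_eq[of xH zH] by (simp add: cxz H.square_eq)
    then have "(zH \<otimes>\<^bsub>H\<^esub> xH \<otimes>\<^bsub>H\<^esub> zH) \<otimes>\<^bsub>H\<^esub> zH = xH \<otimes>\<^bsub>H\<^esub> zH"
      by (simp add: H.m_assoc)
    then have zxz: "zH \<otimes>\<^bsub>H\<^esub> xH \<otimes>\<^bsub>H\<^esub> zH = xH"
      by (simp only: H.r_cancel H.m_closed H.gens_closed)
    have "?B \<otimes>\<^bsub>H\<^esub> xH \<otimes>\<^bsub>H\<^esub> ?B = zH \<otimes>\<^bsub>H\<^esub> (zH \<otimes>\<^bsub>H\<^esub> xH \<otimes>\<^bsub>H\<^esub> zH) \<otimes>\<^bsub>H\<^esub> zH"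
      by (simp add: H.square_eq H.m_assoc)
    then have bxb: "?B \<otimes>\<^bsub>H\<^esub> xH \<otimes>\<^bsub>H\<^esub> ?B = xH"
      by (simp only: zxz)
    have "?B \<otimes>\<^bsub>H\<^esub> xH = ?B \<otimes>\<^bsub>H\<^esub> xH \<otimes>\<^bsub>H\<^esub> (?B \<otimes>\<^bsub>H\<^esub> ?B)"
      using B2 by (simp add: H.square_eq[of ?B])
    also have "\<dots> = (?B \<otimes>\<^bsub>H\<^esub> xH \<otimes>\<^bsub>H\<^esub> ?B) \<otimes>\<^bsub>H\<^esub> ?B"
      by (simp add: H.m_assoc)
    finally show "?B \<otimes>\<^bsub>H\<^esub> xH = xH \<otimes>\<^bsub>H\<^esub> ?B"
      by (simp only: bxb)
  qed simp
  have relc: "H.comm xH yH = monom3 H xH yH zH (2 * 1) (2 * 0) (2 * 0)"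
    "H.comm xH zH = monom3 H xH yH zH (2 * 0) (2 * 0) (2 * 1)"
    "H.comm yH zH = monom3 H xH yH zH (2 * 0) (2 * 0) (2 * 0)"
    by (simp_all add: monom3_def cxy cxz rel)
  have val: "case_gen3 x y z a \<in> carrier G" for a using xyz by (cases a) auto
  have sat: "word_eval G (case_gen3 x y z) u = word_eval G (case_gen3 x y z) v" if "(u, v) \<in> R" for u v
    using that xyz c xy pow4
    by (auto simp: R_def word_eval_Nil word_eval_Cons word_eval_simps[of "case_gen3 x y z", OF val])
  have k1: "2 dvd i \<and> 2 dvd j \<and> 2 dvd k" if "monom3 G x y z i j k = \<one>" for i j k :: int
    by (rule even_exponents_rank2[OF xyz _ _ c(3) ind that]) (use cen c in simp_all)
  have k2: "monom3 H xH yH zH (2 * i) (2 * j) (2 * k) = \<one>\<^bsub>H\<^esub>"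
    if "monom3 G x y z (2 * i) (2 * j) (2 * k) = \<one>" for i j k
  proof -
    have "comm x y [^] (i + j) \<otimes> comm x z [^] k = \<one>"
      using that xyz monom3_collect12[OF cen, of i j k] by (simp add: monom3_double c flip: xy)
    then have "even (i + j)" "even k" by (auto dest: ind)
    moreover have "monom3 H xH yH zH (2 * i) (2 * j) (2 * k) = ?A [^]\<^bsub>H\<^esub> (i + j) \<otimes>\<^bsub>H\<^esub> ?B [^]\<^bsub>H\<^esub> k"
      using H.monom3_collect12[OF A B] by (simp add: H.monom3_double flip: xyH)
    ultimately show ?thesis
      using H.pow_even[of ?A "i + j"] H.pow_even[of ?B k] B2 A2 by simp
  qed
  have yHc: "yH [^]\<^bsub>H\<^esub> (2::int) \<in> H.ZZ" using A xyH by simp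
  have "G \<cong> presented_group R"
    by (rule presented_group_iso[OF xyz gen sat A[unfolded H_def xH_def yH_def zH_def]
          yHc[unfolded H_def xH_def yH_def zH_def] B[unfolded H_def xH_def yH_def zH_def]
          relc[unfolded H_def xH_def yH_def zH_def]])
      (use k1 k2 in \<open>auto simp: H_def xH_def yH_def zH_def\<close>)
  then show ?thesis by (simp add: R_def group_iii_def)
qed

end

text \<open>An auxiliary presentation of \<open>Q\<^sub>8 \<times> C\<^sub>2\<close>.\<close>

definition Q8C2_relations :: "(gen3 word \<times> gen3 word) set" where
  "Q8C2_relations = {(wx ^\<^sub>w 4, []), (wx ^\<^sub>w 2, wy ^\<^sub>w 2), (wy ^\<^sub>w 2, word_comm wx wy),
     (wz ^\<^sub>w 2, []), (word_comm wx wz, []), (word_comm wy wz, [])}"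

context group
begin

text \<open>The parities of \<open>i\<close> and \<open>j\<close> are again read off from
  commutators, which are powers of \<open>x^2\<close>. The generator \<open>z\<close> is central
  here, so commutators say nothing about \<open>k\<close>; the hypothesis that \<open>z\<close> lies
  outside the subgroup generated by \<open>x\<close> and \<open>y\<close> does.\<close>

lemma iso_Q8C2_presentation:
  assumes xyz: "x \<in> carrier G" "y \<in> carrier G" "z \<in> carrier G"
    and gen: "generate G {x, y, z} = carrier G"
    and cen: "x [^] (2::int) \<in> ZZ"
    and c: "comm x y = x [^] (2::int)" "comm x z = \<one>" "comm y z = \<one>"
    and sq: "x [^] (2::int) = y [^] (2::int)" "z [^] (2::int) = \<one>"
    and pow4: "x [^] (4::int) = \<one>" and neq: "x [^] (2::int) \<noteq> \<one>"
    and zxy: "z \<notin> generate G {x, y}"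
  shows "G \<cong> presented_group Q8C2_relations"
proof -
  define R where "R = Q8C2_relations"
  define xH where "xH = word_class R wx"
  define yH where "yH = word_class R wy"
  define zH where "zH = word_class R wz"
  define H where "H = presented_group R"
  interpret H: gen3_presentation R H xH yH zH
    unfolding H_def xH_def yH_def zH_def by (rule gen3_presentation)
  note simps = word_eval_Nil word_eval_Cons H.word_eval_simps[of "case_gen3 xH yH zH", OF H.val_closed]
  let ?A = "xH [^]\<^bsub>H\<^esub> (2::int)"
  have rel: "xH [^]\<^bsub>H\<^esub> (4::int) = \<one>\<^bsub>H\<^esub>" "zH [^]\<^bsub>H\<^esub> (2::int) = \<one>\<^bsub>H\<^esub>"
      "H.comm xH zH = \<one>\<^bsub>H\<^esub>" "H.comm yH zH = \<one>\<^bsub>H\<^esub>"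
    and xyH: "?A = yH [^]\<^bsub>H\<^esub> (2::int)"
    and "yH [^]\<^bsub>H\<^esub> (2::int) = H.comm xH yH"
    using H.relation[of "wx ^\<^sub>w 4" "[]"] H.relation[of "wz ^\<^sub>w 2" "[]"]
      H.relation[of "wx ^\<^sub>w 2" "wy ^\<^sub>w 2"] H.relation[of "wy ^\<^sub>w 2" "word_comm wx wy"]
      H.relation[of "word_comm wx wz" "[]"] H.relation[of "word_comm wy wz" "[]"]
    by (simp_all add: R_def Q8C2_relations_def simps)
  then have cxy: "H.comm xH yH = ?A" by simp
  have yz: "yH \<otimes>\<^bsub>H\<^esub> zH = zH \<otimes>\<^bsub>H\<^esub> yH"
    using rel(4) by (simp add: H.comm_eq_one_iff)
  have A: "?A \<in> H.ZZ"
  proof (rule H.centerI)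
    show "?A \<otimes>\<^bsub>H\<^esub> xH = xH \<otimes>\<^bsub>H\<^esub> ?A"
      by (simp add: H.commutes_with_pow)
    show "?A \<otimes>\<^bsub>H\<^esub> yH = yH \<otimes>\<^bsub>H\<^esub> ?A"
      unfolding xyH by (simp add: H.commutes_with_pow)
    show "?A \<otimes>\<^bsub>H\<^esub> zH = zH \<otimes>\<^bsub>H\<^esub> ?A"
      unfolding xyH using yz by (simp add: H.commutes_with_pow)
  qed simp
  have A2: "?A [^]\<^bsub>H\<^esub> (2::int) = \<one>\<^bsub>H\<^esub>"
    using rel by (simp add: H.pow4_eq)
  have relc: "H.comm xH yH = monom3 H xH yH zH (2 * 1) (2 * 0) (2 * 0)"
    "H.comm xH zH = monom3 H xH yH zH (2 * 0) (2 * 0) (2 * 0)"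
    "H.comm yH zH = monom3 H xH yH zH (2 * 0) (2 * 0) (2 * 0)"
    by (simp_all add: monom3_def cxy rel)
  have val: "case_gen3 x y z a \<in> carrier G" for a using xyz by (cases a) auto
  have sat: "word_eval G (case_gen3 x y z) u = word_eval G (case_gen3 x y z) v" if "(u, v) \<in> R" for u v
    using that xyz c sq pow4
    by (auto simp: R_def Q8C2_relations_def word_eval_Nil word_eval_Cons
        word_eval_simps[of "case_gen3 x y z", OF val])
  let ?a = "x [^] (2::int)"
  have a2: "?a [^] (2::int) = \<one>" using pow4 xyz by (simp add: pow4_eq)
  have evenI: "even i" if "?a [^] i = \<one>" for i :: int
  proof (rule ccontr)
    assume "odd i"
    then have "?a [^] i = ?a" using xyz a2 by (intro pow_odd) simp_all
    with that neq show False by simp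
  qed
  have k1: "2 dvd i \<and> 2 dvd j \<and> 2 dvd k" if one: "monom3 G x y z i j k = \<one>" for i j k :: int
  proof -
    have "monom3 G \<one> ?a \<one> i j k = \<one>"
      using comm_monom3_right[of x x y z i j k] xyz c cen by (simp add: one comm_self)
    then have "even j" using xyz by (intro evenI) (simp add: monom3_def)
    moreover have "monom3 G (inv ?a) \<one> \<one> i j k = \<one>"
      using comm_monom3_right[of y x y z i j k] xyz c cen
      by (simp add: one comm_self comm_swap[of x y] center_inv)
    then have "?a [^] (- i) = \<one>"
      using xyz by (simp add: monom3_def int_pow_neg int_pow_inv)
    then have "even (- i)" using evenI by blast
    \<comment> \<open>For odd \<open>k\<close> the power \<open>z [^] k\<close> is \<open>z\<close>
      itself, and the vanishing word would express \<open>z\<close> through \<open>x\<close> and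
      \<open>y\<close>.\<close>
    moreover have "even k"
    proof (rule ccontr)
      assume "odd k"
      then have "z [^] k = z" using xyz sq by (intro pow_odd)
      then have "x [^] i \<otimes> y [^] j \<otimes> z = \<one>" using one by (simp add: monom3_def)
      then have "inv z = x [^] i \<otimes> y [^] j" using xyz by (intro inv_equality) simp_all
      moreover have S: "subgroup (generate G {x, y}) G"
        using xyz by (intro generate_is_subgroup) simp
      have "x [^] i \<in> generate G {x, y}" "y [^] j \<in> generate G {x, y}"
        by (simp_all add: subgroup_int_pow_closed[OF S] generate.incl)
      then have "x [^] i \<otimes> y [^] j \<in> generate G {x, y}" by (rule generate.eng)
      ultimately have "inv (inv z) \<in> generate G {x, y}"
        using subgroup.m_inv_closed[OF S] by simp
      then show False using zxy xyz by simp
    qed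
    ultimately show ?thesis by simp
  qed
  have k2: "monom3 H xH yH zH (2 * i) (2 * j) (2 * k) = \<one>\<^bsub>H\<^esub>"
    if "monom3 G x y z (2 * i) (2 * j) (2 * k) = \<one>" for i j k
  proof -
    have "?a [^] (i + j) = \<one>"
      using that xyz monom3_collect12[of ?a \<one> i j k] cen
        by (simp add: monom3_double sq(2) flip: sq(1))
    then have "even (i + j)" by (rule evenI)
    moreover have "monom3 H xH yH zH (2 * i) (2 * j) (2 * k) = ?A [^]\<^bsub>H\<^esub> (i + j)"
      using H.monom3_collect12[of ?A "\<one>\<^bsub>H\<^esub>" i j k] A
        by (simp add: H.monom3_double rel flip: xyH)
    ultimately show ?thesis
      using H.pow_even[of ?A "i + j"] A2 by simp
  qed
  have yHc: "yH [^]\<^bsub>H\<^esub> (2::int) \<in> H.ZZ" using A xyH by simp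
  have zHc: "zH [^]\<^bsub>H\<^esub> (2::int) \<in> H.ZZ" using rel by simp
  have "G \<cong> presented_group R"
    by (rule presented_group_iso[OF xyz gen sat A[unfolded H_def xH_def yH_def zH_def]
          yHc[unfolded H_def xH_def yH_def zH_def] zHc[unfolded H_def xH_def yH_def zH_def]
          relc[unfolded H_def xH_def yH_def zH_def]])
      (use k1 k2 in \<open>auto simp: H_def xH_def yH_def zH_def\<close>)
  then show ?thesis by (simp add: R_def)
qed

end

text \<open>The concrete direct product satisfies the criterion just proved, hence has this
  presentation. In the classification \<open>G\<close> and the product are both compared with the
  presented group instead of with each other.\<close>

lemma quaternion_group_C2_presentation:
  "quaternion_group \<times>\<times> integer_mod_group 2 \<cong> presented_group Q8C2_relations"
proof -
  define K where "K = quaternion_group \<times>\<times> integer_mod_group 2"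
  interpret Q: group quaternion_group by (rule quaternion_group_is_group)
  interpret C: group "integer_mod_group 2" by simp
  interpret K: group K unfolding K_def by (rule DirProd_group) unfold_locales
  have carrK: "carrier K = carrier quaternion_group \<times> {0, 1}"
    by (auto simp: K_def carrier_integer_mod_group)
  have multK: "u \<otimes>\<^bsub>K\<^esub> v = (hamilton_mult (fst u) (fst v), (snd u + snd v) mod 2)" for u v
    by (cases u; cases v)
      (simp add: K_def quaternion_group_def mult_integer_mod_group)
  have oneK: "\<one>\<^bsub>K\<^esub> = ((1, 0, 0, 0), 0)"
    by (simp add: K_def quaternion_group_def)
  \<comment> \<open>The quaternion units \<open>i\<close> and \<open>j\<close>, and the non-trivial
    element of the cyclic factor.\<close>
  define x :: "(int \<times> int \<times> int \<times> int) \<times> int" where "x = ((0, 1, 0, 0), 0)"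
  define y :: "(int \<times> int \<times> int \<times> int) \<times> int" where "y = ((0, 0, 1, 0), 0)"
  define z :: "(int \<times> int \<times> int \<times> int) \<times> int" where "z = ((1, 0, 0, 0), 1)"
  note defs = x_def y_def z_def
  have xyz: "x \<in> carrier K" "y \<in> carrier K" "z \<in> carrier K"
    by (simp_all add: defs carrK quaternion_group_def)
  have x2: "x [^]\<^bsub>K\<^esub> (2::int) = ((-1, 0, 0, 0), 0)" and y2: "y [^]\<^bsub>K\<^esub> (2::int) = ((-1, 0, 0, 0), 0)"
    and z2: "z [^]\<^bsub>K\<^esub> (2::int) = \<one>\<^bsub>K\<^esub>"
    using xyz by (simp_all add: K.square_eq multK oneK) (simp_all add: defs)
  have x4: "x [^]\<^bsub>K\<^esub> (4::int) = \<one>\<^bsub>K\<^esub>"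
    using xyz by (simp add: K.pow4_eq) (simp add: x2 K.square_eq carrK quaternion_group_def multK oneK)
  have gen: "generate K {x, y, z} = carrier K"
  proof
    show "generate K {x, y, z} \<subseteq> carrier K" using xyz by (intro K.generate_incl) simp
    let ?S = "generate K {x, y, z}"
    have S: "x \<in> ?S" "y \<in> ?S" "z \<in> ?S" by (simp_all add: generate.incl)
    have m: "u \<in> ?S \<Longrightarrow> v \<in> ?S \<Longrightarrow> u \<otimes>\<^bsub>K\<^esub> v \<in> ?S" for u v
      by (rule generate.eng)
    have "x \<otimes>\<^bsub>K\<^esub> x \<in> ?S" "x \<otimes>\<^bsub>K\<^esub> y \<in> ?S" "y \<otimes>\<^bsub>K\<^esub> x \<in> ?S" "x \<otimes>\<^bsub>K\<^esub> (x \<otimes>\<^bsub>K\<^esub> x) \<in> ?S"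
      "y \<otimes>\<^bsub>K\<^esub> (y \<otimes>\<^bsub>K\<^esub> y) \<in> ?S" "\<one>\<^bsub>K\<^esub> \<in> ?S"
      using S by (simp_all add: m generate.one)
    then have mem: "((-1, 0, 0, 0), 0) \<in> ?S" "((0, 0, 0, 1), 0) \<in> ?S" "((0, 0, 0, -1), 0) \<in> ?S"
      "((0, -1, 0, 0), 0) \<in> ?S" "((0, 0, -1, 0), 0) \<in> ?S" "((1, 0, 0, 0), 0) \<in> ?S"
      "((0, 1, 0, 0), 0) \<in> ?S" "((0, 0, 1, 0), 0) \<in> ?S"
      using S by (simp_all only: multK oneK) (simp_all add: defs)
    have "(q, 0) \<in> ?S" if "q \<in> carrier quaternion_group" for q
      using that mem by (auto simp: quaternion_group_def)
    moreover have "(q, 1) \<in> ?S" if "q \<in> carrier quaternion_group" for q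
    proof -
      have "(q, 0) \<otimes>\<^bsub>K\<^esub> z \<in> ?S"
        using calculation[OF that] S(3) by (rule m)
      then show ?thesis by (cases q) (simp add: multK z_def)
    qed
    ultimately show "carrier K \<subseteq> ?S" by (auto simp: carrK)
  qed
  have cen: "x [^]\<^bsub>K\<^esub> (2::int) \<in> K.ZZ"
    by (auto simp: group_center_def x2 carrK quaternion_group_def multK)
  have "x \<otimes>\<^bsub>K\<^esub> y = y \<otimes>\<^bsub>K\<^esub> x \<otimes>\<^bsub>K\<^esub> x [^]\<^bsub>K\<^esub> (2::int)"
    "x \<otimes>\<^bsub>K\<^esub> z = z \<otimes>\<^bsub>K\<^esub> x \<otimes>\<^bsub>K\<^esub> \<one>\<^bsub>K\<^esub>" "y \<otimes>\<^bsub>K\<^esub> z = z \<otimes>\<^bsub>K\<^esub> y \<otimes>\<^bsub>K\<^esub> \<one>\<^bsub>K\<^esub>"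
    by (simp_all only: multK x2 oneK) (simp_all add: defs)
  then have c: "K.comm x y = x [^]\<^bsub>K\<^esub> (2::int)" "K.comm x z = \<one>\<^bsub>K\<^esub>" "K.comm y z = \<one>\<^bsub>K\<^esub>"
    using xyz by (simp_all only: K.comm_eqI K.int_pow_closed K.one_closed)
  \<comment> \<open>The second coordinate is a homomorphism that is trivial on \<open>x\<close> and
    \<open>y\<close> but not on \<open>z\<close>.\<close>
  have "generate K {x, y} \<subseteq> {g \<in> carrier K. snd g = 0}"
  proof
    fix g assume "g \<in> generate K {x, y}"
    then show "g \<in> {g \<in> carrier K. snd g = 0}"
    proof (rule K.generate_right_induct)
      fix g s and e :: int
      assume g: "g \<in> {g \<in> carrier K. snd g = 0}" and "s \<in> {x, y}"
      then have s: "s \<in> carrier K" "snd s = 0" using xyz by (auto simp: defs)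
      have "snd \<in> hom K (integer_mod_group 2)"
        by (auto simp: hom_def K_def)
      then have "snd (s [^]\<^bsub>K\<^esub> e) = snd s [^]\<^bsub>integer_mod_group 2\<^esub> e"
        using s by (intro hom_int_pow) (auto intro: K.group_axioms)
      then have "snd (s [^]\<^bsub>K\<^esub> e) = 0" using s C.int_pow_one[of e] by simp
      moreover have "g \<otimes>\<^bsub>K\<^esub> s [^]\<^bsub>K\<^esub> e \<in> carrier K"
        using g s by simp
      ultimately show "g \<otimes>\<^bsub>K\<^esub> s [^]\<^bsub>K\<^esub> e \<in> {g \<in> carrier K. snd g = 0}"
        using g by (simp add: multK)
    qed (use xyz in \<open>auto simp: oneK carrK quaternion_group_def\<close>)
  qed
  then have "z \<notin> generate K {x, y}" by (auto simp: z_def)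
  moreover have "x [^]\<^bsub>K\<^esub> (2::int) \<noteq> \<one>\<^bsub>K\<^esub>"
    by (simp add: x2 oneK)
  moreover have "x [^]\<^bsub>K\<^esub> (2::int) = y [^]\<^bsub>K\<^esub> (2::int)"
    by (simp only: x2 y2)
  ultimately have "K \<cong> presented_group Q8C2_relations"
    by (intro K.iso_Q8C2_presentation[OF xyz gen cen c _ z2 x4])
  then show ?thesis by (simp only: K_def)
qed

section \<open>Generating triples and commutators\<close>

text \<open>The two commutator conventions differ by replacing both arguments by their
  inverses.\<close>

lemma (in group) comm_in_derived:
  assumes "g \<in> carrier G" "h \<in> carrier G"
  shows "comm g h \<in> derived_subgroup G"
proof -
  have "comm g h = inv g \<otimes> inv h \<otimes> inv (inv g) \<otimes> inv (inv h)"
    using assms by (simp add: commutator_def)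
  then have "comm g h \<in> derived_set G (carrier G)"
    using assms by (intro UN_I[of "inv g"] UN_I[of "inv h"]) simp_all
  then show ?thesis unfolding derived_subgroup_def derived_def by (rule generate.incl)
qed

text \<open>Collecting the \<open>x\<close> to the left, each of them passes all the
  \<open>y\<close> in front of it, namely 0, 1, ..., \<open>m - 1\<close> of them, and each passage
  costs one central factor \<open>comm y x\<close>.\<close>

lemma (in group) mult_pow_class2:
  fixes m :: nat
  assumes x: "x \<in> carrier G" and y: "y \<in> carrier G" and c: "comm y x \<in> ZZ"
  shows "(x \<otimes> y) [^] m = x [^] m \<otimes> y [^] m \<otimes> comm y x [^] (m * (m - 1) div 2)"
proof (induction m)
  case 0
  show ?case by simp
next
  case (Suc m)
  let ?c = "comm y x"
  have cp: "?c [^] k \<in> ZZ" for k :: nat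
    using center_pow[OF c, of "int k"] by (simp add: int_pow_int)
  have "y [^] m \<otimes> x = x \<otimes> y [^] m \<otimes> ?c [^] m"
    using pow_comm_shift[OF y x c, of "int m"] by (simp add: int_pow_int)
  then have s: "y [^] m \<otimes> (x \<otimes> y) = x \<otimes> y [^] m \<otimes> ?c [^] m \<otimes> y"
    using x y by (simp flip: m_assoc)
  have tri: "Suc m * (Suc m - 1) div 2 = m * (m - 1) div 2 + m"
    by (cases m) (simp_all add: algebra_simps)
  have "(x \<otimes> y) [^] Suc m = x [^] m \<otimes> (y [^] m \<otimes> (?c [^] (m * (m - 1) div 2) \<otimes> (x \<otimes> y)))"
    using x y by (simp add: Suc m_assoc)
  also have "?c [^] (m * (m - 1) div 2) \<otimes> (x \<otimes> y) = (x \<otimes> y) \<otimes> ?c [^] (m * (m - 1) div 2)"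
    using x y by (intro center_comm[OF cp, symmetric]) simp
  also have "x [^] m \<otimes> (y [^] m \<otimes> ((x \<otimes> y) \<otimes> ?c [^] (m * (m - 1) div 2))) =
      x [^] m \<otimes> ((y [^] m \<otimes> (x \<otimes> y)) \<otimes> ?c [^] (m * (m - 1) div 2))"
    using x y by (simp add: m_assoc)
  also have "\<dots> = x [^] m \<otimes> x \<otimes> (y [^] m \<otimes> (?c [^] m \<otimes> y) \<otimes> ?c [^] (m * (m - 1) div 2))"
    unfolding s using x y by (simp add: m_assoc)
  also have "?c [^] m \<otimes> y = y \<otimes> ?c [^] m"
    using y by (intro center_comm[OF cp, symmetric])
  also have "x [^] m \<otimes> x \<otimes> (y [^] m \<otimes> (y \<otimes> ?c [^] m) \<otimes> ?c [^] (m * (m - 1) div 2)) =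
      x [^] Suc m \<otimes> y [^] Suc m \<otimes> (?c [^] m \<otimes> ?c [^] (m * (m - 1) div 2))"
    using x y by (simp add: m_assoc)
  also have "?c [^] m \<otimes> ?c [^] (m * (m - 1) div 2) = ?c [^] (Suc m * (Suc m - 1) div 2)"
    using x y by (simp only: tri nat_pow_mult comm_closed add.commute)
  finally show ?case .
qed

text \<open>The hypotheses reduced to statements about single elements, with \<open>n\<close> an
  integer because all exponents are. \<open>derived_half_pow\<close> is the lower bound on the
  exponent of the derived subgroup, \<open>not_2_generated\<close> the lower bound on the number of
  generators.\<close>

locale engel_group = group +
  fixes r :: nat and n :: int
  defines n_def: "n \<equiv> 2 ^ r"
  assumes comm_central: "g \<in> carrier G \<Longrightarrow> h \<in> carrier G \<Longrightarrow> comm g h \<in> ZZ"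
    and pow_derived: "g \<in> carrier G \<Longrightarrow> g [^] n \<in> derived_subgroup G"
    and derived_pow: "c \<in> derived_subgroup G \<Longrightarrow> c [^] n = \<one>"
    and center_if_pow: "g \<in> carrier G \<Longrightarrow> g [^] n = \<one> \<Longrightarrow> g \<in> ZZ"
    and r_pos: "0 < r"
    and derived_half_pow: "\<exists>c \<in> derived_subgroup G. c [^] (n div 2) \<noteq> \<one>"
    and not_2_generated: "u \<in> carrier G \<Longrightarrow> v \<in> carrier G \<Longrightarrow> generate G {u, v} \<noteq> carrier G"
begin

abbreviation "D \<equiv> derived_subgroup G"

lemma n_half: "n div 2 * 2 = n" "2 * (n div 2) = n" "n = 2 * (n div 2)"
  using r_pos by (auto simp: n_def)

lemma n_pos: "0 < n"
  by (simp add: n_def)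

lemma subgroup_D: "subgroup D G"
  by (simp add: derived_subgroup_def derived_is_subgroup)

definition gen_triple :: "'a \<Rightarrow> 'a \<Rightarrow> 'a \<Rightarrow> bool" where
  "gen_triple x y z \<longleftrightarrow> x \<in> carrier G \<and> y \<in> carrier G \<and> z \<in> carrier G \<and> generate G {x, y, z} = carrier G"

lemma gen_triple_carrier: "gen_triple x y z \<Longrightarrow> x \<in> carrier G \<and> y \<in> carrier G \<and> z \<in> carrier G"
  by (simp add: gen_triple_def)

lemma gen_tripleI:
  assumes "gen_triple x y z" and c: "x' \<in> carrier G" "y' \<in> carrier G" "z' \<in> carrier G"
    and "x \<in> generate G {x', y', z'}" "y \<in> generate G {x', y', z'}" "z \<in> generate G {x', y', z'}"
  shows "gen_triple x' y' z'"
proof -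
  have s: "subgroup (generate G {x', y', z'}) G" using c by (intro generate_is_subgroup) simp
  have "generate G {x, y, z} \<subseteq> generate G {x', y', z'}"
    using assms by (intro generate_subgroup_incl[OF _ s]) simp
  moreover have "generate G {x', y', z'} \<subseteq> carrier G"
    using c by (intro generate_incl) simp
  ultimately show ?thesis using assms by (auto simp: gen_triple_def)
qed

lemma gen_triple_perm:
  assumes "gen_triple x y z"
  shows "gen_triple y x z" "gen_triple x z y" "gen_triple y z x" "gen_triple z x y" "gen_triple z y x"
  using assms
  by (auto simp: gen_triple_def insert_commute)

text \<open>The elementary transvection. Together with permutations it gives the base changes that
  simplify a relation between commutators.\<close>

lemma gen_triple_mult:
  assumes g: "gen_triple x y z"
  shows "gen_triple x (y \<otimes> z [^] (k::int)) z"
proof (rule gen_tripleI[OF g])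
  note c = gen_triple_carrier[OF g]
  let ?S = "generate G {x, y \<otimes> z [^] k, z}"
  have s: "subgroup ?S G" using c by (intro generate_is_subgroup) auto
  have m: "y \<otimes> z [^] k \<in> ?S" "z \<in> ?S" by (auto intro: generate.incl)
  show "x \<in> ?S" "z \<in> ?S" by (auto intro: generate.incl)
  have "inv (z [^] k) \<in> ?S"
    using m by (intro subgroup.m_inv_closed[OF s] subgroup_int_pow_closed[OF s])
  with m(1) have "y \<otimes> z [^] k \<otimes> inv (z [^] k) \<in> ?S" by (rule generate.eng)
  then show "y \<in> ?S" using c by (simp add: m_assoc)
qed (use gen_triple_carrier[OF g] in auto)

text \<open>Commutators are bilinear because they are central, so those of the generators determine
  all others.\<close>

lemma derived_monom3:
  assumes g: "gen_triple x y z" and d: "d \<in> D"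
  shows "\<exists>i j k. d = monom3 G (comm x y) (comm x z) (comm y z) i j k"
proof -
  define S where "S = range (\<lambda>(i, j, k). monom3 G (comm x y) (comm x z) (comm y z) i j k)"
  note c = gen_triple_carrier[OF g]
  have cc: "comm x y \<in> ZZ" "comm x z \<in> ZZ" "comm y z \<in> ZZ"
    using c by (auto intro: comm_central)
  have S: "subgroup S G" unfolding S_def by (rule monom3_subgroup[OF cc])
  have mem: "monom3 G (comm x y) (comm x z) (comm y z) i j k \<in> S" for i j k
    using rangeI[of "\<lambda>(i, j, k). monom3 G (comm x y) (comm x z) (comm y z) i j k" "(i, j, k)"]
    by (simp add: S_def)
  have base: "comm x y \<in> S" "comm x z \<in> S" "comm y z \<in> S"
    using mem[of 1 0 0] mem[of 0 1 0] mem[of 0 0 1] c by (simp_all add: monom3_def)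
  have swap: "comm h g \<in> S" if "comm g h \<in> S" "g \<in> carrier G" "h \<in> carrier G" for g h
    using that subgroup.m_inv_closed[OF S] comm_swap[of g h] by simp
  \<comment> \<open>Extends the first argument from generators to the whole group. The second
    argument is reached by \<open>swap\<close> and a further use of \<open>step\<close>.\<close>
  have step: "comm g h \<in> S" if h: "h \<in> carrier G" and "\<And>s. s \<in> {x, y, z} \<Longrightarrow> comm s h \<in> S"
      and g: "g \<in> generate G {x, y, z}" for g h
    using g
  proof (rule generate_right_induct)
    show "{x, y, z} \<subseteq> carrier G" using c by simp
    show "comm \<one> h \<in> S" using h swap[of h \<one>] subgroup.one_closed[OF S] by simp
    fix g s and e :: int
    assume a: "g \<in> carrier G" "comm g h \<in> S" "s \<in> {x, y, z}"
    then have s: "s \<in> carrier G" using c by auto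
    have "comm (g \<otimes> s [^] e) h = comm g h \<otimes> comm s h [^] e"
      using a s h by (simp add: comm_mult_left comm_pow_left comm_central)
    then show "comm (g \<otimes> s [^] e) h \<in> S"
      using a that(2) by (simp add: subgroup.m_closed[OF S] subgroup_int_pow_closed[OF S])
  qed
  have gen: "generate G {x, y, z} = carrier G" using g by (simp add: gen_triple_def)
  have one: "comm u u \<in> S" if "u \<in> carrier G" for u
    using that subgroup.one_closed[OF S] by (simp add: comm_self)
  have "comm x x \<in> S" "comm y y \<in> S" "comm z z \<in> S" "comm y x \<in> S" "comm z x \<in> S" "comm z y \<in> S"
    using c base by (simp_all add: one swap)
  with base have s0: "comm s t \<in> S" if "s \<in> {x, y, z}" "t \<in> {x, y, z}" for s t
    using that by auto
  have s1: "comm g s \<in> S" if s: "s \<in> {x, y, z}" and g: "g \<in> carrier G" for g s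
  proof (rule step)
    show "s \<in> carrier G" using s c by auto
    show "g \<in> generate G {x, y, z}" using g gen by simp
  qed (rule s0[OF _ s])
  have all: "comm g h \<in> S" if g: "g \<in> carrier G" and h: "h \<in> carrier G" for g h
  proof (rule step[OF h])
    show "g \<in> generate G {x, y, z}" using g gen by simp
    fix s assume s: "s \<in> {x, y, z}"
    then have "s \<in> carrier G" using c by auto
    then show "comm s h \<in> S" using swap[OF s1[OF s h] h] by blast
  qed
  have "derived_set G (carrier G) \<subseteq> S"
  proof
    fix u assume "u \<in> derived_set G (carrier G)"
    then obtain g h where gh: "g \<in> carrier G" "h \<in> carrier G" "u = g \<otimes> h \<otimes> inv g \<otimes> inv h"
      by auto
    then have "u = comm (inv g) (inv h)" by (simp add: commutator_def)
    then show "u \<in> S" using gh all by simp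
  qed
  then have "D \<subseteq> S"
    unfolding derived_subgroup_def derived_def by (rule generate_subgroup_incl[OF _ S])
  then have "d \<in> S" using d by blast
  then show ?thesis by (auto simp: S_def)
qed

lemma D_central: assumes "gen_triple x y z" "d \<in> D" shows "d \<in> ZZ"
proof -
  obtain i j k where "d = monom3 G (comm x y) (comm x z) (comm y z) i j k"
    using derived_monom3[OF assms] by blast
  then show ?thesis using gen_triple_carrier[OF assms(1)] by (simp add: monom3_center comm_central)
qed

text \<open>
  In dimension 3 every bivector is decomposable: a vanishing combination of the three commutators
  is the commutator of two members of another generating triple.
\<close>

lemma exists_gen_triple_comm_yz:
  assumes g: "gen_triple x y z"
    and rel: "monom3 G (comm x y [^] m) (comm x z [^] m) (comm y z [^] m) i j k = \<one>"
    and sq: "comm x y [^] (2 * m) = \<one>" "comm x z [^] (2 * m) = \<one>" "comm y z [^] (2 * m) = \<one>"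
    and odd: "\<not> (even i \<and> even j \<and> even k)"
  shows "\<exists>x y z. gen_triple x y z \<and> comm y z [^] (m::int) = \<one>"
proof -
  note c = gen_triple_carrier[OF g]
  let ?a = "comm x y" and ?b = "comm x z" and ?c = "comm y z"
  have cc: "?a \<in> ZZ" "?b \<in> ZZ" "?c \<in> ZZ" using c by (auto intro: comm_central)
  have cd: "?a \<in> carrier G" "?b \<in> carrier G" "?c \<in> carrier G" using c by auto
  have sq': "(u [^] m) [^] (2::int) = \<one>" if "u [^] (2 * m) = \<one>" "u \<in> carrier G" for u
    using that by (simp add: int_pow_pow mult.commute)
  have ev: "(u [^] m) [^] e = \<one>" if "u [^] (2 * m) = \<one>" "u \<in> carrier G" "even e" for u and e :: int
    by (rule pow_even[OF _ sq']) (use that in auto)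
  have od: "(u [^] m) [^] e = u [^] m" if "u [^] (2 * m) = \<one>" "u \<in> carrier G" "odd e" for u and e :: int
    by (rule pow_odd[OF _ sq']) (use that in auto)
  have mul: "(u \<otimes> v) [^] m = u [^] m \<otimes> v [^] m" if "u \<in> ZZ" "v \<in> ZZ" for u v
    using that by (intro int_pow_mult_distrib center_comm) (auto intro: center_closed)
  consider "odd i" | "even i" "odd j" | "even i" "even j" "odd k" using odd by blast
  then show ?thesis
  proof cases
    case 1
    \<comment> \<open>Chosen so that \<open>[x z^(-k), y z^j] = [x,y] [x,z]^j [z,y]^(-k) = [x,y]
      [x,z]^j [y,z]^k\<close>. As \<open>i\<close> is odd, its \<open>m\<close>-th power is the
      given vanishing combination.\<close>
    define x' where "x' = x \<otimes> z [^] (- k)"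
    define y' where "y' = y \<otimes> z [^] j"
    have x': "x' \<in> carrier G" and y': "y' \<in> carrier G"
      using c by (simp_all add: x'_def y'_def)
    have "gen_triple x y' z" unfolding y'_def by (rule gen_triple_mult[OF g])
    then have "gen_triple y' x z" by (rule gen_triple_perm)
    then have "gen_triple y' x' z" unfolding x'_def by (rule gen_triple_mult)
    then have "gen_triple z x' y'" by (rule gen_triple_perm)
    moreover have "comm x' y' [^] m = \<one>"
    proof -
      have zy: "comm z y = inv ?c" using c by (simp add: comm_swap[of y z])
      have "comm x' y' = comm x y' \<otimes> comm z y' [^] (- k)"
        unfolding x'_def using c y' by (simp add: comm_mult_left comm_pow_left comm_central)
      also have "comm x y' = ?a \<otimes> ?b [^] j"
        unfolding y'_def using c by (simp add: comm_mult_right comm_pow_right comm_central)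
      also have "comm z y' = inv ?c"
        unfolding y'_def
          using c by (simp add: comm_mult_right comm_pow_right comm_central comm_self zy center_inv)
      also have "inv ?c [^] (- k) = ?c [^] k"
        using cd by (simp add: int_pow_neg int_pow_inv)
      finally have "comm x' y' [^] m = (?a [^] m \<otimes> (?b [^] m) [^] j) \<otimes> (?c [^] m) [^] k"
        using cc cd by (simp add: mul center_mult center_pow int_pow_pow mult.commute)
      also have "\<dots> = monom3 G (?a [^] m) (?b [^] m) (?c [^] m) i j k"
        using od[OF sq(1) cd(1) 1] by (simp add: monom3_def)
      finally show ?thesis using rel by simp
    qed
    ultimately show ?thesis by blast
  next
    case 2
    \<comment> \<open>Now the \<open>[x,y]\<close> term drops out, and
      \<open>[x y^k, z] = [x,z] [y,z]^k\<close> has the remaining combination as its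
      \<open>m\<close>-th power.\<close>
    define x' where "x' = x \<otimes> y [^] k"
    have x': "x' \<in> carrier G" using c by (simp add: x'_def)
    have "gen_triple z x y" using g by (rule gen_triple_perm)
    then have "gen_triple z x' y" unfolding x'_def by (rule gen_triple_mult)
    then have "gen_triple y x' z" by (rule gen_triple_perm)
    moreover have "comm x' z = ?b \<otimes> ?c [^] k"
      unfolding x'_def using c by (simp add: comm_mult_left comm_pow_left comm_central)
    then have "comm x' z [^] m = ?b [^] m \<otimes> (?c [^] m) [^] k"
      using cc cd by (simp add: mul center_pow int_pow_pow mult.commute)
    then have "comm x' z [^] m = \<one>"
      using rel ev[OF sq(1) cd(1) 2(1)] od[OF sq(2) cd(2) 2(2)] cd by (simp add: monom3_def)
    ultimately show ?thesis by blast
  next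
    case 3
    then have "?c [^] m = \<one>"
      using rel ev[OF sq(1) cd(1) 3(1)] ev[OF sq(2) cd(2) 3(2)] od[OF sq(3) cd(3) 3(3)] cd
      by (simp add: monom3_def)
    then show ?thesis using g by blast
  qed
qed

text \<open>For odd \<open>j\<close> replace \<open>z\<close> by \<open>z y^i\<close>: then
  \<open>[x, z y^i] = [x,z] [x,y]^i\<close>, while \<open>[y, z y^i] = [y,z]\<close> is unchanged.
  For even \<open>j\<close> the relation reduces to \<open>[x,y]^m = 1\<close>, and exchanging
  \<open>y\<close> and \<open>z\<close> suffices.\<close>

lemma exists_gen_triple_comm_xz_yz:
  assumes g: "gen_triple x y z" and c0: "comm y z [^] m = \<one>"
    and rel: "(comm x y [^] m) [^] i \<otimes> (comm x z [^] m) [^] j = \<one>"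
    and sq: "comm x y [^] (2 * m) = \<one>" "comm x z [^] (2 * m) = \<one>"
    and odd: "\<not> (even (i::int) \<and> even (j::int))"
  shows "\<exists>x y z. gen_triple x y z \<and> comm x z [^] m = \<one> \<and> comm y z [^] (m::int) = \<one>"
proof -
  note c = gen_triple_carrier[OF g]
  let ?a = "comm x y" and ?b = "comm x z" and ?c = "comm y z"
  have cc: "?a \<in> ZZ" "?b \<in> ZZ" "?c \<in> ZZ" using c by (auto intro: comm_central)
  have cd: "?a \<in> carrier G" "?b \<in> carrier G" "?c \<in> carrier G" using c by auto
  have sq': "(u [^] m) [^] (2::int) = \<one>" if "u [^] (2 * m) = \<one>" "u \<in> carrier G" for u
    using that by (simp add: int_pow_pow mult.commute)
  show ?thesis
  proof (cases "odd j")
    case True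
    define z' where "z' = z \<otimes> y [^] i"
    have "gen_triple x z' y" unfolding z'_def by (rule gen_triple_mult[OF gen_triple_perm(2)[OF g]])
    then have g': "gen_triple x y z'" by (rule gen_triple_perm)
    have "comm x z' = ?b \<otimes> ?a [^] i"
      unfolding z'_def using c by (simp add: comm_mult_right comm_pow_right comm_central)
    then have "comm x z' [^] m = (?a [^] i \<otimes> ?b) [^] m"
      using center_comm[OF cc(2), of "?a [^] i"] cd by simp
    also have "\<dots> = (?a [^] i) [^] m \<otimes> ?b [^] m"
      using cc cd by (intro int_pow_mult_distrib center_comm) simp_all
    also have "\<dots> = (?a [^] m) [^] i \<otimes> (?b [^] m) [^] j"
      using pow_odd[OF _ sq' True, of ?b] sq cd by (simp add: int_pow_pow mult.commute)
    finally have "comm x z' [^] m = \<one>" using rel by simp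
    moreover have "comm y z' = ?c"
      unfolding z'_def using c by (simp add: comm_mult_right comm_pow_right comm_central comm_self)
    ultimately have "gen_triple x y z' \<and> comm x z' [^] m = \<one> \<and> comm y z' [^] m = \<one>"
      using c0 g' by simp
    then show ?thesis by blast
  next
    case False
    then have "odd i" using odd by simp
    then have "?a [^] m = \<one>"
      using rel pow_odd[OF _ sq', of ?a i] pow_even[OF _ sq', of ?b j] False sq cd by simp
    moreover have "comm z y [^] m = \<one>"
      using c0 c cd by (simp add: comm_swap[of y z] int_pow_inv)
    ultimately show ?thesis using gen_triple_perm(2)[OF g] by blast
  qed
qed

end

section \<open>The groups \<open>G(2, r, r, T)\<close>\<close>

text \<open>Substituting linear combinations into a linear combination: the exponents compose by
  matrix multiplication, which is how the inverse of the matrix \<open>T\<close> is recognised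
  later.\<close>

lemma (in group) monom3_monom3:
  assumes "u \<in> ZZ" "v \<in> ZZ" "w \<in> ZZ"
  shows "monom3 G (monom3 G u v w i1 j1 k1) (monom3 G u v w i2 j2 k2) (monom3 G u v w i3 j3 k3) e1 e2 e3 =
    monom3 G u v w (i1 * e1 + i2 * e2 + i3 * e3) (j1 * e1 + j2 * e2 + j3 * e3) (k1 * e1 + k2 * e2 + k3 * e3)"
  unfolding monom3_def[of G "monom3 G u v w i1 j1 k1"] monom3_pow[OF assms] monom3_mult[OF assms] ..

section \<open>Linear algebra in the derived subgroup\<close>

context engel_group
begin

abbreviation "h \<equiv> n div 2"

lemma half_eq: "h = 2 ^ (r - 1)"
  using r_pos by (cases r) (simp_all add: n_def)

lemma derived_pow_dvd: "gen_triple x y z \<Longrightarrow> c \<in> D \<Longrightarrow> n dvd k \<Longrightarrow> c [^] (k::int) = \<one>"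
  by (rule pow_eq_one_if_dvd[of c n k]) (auto intro: derived_pow center_closed D_central)

text \<open>Linear independence over the integers modulo \<open>m\<close>, written multiplicatively.
  That the orders divide \<open>m\<close> is not included; for elements of the derived subgroup and
  \<open>m = n\<close> it is \<open>derived_pow\<close>.\<close>

definition indep3 :: "int \<Rightarrow> 'a \<Rightarrow> 'a \<Rightarrow> 'a \<Rightarrow> bool" where
  "indep3 m u v w \<longleftrightarrow> (\<forall>i j k. monom3 G u v w i j k = \<one> \<longrightarrow> m dvd i \<and> m dvd j \<and> m dvd k)"

lemma indep3D: "indep3 m u v w \<Longrightarrow> monom3 G u v w i j k = \<one> \<Longrightarrow> m dvd i \<and> m dvd j \<and> m dvd k"
  by (simp add: indep3_def)

text \<open>The factors of 2 are peeled off one at a time: if \<open>2 ^ s\<close> divides all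
  exponents of a relation, a suitable power of it is a relation between the \<open>h\<close>-th
  powers, whose exponents are even by assumption.\<close>

lemma indep3_lift:
  assumes c: "u \<in> ZZ" "v \<in> ZZ" "w \<in> ZZ"
    and ind: "indep3 2 (u [^] h) (v [^] h) (w [^] h)"
  shows "indep3 n u v w"
  unfolding indep3_def
proof (intro allI impI)
  fix i j k
  assume one: "monom3 G u v w i j k = \<one>"
  have "s \<le> r \<Longrightarrow> 2 ^ s dvd i \<and> 2 ^ s dvd j \<and> 2 ^ s dvd k" for s
  proof (induction s)
    case 0
    show ?case by simp
  next
    case (Suc s)
    then obtain i' j' k' where ijk: "i = 2 ^ s * i'" "j = 2 ^ s * j'" "k = 2 ^ s * k'"
      by (auto elim!: dvdE)
    \<comment> \<open>The factor that completes \<open>2 ^ s\<close> to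
      \<open>h = 2 ^ (r - 1)\<close>.\<close>
    define e :: int where "e = 2 ^ (r - Suc s)"
    have se: "2 ^ s * e = h"
      unfolding e_def half_eq power_add[symmetric]
        using Suc.prems by (intro arg_cong[of _ _ "power 2"]) simp
    have "\<one> = monom3 G u v w i j k [^] e" by (simp add: one)
    also have "\<dots> = monom3 G u v w (2 ^ s * e * i') (2 ^ s * e * j') (2 ^ s * e * k')"
      unfolding monom3_pow[OF c] ijk by (simp add: mult_ac)
    also have "\<dots> = monom3 G (u [^] h) (v [^] h) (w [^] h) i' j' k'"
      unfolding se using c by (simp add: monom3_def int_pow_pow center_closed)
    finally have "even i' \<and> even j' \<and> even k'" by (intro indep3D[OF ind]) simp
    then show ?case unfolding ijk by (auto elim!: evenE)
  qed
  from this[of r] show "n dvd i \<and> n dvd j \<and> n dvd k" by (simp add: n_def)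
qed

lemma monom3_mod:
  assumes "u \<in> carrier G" "v \<in> carrier G" "w \<in> carrier G" "u [^] n = \<one>" "v [^] n = \<one>" "w [^] n = \<one>"
  shows "monom3 G u v w (i mod n) (j mod n) (k mod n) = monom3 G u v w i j k"
proof -
  have "u [^] (i mod n) = u [^] i" if "u \<in> carrier G" "u [^] n = \<one>" for u and i
  proof -
    have "u [^] i = u [^] (n * (i div n)) \<otimes> u [^] (i mod n)"
      using int_pow_mult[OF that(1), of "n * (i div n)" "i mod n"] by simp
    also have "u [^] (n * (i div n)) = \<one>" by (rule pow_eq_one_if_dvd[OF that]) simp
    finally show ?thesis using that by simp
  qed
  with assms show ?thesis by (simp add: monom3_def)
qed

lemma monom3_eq_dvd:
  assumes c: "u \<in> ZZ" "v \<in> ZZ" "w \<in> ZZ"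
    and ind: "indep3 n u v w"
    and eq: "monom3 G u v w i j k = monom3 G u v w i' j' k'"
  shows "n dvd i - i' \<and> n dvd j - j' \<and> n dvd k - k'"
proof (rule indep3D[OF ind])
  have "monom3 G u v w (i - i') (j - j') (k - k') = monom3 G u v w i j k \<otimes> monom3 G u v w (- i') (- j') (- k')"
    using c by (simp add: monom3_mult)
  also have "\<dots> = \<one>"
    unfolding eq monom3_inv[OF c, symmetric] using c by (simp add: center_closed)
  finally show "monom3 G u v w (i - i') (j - j') (k - k') = \<one>" .
qed

text \<open>A counting argument: the commutators of the generators give at most \<open>n^3\<close>
  elements, an independent triple gives \<open>n^3\<close> different ones, so these are all. The
  exponents come out in the residue range that \<open>GL3_mod\<close> requires.\<close>

lemma derived_spanned:
  assumes g: "gen_triple x y z" and uvw: "u \<in> D" "v \<in> D" "w \<in> D"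
    and ind: "indep3 n u v w"
    and d: "d \<in> D"
  shows "\<exists>i \<in> {0..<n}. \<exists>j \<in> {0..<n}. \<exists>k \<in> {0..<n}. d = monom3 G u v w i j k"
proof -
  define I where "I = {0..<n} \<times> {0..<n} \<times> {0..<n}"
  have finI: "finite I" by (simp add: I_def)
  note c = gen_triple_carrier[OF g]
  let ?m = "\<lambda>u v w (i, j, k). monom3 G u v w i j k"
  have "D \<subseteq> ?m (comm x y) (comm x z) (comm y z) ` I"
  proof
    fix d assume "d \<in> D"
    then obtain i j k where "d = monom3 G (comm x y) (comm x z) (comm y z) i j k"
      using derived_monom3[OF g] by blast
    also have "\<dots> = ?m (comm x y) (comm x z) (comm y z) (i mod n, j mod n, k mod n)"
      using c by (simp add: monom3_mod derived_pow comm_in_derived)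
    finally have "d = ?m (comm x y) (comm x z) (comm y z) (i mod n, j mod n, k mod n)" .
    moreover have "(i mod n, j mod n, k mod n) \<in> I" using n_pos by (simp add: I_def)
    ultimately show "d \<in> ?m (comm x y) (comm x z) (comm y z) ` I" by (rule image_eqI)
  qed
  then have cardD: "finite D" "card D \<le> card I"
    using finI by (auto intro: finite_subset surj_card_le)
  have uvwc: "u \<in> ZZ" "v \<in> ZZ" "w \<in> ZZ" using uvw D_central[OF g] by auto
  have "inj_on (?m u v w) I"
  proof (rule inj_onI)
    fix p q assume p: "p \<in> I" and q: "q \<in> I" and eq: "?m u v w p = ?m u v w q"
    obtain i j k i' j' k' where pq: "p = (i, j, k)" "q = (i', j', k')" by (cases p; cases q) auto
    have "i mod n = i' mod n \<and> j mod n = j' mod n \<and> k mod n = k' mod n"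
      using monom3_eq_dvd[OF uvwc ind, of i j k i' j' k'] eq by (simp add: pq mod_eq_dvd_iff)
    then show "p = q" using p q by (simp add: pq I_def)
  qed
  then have "card (?m u v w ` I) = card I" by (rule card_image)
  moreover have "?m u v w ` I \<subseteq> D"
    using uvw by (auto simp: monom3_def subgroup.m_closed[OF subgroup_D] subgroup_int_pow_closed[OF subgroup_D])
  ultimately have "?m u v w ` I = D" using cardD by (intro card_seteq) auto
  with d obtain p where "p \<in> I" "d = ?m u v w p" by blast
  moreover obtain i j k where "p = (i, j, k)" by (cases p)
  ultimately have "i \<in> {0..<n}" "j \<in> {0..<n}" "k \<in> {0..<n}" "d = monom3 G u v w i j k"
    by (simp_all add: I_def)
  then show ?thesis by blast
qed

text \<open>Both triples are bases of the derived subgroup modulo \<open>n\<close>. \<open>T\<close>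
  expresses the commutators in the \<open>n\<close>-th powers and \<open>S\<close> the
  \<open>n\<close>-th powers in the commutators; as both triples are independent, \<open>T\<close>
  and \<open>S\<close> are inverse to each other modulo \<open>n\<close>.\<close>

lemma classification_iv:
  assumes g: "gen_triple x y z"
    and indc: "indep3 n (comm x y) (comm x z) (comm y z)"
    and indp: "indep3 n (x [^] n) (y [^] n) (z [^] n)"
  shows "\<exists>T \<in> GL3_mod n. G \<cong> group_G 2 r r T"
proof -
  let ?a = "comm x y" and ?b = "comm x z" and ?c = "comm y z"
  let ?p = "x [^] n" and ?q = "y [^] n" and ?s = "z [^] n"
  have xyz: "x \<in> carrier G" "y \<in> carrier G" "z \<in> carrier G"
    using g by (simp_all add: gen_triple_def)
  have gen: "generate G {x, y, z} = carrier G" using g by (simp add: gen_triple_def)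
  have D: "?a \<in> D" "?b \<in> D" "?c \<in> D" "?p \<in> D" "?q \<in> D" "?s \<in> D"
    using xyz by (simp_all add: comm_in_derived pow_derived)
  note cen = D_central[OF g]
  note spanp = derived_spanned[OF g D(4-6) indp]
  note spanc = derived_spanned[OF g D(1-3) indc]
  obtain t11 t12 t13 where t1: "t11 \<in> {0..<n}" "t12 \<in> {0..<n}" "t13 \<in> {0..<n}"
    and a: "?a = monom3 G ?p ?q ?s t11 t12 t13" using spanp[OF D(1)] by blast
  obtain t21 t22 t23 where t2: "t21 \<in> {0..<n}" "t22 \<in> {0..<n}" "t23 \<in> {0..<n}"
    and b: "?b = monom3 G ?p ?q ?s t21 t22 t23" using spanp[OF D(2)] by blast
  obtain t31 t32 t33 where t3: "t31 \<in> {0..<n}" "t32 \<in> {0..<n}" "t33 \<in> {0..<n}"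
    and c: "?c = monom3 G ?p ?q ?s t31 t32 t33" using spanp[OF D(3)] by blast
  obtain s11 s12 s13 where p: "?p = monom3 G ?a ?b ?c s11 s12 s13" using spanc[OF D(4)] by blast
  obtain s21 s22 s23 where q: "?q = monom3 G ?a ?b ?c s21 s22 s23" using spanc[OF D(5)] by blast
  obtain s31 s32 s33 where s: "?s = monom3 G ?a ?b ?c s31 s32 s33" using spanc[OF D(6)] by blast
  define T :: "int ^ 3 ^ 3" where "T = vector [vector [t11, t12, t13], vector [t21, t22, t23], vector [t31, t32, t33]]"
  define S :: "int ^ 3 ^ 3" where "S = vector [vector [s11, s12, s13], vector [s21, s22, s23], vector [s31, s32, s33]]"
  have unit: "monom3 G u v w 1 0 0 = u" "monom3 G u v w 0 1 0 = v" "monom3 G u v w 0 0 1 = w"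
    if "u \<in> ZZ" "v \<in> ZZ" "w \<in> ZZ" for u v w
    using that by (simp_all add: monom3_def center_closed)
  note ccc = cen[OF D(1)] cen[OF D(2)] cen[OF D(3)]
  note ccp = cen[OF D(4)] cen[OF D(5)] cen[OF D(6)]
  note pqs = monom3_monom3[OF ccc, of s11 s12 s13 s21 s22 s23 s31 s32 s33, folded p q s]
  note TS = pqs[of t11 t12 t13, folded a] pqs[of t21 t22 t23, folded b] pqs[of t31 t32 t33, folded c]
  note abc = monom3_monom3[OF ccp, of t11 t12 t13 t21 t22 t23 t31 t32 t33, folded a b c]
  note ST = abc[of s11 s12 s13, folded p] abc[of s21 s22 s23, folded q] abc[of s31 s32 s33, folded s]
  note dvdc = monom3_eq_dvd[OF ccc indc]
  note dvdp = monom3_eq_dvd[OF ccp indp]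
  have TS': "\<forall>i j. [(T ** S) $ i $ j = mat 1 $ i $ j] (mod n)"
    using dvdc[OF HOL.trans[OF unit(1)[OF ccc] TS(1)]] dvdc[OF HOL.trans[OF unit(2)[OF ccc] TS(2)]]
      dvdc[OF HOL.trans[OF unit(3)[OF ccc] TS(3)]]
    by (simp add: forall_3 matrix_matrix_mult_def sum_3 T_def S_def mat_def cong_iff_dvd_diff dvd_diff_commute[of n "_ + _"] mult.commute)
  have ST': "\<forall>i j. [(S ** T) $ i $ j = mat 1 $ i $ j] (mod n)"
    using dvdp[OF HOL.trans[OF unit(1)[OF ccp] ST(1)]] dvdp[OF HOL.trans[OF unit(2)[OF ccp] ST(2)]]
      dvdp[OF HOL.trans[OF unit(3)[OF ccp] ST(3)]]
    by (simp add: forall_3 matrix_matrix_mult_def sum_3 T_def S_def mat_def cong_iff_dvd_diff dvd_diff_commute[of n "_ + _"] mult.commute)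
  have "\<forall>i j. T $ i $ j \<in> {0..<n}"
    using t1 t2 t3 by (simp add: forall_3 T_def)
  with TS' ST' have "T \<in> GL3_mod n" unfolding GL3_mod_def by blast
  moreover have "G \<cong> group_G 2 r r T"
  proof (rule iso_group_G[OF xyz gen])
    show "x [^] (2 ^ r :: int) \<in> ZZ" "y [^] (2 ^ r :: int) \<in> ZZ" "z [^] (2 ^ r :: int) \<in> ZZ"
      using ccp by (simp_all add: n_def)
    show "x [^] (2 ^ r * 2 ^ r :: int) = \<one>" "y [^] (2 ^ r * 2 ^ r :: int) = \<one>" "z [^] (2 ^ r * 2 ^ r :: int) = \<one>"
      using derived_pow[OF D(4)] derived_pow[OF D(5)] derived_pow[OF D(6)] xyz
      by (simp_all add: n_def int_pow_pow)
    have row: "monom3 G x y z (n * i) (n * j) (n * k) = monom3 G ?p ?q ?s i j k" for i j k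
      using xyz by (simp add: monom3_def int_pow_pow)
    show "?a = monom3 G x y z (2 ^ r * T $ 1 $ 1) (2 ^ r * T $ 1 $ 2) (2 ^ r * T $ 1 $ 3)"
      "?b = monom3 G x y z (2 ^ r * T $ 2 $ 1) (2 ^ r * T $ 2 $ 2) (2 ^ r * T $ 2 $ 3)"
      "?c = monom3 G x y z (2 ^ r * T $ 3 $ 1) (2 ^ r * T $ 3 $ 2) (2 ^ r * T $ 3 $ 3)"
      using a b c row by (simp_all add: T_def flip: n_def)
    show "2 ^ r dvd i \<and> 2 ^ r dvd j \<and> 2 ^ r dvd k"
      if "monom3 G x y z (2 ^ r * i) (2 ^ r * j) (2 ^ r * k) = \<one>" for i j k
      using indep3D[OF indp, of i j k] that row[of i j k] by (simp flip: n_def)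
    show "2 ^ r dvd i \<and> 2 ^ r dvd j \<and> 2 ^ r dvd k" if one: "monom3 G x y z i j k = \<one>" for i j k
    proof -
      \<comment> \<open>Commuting with \<open>x\<close> reveals \<open>j\<close> and
        \<open>k\<close>, commuting with \<open>y\<close> reveals \<open>i\<close>.\<close>
      have "monom3 G \<one> ?a ?b i j k = \<one>"
        using comm_monom3_right[of x x y z i j k] xyz ccc by (simp add: one comm_self)
      then have "monom3 G ?a ?b ?c j k 0 = \<one>" using xyz by (simp add: monom3_def)
      moreover have "monom3 G (inv ?a) \<one> ?c i j k = \<one>"
        using comm_monom3_right[of y x y z i j k] xyz ccc
        by (simp add: one comm_self comm_swap[of x y] center_inv)
      then have "monom3 G ?a ?b ?c (- i) 0 k = \<one>"
        using xyz by (simp add: monom3_def int_pow_neg int_pow_inv)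
      ultimately show ?thesis
        using indep3D[OF indc, of j k 0] indep3D[OF indc, of "- i" 0 k] by (simp add: n_def)
    qed
  qed
  ultimately show ?thesis by blast
qed

end

section \<open>The case \<open>r \<ge> 2\<close>\<close>

text \<open>Two linear equations in three unknowns over the field of two elements have a non-zero
  solution; the seven candidates are tried.\<close>

lemma exists_even_combination2:
  fixes x1 x2 y1 y2 z1 z2 :: int
  shows "\<exists>i j k :: int. \<not> (even i \<and> even j \<and> even k) \<and>
    even (x1 * i + y1 * j + z1 * k) \<and> even (x2 * i + y2 * j + z2 * k)"
proof -
  let ?P = "\<lambda>i j k :: int. \<not> (even i \<and> even j \<and> even k) \<and>
    even (x1 * i + y1 * j + z1 * k) \<and> even (x2 * i + y2 * j + z2 * k)"
  have "?P 1 0 0 \<or> ?P 0 1 0 \<or> ?P 0 0 1 \<or> ?P 1 1 0 \<or> ?P 1 0 1 \<or> ?P 0 1 1 \<or> ?P 1 1 1"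
    by simp argo
  then show ?thesis by blast
qed

context engel_group
begin

text \<open>The correction term is \<open>[v,u]\<close> to the power
  \<open>h j n (n - 1) / 2\<close>. This contains the factor \<open>h * h = n * 2 ^ (r - 2)\<close>,
  where \<open>r \<ge> 2\<close> is essential.\<close>

lemma mult_pow_n:
  assumes r2: "2 \<le> r" and g: "gen_triple x y z" and u: "u \<in> carrier G" and v: "v \<in> carrier G"
  shows "(u \<otimes> v [^] (h * j)) [^] n = u [^] n \<otimes> (v [^] (h * j)) [^] n"
proof -
  let ?w = "v [^] (h * j)"
  define m :: nat where "m = 2 ^ r"
  have nm: "n = int m" by (simp add: n_def m_def)
  have w: "?w \<in> carrier G" using v by simp
  have c: "comm ?w u = comm v u [^] (h * j)" using u v by (simp add: comm_pow_left comm_central)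
  have mm: "m * (m - 1) div 2 = 2 ^ (r - 1) * (m - 1)"
    using r_pos by (cases r) (simp_all add: m_def)
  have hh: "h * 2 ^ (r - 1) = n * 2 ^ (r - 2)"
  proof -
    have "r - 1 + (r - 1) = r + (r - 2)" using r2 by simp
    then have "(2::int) ^ (r - 1) * 2 ^ (r - 1) = 2 ^ r * 2 ^ (r - 2)" by (simp flip: power_add)
    then show ?thesis by (simp only: half_eq n_def[symmetric])
  qed
  have "h * j * int (m * (m - 1) div 2) = (h * 2 ^ (r - 1)) * (j * int (m - 1))"
    unfolding mm by simp
  also have "\<dots> = n * (2 ^ (r - 2) * (j * int (m - 1)))"
    unfolding hh by (simp only: mult.assoc)
  finally have "n dvd h * j * int (m * (m - 1) div 2)" by (rule dvdI)
  moreover have "comm ?w u [^] (m * (m - 1) div 2) = comm v u [^] (h * j * int (m * (m - 1) div 2))"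
    unfolding c int_pow_int[symmetric] using u v by (simp add: int_pow_pow)
  ultimately have "comm ?w u [^] (m * (m - 1) div 2) = \<one>"
    using derived_pow_dvd[OF g comm_in_derived[OF v u]] by simp
  then show ?thesis
    using mult_pow_class2[OF u w comm_central[OF w u], of m] u w by (simp add: nm int_pow_int)
qed

text \<open>By \<open>mult_pow_n\<close> the hypothesis says that
  \<open>x^(hi) y^(hj) z^(hk)\<close> has trivial \<open>n\<close>-th power. Hence it is central,
  and its commutators with \<open>x\<close>, \<open>y\<close>, \<open>z\<close> are the three
  relations.\<close>

lemma half_power_relations:
  assumes r2: "2 \<le> r" and g: "gen_triple x y z"
    and one: "monom3 G ((x [^] n) [^] h) ((y [^] n) [^] h) ((z [^] n) [^] h) i j k = \<one>"
  shows "(comm x y [^] h) [^] j \<otimes> (comm x z [^] h) [^] k = \<one>"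
    and "(comm x y [^] h) [^] (- i) \<otimes> (comm y z [^] h) [^] k = \<one>"
    and "(comm x z [^] h) [^] (- i) \<otimes> (comm y z [^] h) [^] (- j) = \<one>"
proof -
  have c: "x \<in> carrier G" "y \<in> carrier G" "z \<in> carrier G"
    using g by (simp_all add: gen_triple_def)
  let ?a = "comm x y" and ?b = "comm x z" and ?c = "comm y z"
  let ?g = "monom3 G x y z (h * i) (h * j) (h * k)"
  have sw: "(u [^] (h * e)) [^] n = ((u [^] n) [^] h) [^] e" if "u \<in> carrier G" for u and e :: int
    using that by (simp add: int_pow_pow mult_ac)
  have "?g [^] n = (x [^] (h * i) \<otimes> y [^] (h * j)) [^] n \<otimes> (z [^] (h * k)) [^] n"
    unfolding monom3_def using c by (intro mult_pow_n[OF r2 g]) simp_all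
  also have "(x [^] (h * i) \<otimes> y [^] (h * j)) [^] n = (x [^] (h * i)) [^] n \<otimes> (y [^] (h * j)) [^] n"
    using c by (intro mult_pow_n[OF r2 g]) simp_all
  also have "(x [^] (h * i)) [^] n \<otimes> (y [^] (h * j)) [^] n \<otimes> (z [^] (h * k)) [^] n = \<one>"
    using one unfolding sw[OF c(1)] sw[OF c(2)] sw[OF c(3)] by (simp only: monom3_def)
  finally have "?g \<in> ZZ" using c by (intro center_if_pow) simp_all
  then have gc: "comm u ?g = \<one>" if "u \<in> carrier G" for u
    using that by (rule central_commutes)
  have cc: "?a \<in> ZZ" "?b \<in> ZZ" "?c \<in> ZZ" using c by (auto intro: comm_central)
  have "monom3 G \<one> ?a ?b (h * i) (h * j) (h * k) = \<one>"
    using comm_monom3_right[of x x y z "h * i" "h * j" "h * k"] c cc gc by (simp add: comm_self)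
  then show "(?a [^] h) [^] j \<otimes> (?b [^] h) [^] k = \<one>"
    using c by (simp add: monom3_def int_pow_pow)
  have "monom3 G (inv ?a) \<one> ?c (h * i) (h * j) (h * k) = \<one>"
    using comm_monom3_right[of y x y z "h * i" "h * j" "h * k"] c cc gc
    by (simp add: comm_self comm_swap[of x y] center_inv)
  then show "(?a [^] h) [^] (- i) \<otimes> (?c [^] h) [^] k = \<one>"
    using c by (simp add: monom3_def int_pow_pow int_pow_inv int_pow_neg)
  have "monom3 G (inv ?b) (inv ?c) \<one> (h * i) (h * j) (h * k) = \<one>"
    using comm_monom3_right[of z x y z "h * i" "h * j" "h * k"] c cc gc
    by (simp add: comm_self comm_swap[of x z] comm_swap[of y z] center_inv)
  then show "(?b [^] h) [^] (- i) \<otimes> (?c [^] h) [^] (- j) = \<one>"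
    using c by (simp add: monom3_def int_pow_pow int_pow_inv int_pow_neg)
qed

lemma derived_half_sq:
  assumes "gen_triple x y z" "c \<in> D"
  shows "(c [^] h) [^] (2::int) = \<one>" "c [^] (2 * h) = \<one>"
  using derived_pow[OF assms(2)] center_closed[OF D_central[OF assms]]
  by (simp_all only: int_pow_pow n_half(1,2))

lemma half_derived:
  assumes g: "gen_triple x y z" and d: "d \<in> D"
  shows "\<exists>i j k. d [^] h = monom3 G (comm x y [^] h) (comm x z [^] h) (comm y z [^] h) i j k"
proof -
  have c: "x \<in> carrier G" "y \<in> carrier G" "z \<in> carrier G"
    using g by (simp_all add: gen_triple_def)
  obtain i j k where "d = monom3 G (comm x y) (comm x z) (comm y z) i j k"
    using derived_monom3[OF g d] by blast
  then have "d [^] h = monom3 G (comm x y) (comm x z) (comm y z) (i * h) (j * h) (k * h)"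
    using c by (simp add: monom3_pow comm_central)
  also have "\<dots> = monom3 G (comm x y [^] h) (comm x z [^] h) (comm y z [^] h) i j k"
    using c by (simp add: monom3_def int_pow_pow mult.commute)
  finally show ?thesis by blast
qed

text \<open>Here it enters that the exponent of the derived subgroup is \<open>n\<close> and not a
  proper divisor.\<close>

lemma half_comm_ne:
  assumes g: "gen_triple x y z"
  shows "\<not> (comm x y [^] h = \<one> \<and> comm x z [^] h = \<one> \<and> comm y z [^] h = \<one>)"
proof
  assume a: "comm x y [^] h = \<one> \<and> comm x z [^] h = \<one> \<and> comm y z [^] h = \<one>"
  obtain d where d: "d \<in> D" "d [^] h \<noteq> \<one>" using derived_half_pow by blast
  with half_derived[OF g d(1)] a show False by (auto simp: monom3_def)
qed

text \<open>Otherwise the \<open>h\<close>-th powers of \<open>x^n\<close>, \<open>y^n\<close>,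
  \<open>z^n\<close> lie in a space spanned by \<open>[x,y]^h\<close> and \<open>[x,z]^h\<close>, so
  that some combination vanishes with not all exponents even. The relations that follow from it
  force these exponents to be even.\<close>

lemma half_comm_yz_ne:
  assumes r2: "2 \<le> r" and g: "gen_triple x y z"
  shows "comm y z [^] h \<noteq> \<one>"
proof
  assume c1: "comm y z [^] h = \<one>"
  \<comment> \<open>\<open>nice\<close> separates dimension two from dimension one. A triple with
    dependent \<open>[x,y]^h\<close> and \<open>[x,z]^h\<close> is first exchanged for one with
    \<open>[x,z]^h\<close> trivial.\<close>
  have key: False if g: "gen_triple x y z" and c1: "comm y z [^] h = \<one>"
      and nice: "(\<forall>i j. (comm x y [^] h) [^] (i::int) \<otimes> (comm x z [^] h) [^] (j::int) = \<one> \<longrightarrow> even i \<and> even j)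
        \<or> comm x z [^] h = \<one>" for x y z
  proof -
    have c: "x \<in> carrier G" "y \<in> carrier G" "z \<in> carrier G"
      using g by (simp_all add: gen_triple_def)
    let ?a = "comm x y [^] h" and ?b = "comm x z [^] h" and ?c = "comm y z [^] h"
    have cc: "?a \<in> ZZ" "?b \<in> ZZ" "?c \<in> ZZ"
      using c by (auto intro: center_pow comm_central)
    have sq: "?a [^] (2::int) = \<one>" "?b [^] (2::int) = \<one>"
      using derived_half_sq[OF g] c by (simp_all add: comm_in_derived)
    obtain x1 x2 x3 where X: "(x [^] n) [^] h = monom3 G ?a ?b ?c x1 x2 x3"
      using half_derived[OF g pow_derived[OF c(1)]] by blast
    obtain y1 y2 y3 where Y: "(y [^] n) [^] h = monom3 G ?a ?b ?c y1 y2 y3"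
      using half_derived[OF g pow_derived[OF c(2)]] by blast
    obtain z1 z2 z3 where Z: "(z [^] n) [^] h = monom3 G ?a ?b ?c z1 z2 z3"
      using half_derived[OF g pow_derived[OF c(3)]] by blast
    have comb: "monom3 G ((x [^] n) [^] h) ((y [^] n) [^] h) ((z [^] n) [^] h) i j k =
        ?a [^] (x1 * i + y1 * j + z1 * k) \<otimes> ?b [^] (x2 * i + y2 * j + z2 * k)" for i j k
      unfolding X Y Z monom3_monom3[OF cc] using c c1 by (simp add: monom3_def)
    show False
      using nice
    proof
      assume ind: "\<forall>i j. ?a [^] (i::int) \<otimes> ?b [^] (j::int) = \<one> \<longrightarrow> even i \<and> even j"
      obtain i j k :: int where ijk: "\<not> (even i \<and> even j \<and> even k)"
        and e: "even (x1 * i + y1 * j + z1 * k)" "even (x2 * i + y2 * j + z2 * k)"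
        using exists_even_combination2 by blast
      have "monom3 G ((x [^] n) [^] h) ((y [^] n) [^] h) ((z [^] n) [^] h) i j k = \<one>"
        unfolding comb using pow_even[OF _ sq(1) e(1)] pow_even[OF _ sq(2) e(2)] c by simp
      note rel = half_power_relations[OF r2 g this]
      have "even j \<and> even k" using rel(1) ind by blast
      moreover have "?a [^] (- i) \<otimes> ?b [^] (0::int) = \<one>" using rel(2) c1 c by simp
      then have "even (- i)" using ind by blast
      ultimately show False using ijk by simp
    next
      assume b1: "?b = \<one>"
      then have a1: "?a \<noteq> \<one>" using half_comm_ne[OF g] c1 by blast
      \<comment> \<open>In dimension one only \<open>[x,y]^h\<close> is left, which does not see the
        exponent of \<open>z\<close>. Therefore \<open>k = 0\<close> is imposed, and two vectors in
        a one-dimensional space are still dependent.\<close>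
      have ex: "\<exists>i j. \<not> (even i \<and> even j) \<and> even (x1 * i + y1 * j + z1 * (0::int))"
      proof (cases "even x1 \<or> even y1")
        case True
        then show ?thesis
        proof
          assume "even x1"
          then show ?thesis by (intro exI[of _ 1] exI[of _ 0]) simp
        next
          assume "even y1"
          then show ?thesis by (intro exI[of _ 0] exI[of _ 1]) simp
        qed
      next
        case False
        then show ?thesis by (intro exI[of _ 1] exI[of _ 1]) simp
      qed
      then obtain i j :: int where ij: "\<not> (even i \<and> even j)"
        and e: "even (x1 * i + y1 * j + z1 * (0::int))" by blast
      have "monom3 G ((x [^] n) [^] h) ((y [^] n) [^] h) ((z [^] n) [^] h) i j 0 = \<one>"
        unfolding comb using pow_even[OF _ sq(1) e] b1 c by simp
      note rel = half_power_relations[OF r2 g this]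
      have "?a [^] j = \<one>" "?a [^] (- i) = \<one>" using rel b1 c1 c by simp_all
      moreover have "?a [^] e = ?a" if "odd e" for e :: int using c by (intro pow_odd sq that) simp
      ultimately have "even j" "even (- i)" using a1 by metis+
      then show False using ij by simp
    qed
  qed
  show False
  proof (cases "\<forall>i j. (comm x y [^] h) [^] (i::int) \<otimes> (comm x z [^] h) [^] (j::int) = \<one> \<longrightarrow> even i \<and> even j")
    case True
    then show False using key[OF g c1] by blast
  next
    case False
    then obtain i j :: int where "(comm x y [^] h) [^] i \<otimes> (comm x z [^] h) [^] j = \<one>" "\<not> (even i \<and> even j)"
      by blast
    moreover have "comm x y [^] (2 * h) = \<one>" "comm x z [^] (2 * h) = \<one>"
      using derived_half_sq[OF g] gen_triple_carrier[OF g] by (simp_all add: comm_in_derived)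
    ultimately obtain x y z where "gen_triple x y z" "comm x z [^] h = \<one>" "comm y z [^] h = \<one>"
      using exists_gen_triple_comm_xz_yz[OF g c1] by blast
    then show False using key by blast
  qed
qed

text \<open>It suffices to test the \<open>h\<close>-th powers. A dependence among them is a
  vanishing combination with an odd coefficient, which a new generating triple turns into a single
  commutator.\<close>

lemma indep3_comm_or_degenerate:
  assumes g: "gen_triple x y z"
  shows "indep3 n (comm x y) (comm x z) (comm y z) \<or> (\<exists>x y z. gen_triple x y z \<and> comm y z [^] h = \<one>)"
proof (cases "indep3 2 (comm x y [^] h) (comm x z [^] h) (comm y z [^] h)")
  case True
  have c: "x \<in> carrier G" "y \<in> carrier G" "z \<in> carrier G"
    using g by (simp_all add: gen_triple_def)
  show ?thesis by (intro disjI1 indep3_lift[OF _ _ _ True] comm_central c)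
next
  case False
  then obtain i j k where rel: "monom3 G (comm x y [^] h) (comm x z [^] h) (comm y z [^] h) i j k = \<one>"
    and odd: "\<not> (even i \<and> even j \<and> even k)"
    by (auto simp: indep3_def)
  have "comm x y [^] (2 * h) = \<one>" "comm x z [^] (2 * h) = \<one>" "comm y z [^] (2 * h) = \<one>"
    using derived_half_sq[OF g] gen_triple_carrier[OF g] by (simp_all add: comm_in_derived)
  from exists_gen_triple_comm_yz[OF g rel this odd] show ?thesis by blast
qed

text \<open>Since no triple has trivial \<open>[y,z]^h\<close>, the commutators are independent. A
  vanishing combination of \<open>h\<close>-th powers of \<open>x^n\<close>, \<open>y^n\<close>,
  \<open>z^n\<close> becomes, by centrality, relations between independent commutators, so its
  exponents are even.\<close>

lemma classification_ge2:
  assumes r2: "2 \<le> r" and g: "gen_triple x y z"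
  shows "\<exists>T \<in> GL3_mod n. G \<cong> group_G 2 r r T"
proof (rule classification_iv[OF g])
  have c: "x \<in> carrier G" "y \<in> carrier G" "z \<in> carrier G"
    using g by (simp_all add: gen_triple_def)
  let ?a = "comm x y" and ?b = "comm x z" and ?c = "comm y z"
  show "indep3 n ?a ?b ?c"
    using indep3_comm_or_degenerate[OF g] half_comm_yz_ne[OF r2] by blast
  have ind2: "even i \<and> even j \<and> even k"
    if "monom3 G (?a [^] h) (?b [^] h) (?c [^] h) i j k = \<one>" for i j k
  proof -
    have "monom3 G ?a ?b ?c (h * i) (h * j) (h * k) = \<one>"
      using that c by (simp only: monom3_def int_pow_pow comm_closed)
    from indep3D[OF \<open>indep3 n ?a ?b ?c\<close> this]
    have "h * 2 dvd h * i \<and> h * 2 dvd h * j \<and> h * 2 dvd h * k" by (simp only: n_half(1))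
    moreover have "h \<noteq> 0" by (simp add: half_eq)
    ultimately show ?thesis by (simp only: dvd_times_left_cancel_iff simp_thms)
  qed
  show "indep3 n (x [^] n) (y [^] n) (z [^] n)"
  proof (rule indep3_lift)
    show "x [^] n \<in> ZZ" "y [^] n \<in> ZZ" "z [^] n \<in> ZZ"
      using c by (auto intro: D_central[OF g] pow_derived)
    show "indep3 2 ((x [^] n) [^] h) ((y [^] n) [^] h) ((z [^] n) [^] h)"
      unfolding indep3_def
    proof (intro allI impI)
      fix i j k
      assume "monom3 G ((x [^] n) [^] h) ((y [^] n) [^] h) ((z [^] n) [^] h) i j k = \<one>"
      note rel = half_power_relations[OF r2 g this]
      have "even j \<and> even k" using rel(1) ind2[of j k 0] c by (simp add: monom3_def)
      moreover have "even (- i)" using rel(2) ind2[of "- i" 0 k] c by (simp add: monom3_def)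
      ultimately show "even i \<and> even j \<and> even k" by simp
    qed
  qed
qed

end

section \<open>The case \<open>r = 1\<close>\<close>

definition det3 :: "int \<Rightarrow> int \<Rightarrow> int \<Rightarrow> int \<Rightarrow> int \<Rightarrow> int \<Rightarrow> int \<Rightarrow> int \<Rightarrow> int \<Rightarrow> int" where
  "det3 u1 u2 u3 v1 v2 v3 w1 w2 w3 =
    u1 * (v2 * w3 - v3 * w2) - u2 * (v1 * w3 - v3 * w1) + u3 * (v1 * w2 - v2 * w1)"

text \<open>Cramer's rule: the determinant times each unknown is a combination of the three even
  sums with cofactors as coefficients.\<close>

lemma even_if_odd_det3:
  assumes det: "odd (det3 u1 u2 u3 v1 v2 v3 w1 w2 w3)"
    and e: "even (u1 * i + v1 * j + w1 * k)" "even (u2 * i + v2 * j + w2 * k)" "even (u3 * i + v3 * j + w3 * k)"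
  shows "even i \<and> even j \<and> even k"
proof -
  let ?d = "det3 u1 u2 u3 v1 v2 v3 w1 w2 w3"
  let ?e1 = "u1 * i + v1 * j + w1 * k" and ?e2 = "u2 * i + v2 * j + w2 * k" and ?e3 = "u3 * i + v3 * j + w3 * k"
  have "?d * i = ?e1 * (v2 * w3 - v3 * w2) - ?e2 * (v1 * w3 - v3 * w1) + ?e3 * (v1 * w2 - v2 * w1)"
    "?d * j = ?e2 * (u1 * w3 - u3 * w1) - ?e1 * (u2 * w3 - u3 * w2) - ?e3 * (u1 * w2 - u2 * w1)"
    "?d * k = ?e1 * (u2 * v3 - u3 * v2) - ?e2 * (u1 * v3 - u3 * v1) + ?e3 * (u1 * v2 - u2 * v1)"
    by (simp_all add: det3_def algebra_simps)
  then have "even (?d * i)" "even (?d * j)" "even (?d * k)"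
    by (simp_all only:) (intro dvd_add dvd_diff dvd_mult2 e)+
  with det show ?thesis by simp
qed

text \<open>
  For a quadratic map from the 3-space over the field of two elements to itself with no nontrivial
  zero, whose polar form is the universal alternating one, one of six bases has independent values.
\<close>

lemma anisotropic_independent_values:
  fixes x1 x2 x3 y1 y2 y3 z1 z2 z3 :: int
  assumes "\<not> (even x1 \<and> even x2 \<and> even x3)" "\<not> (even y1 \<and> even y2 \<and> even y3)" "\<not> (even z1 \<and> even z2 \<and> even z3)"
    and "\<not> (even (x1 + y1 + 1) \<and> even (x2 + y2) \<and> even (x3 + y3))"
    and "\<not> (even (x1 + z1) \<and> even (x2 + z2 + 1) \<and> even (x3 + z3))"
    and "\<not> (even (y1 + z1) \<and> even (y2 + z2) \<and> even (y3 + z3 + 1))"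
    and "\<not> (even (x1 + y1 + z1 + 1) \<and> even (x2 + y2 + z2 + 1) \<and> even (x3 + y3 + z3 + 1))"
  shows "odd (det3 x1 x2 x3 y1 y2 y3 z1 z2 z3)
    \<or> odd (det3 (x1 + z1) (x2 + z2 + 1) (x3 + z3) y1 y2 y3 z1 z2 z3)
    \<or> odd (det3 x1 x2 x3 (x1 + y1 + 1) (x2 + y2) (x3 + y3) z1 z2 z3)
    \<or> odd (det3 x1 x2 x3 y1 y2 y3 (y1 + z1) (y2 + z2) (y3 + z3 + 1))
    \<or> odd (det3 (x1 + y1 + z1 + 1) (x2 + y2 + z2 + 1) (x3 + y3 + z3 + 1) y1 y2 y3 (y1 + z1) (y2 + z2) (y3 + z3 + 1))
    \<or> odd (det3 x1 x2 x3 (x1 + y1 + 1) (x2 + y2) (x3 + y3) (x1 + y1 + z1 + 1) (x2 + y2 + z2 + 1) (x3 + y3 + z3 + 1))"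
  \<comment> \<open>Only the parities of the nine entries matter; once \<open>even\<close> is
    distributed this is a propositional problem in nine atoms.\<close>
  using assms unfolding det3_def even_diff even_add even_mult_iff odd_one not_True_eq_False
  by argo

context engel_group
begin

context
  assumes r1: "r = 1"
begin

text \<open>As a simplification rule it also turns the exponent \<open>h\<close> into 1, so the
  earlier statements about \<open>h\<close>-th powers speak of the commutators themselves.\<close>

lemma n_eq [simp]: "n = 2"
  by (simp add: n_def r1)

lemma sq_derived: "g \<in> carrier G \<Longrightarrow> g [^] (2::int) \<in> D"
  using pow_derived[of g] by simp

lemma derived_sq: "c \<in> D \<Longrightarrow> c [^] (2::int) = \<one>"
  using derived_pow[of c] by simp

text \<open>Elements of order at most 2 are central, and \<open>g'\<close> witnesses that
  \<open>g\<close> is not. This is the anisotropy on which all cases with \<open>r = 1\<close>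
  rest.\<close>

lemma sq_ne_one:
  "g \<in> carrier G \<Longrightarrow> g' \<in> carrier G \<Longrightarrow> comm g' g \<noteq> \<one> \<Longrightarrow> g [^] (2::int) \<noteq> \<one>"
  using center_if_pow[of g] central_commutes[of g g'] by auto

lemma sq_mult:
  assumes u: "u \<in> carrier G" and v: "v \<in> carrier G"
  shows "(u \<otimes> v) [^] (2::int) = u [^] (2::int) \<otimes> v [^] (2::int) \<otimes> comm u v"
proof -
  have "comm u v \<otimes> comm u v = \<one>"
    using derived_sq[OF comm_in_derived[OF u v]] u v by (simp add: square_eq)
  then have "comm v u = comm u v"
    using u v by (simp add: comm_swap[of u v] inv_equality)
  then show ?thesis
    using mult_pow_class2[OF u v, of 2] u v comm_central[OF v u]
    by (simp flip: int_pow_int)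
qed

text \<open>The derived subgroup is \<open>{1, a}\<close> with \<open>a = [x,y]\<close>. The squares
  of the non-central elements \<open>x\<close>, \<open>y\<close> and \<open>xz\<close> are
  non-trivial, so all equal \<open>a\<close>; since \<open>(xz)^2 = a z^2\<close>, it follows that
  \<open>z^2 = 1\<close>. That \<open>G\<close> is not 2-generated keeps \<open>z\<close> outside
  the subgroup generated by \<open>x\<close> and \<open>y\<close>.\<close>

lemma classification_1_rank1:
  assumes g: "gen_triple x y z" and b: "comm x z = \<one>" and c: "comm y z = \<one>"
  shows "G \<cong> quaternion_group \<times>\<times> integer_mod_group 2"
proof -
  have xyz: "x \<in> carrier G" "y \<in> carrier G" "z \<in> carrier G"
    using g by (simp_all add: gen_triple_def)
  have gen: "generate G {x, y, z} = carrier G" using g by (simp add: gen_triple_def)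
  let ?a = "comm x y"
  have a1: "?a \<noteq> \<one>" using half_comm_ne[OF g] b c xyz by auto
  have ac: "?a \<in> carrier G" using xyz by simp
  have a2: "?a [^] (2::int) = \<one>" using derived_sq comm_in_derived xyz by simp
  then have aa: "?a \<otimes> ?a = \<one>" using ac by (simp add: square_eq)
  have D: "d = \<one> \<or> d = ?a" if dD: "d \<in> D" for d
  proof -
    obtain i j k where "d = monom3 G ?a (comm x z) (comm y z) i j k"
      using derived_monom3[OF g dD] by blast
    then have "d = ?a [^] i" using ac by (simp add: b c monom3_def)
    then show ?thesis using pow_even[OF ac a2] pow_odd[OF ac a2] by blast
  qed
  have yx: "comm y x = ?a" using aa xyz by (simp add: comm_swap[of x y] inv_equality)
  have x2: "x [^] (2::int) = ?a"
    using D[OF sq_derived[OF xyz(1)]] sq_ne_one[OF xyz(1,2)] yx a1 by simp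
  have y2: "y [^] (2::int) = ?a"
    using D[OF sq_derived[OF xyz(2)]] sq_ne_one[OF xyz(2,1)] a1 by simp
  have "comm (x \<otimes> z) y = ?a"
  proof -
    have "comm z y = \<one>" using c xyz by (simp add: comm_swap[of y z])
    then show ?thesis using xyz by (simp add: comm_mult_left comm_central)
  qed
  then have "comm y (x \<otimes> z) = ?a"
    using aa xyz by (simp add: comm_swap[of "x \<otimes> z" y] inv_equality)
  then have "(x \<otimes> z) [^] (2::int) \<noteq> \<one>"
    using xyz a1 by (intro sq_ne_one[of _ y]) simp_all
  then have "?a \<otimes> z [^] (2::int) \<noteq> \<one>" using xyz by (simp add: sq_mult x2 b)
  then have z2: "z [^] (2::int) = \<one>"
    using D[OF sq_derived[OF xyz(3)]] aa by auto
  have zxy: "z \<notin> generate G {x, y}"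
  proof
    assume z: "z \<in> generate G {x, y}"
    have s: "subgroup (generate G {x, y}) G" using xyz by (intro generate_is_subgroup) simp
    have "generate G {x, y, z} \<subseteq> generate G {x, y}"
      using z by (intro generate_subgroup_incl[OF _ s]) (auto intro: generate.incl)
    moreover have "generate G {x, y} \<subseteq> carrier G" using xyz by (intro generate_incl) simp
    ultimately show False using gen not_2_generated[OF xyz(1,2)] by auto
  qed
  have "G \<cong> presented_group Q8C2_relations"
  proof (rule iso_Q8C2_presentation[OF xyz gen])
    show "x [^] (2::int) \<in> ZZ" unfolding x2 using xyz by (simp add: comm_central)
    show "x [^] (4::int) = \<one>" using xyz a2 by (simp add: pow4_eq x2)
  qed (use x2 y2 z2 b c a1 zxy in simp_all)
  moreover have "group (presented_group Q8C2_relations)" by (rule presented_group_is_group)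
  moreover have "presented_group Q8C2_relations \<cong> quaternion_group \<times>\<times> integer_mod_group 2"
    by (rule group.iso_sym[OF DirProd_group[OF quaternion_group_is_group group_integer_mod_group]
          quaternion_group_C2_presentation])
  ultimately show ?thesis using iso_trans by blast
qed

section \<open>Squares when the commutators span a space of dimension two\<close>

lemma independent_pair:
  assumes g: "gen_triple x y z" and pq: "p \<in> D" "q \<in> D"
    and ne: "p \<noteq> \<one>" "q \<noteq> \<one>" "p \<otimes> q \<noteq> \<one>"
    and one: "p [^] (i::int) \<otimes> q [^] (j::int) = \<one>"
  shows "even i \<and> even j"
proof -
  have c: "p \<in> carrier G" "q \<in> carrier G" using pq D_central[OF g] center_closed by blast+
  note p = pow_even[OF c(1) derived_sq[OF pq(1)], of i] pow_odd[OF c(1) derived_sq[OF pq(1)], of i]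
  note q = pow_even[OF c(2) derived_sq[OF pq(2)], of j] pow_odd[OF c(2) derived_sq[OF pq(2)], of j]
  show ?thesis using one ne p q c by (cases "even i"; cases "even j") simp_all
qed

lemma group_iiI:
  assumes g: "gen_triple x y z" and c: "comm y z = \<one>"
    and ne: "comm x y \<noteq> \<one>" "comm x z \<noteq> \<one>" "comm x y \<otimes> comm x z \<noteq> \<one>"
    and sq: "x [^] (2::int) = comm x y" "z [^] (2::int) = comm x y" "y [^] (2::int) = comm x z"
  shows "G \<cong> group_ii"
proof -
  have xyz: "x \<in> carrier G" "y \<in> carrier G" "z \<in> carrier G"
    using g by (simp_all add: gen_triple_def)
  have D: "comm x y \<in> D" "comm x z \<in> D" using xyz by (simp_all add: comm_in_derived)
  show ?thesis
  proof (rule iso_group_ii[OF xyz])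
    show "generate G {x, y, z} = carrier G" using g by (simp add: gen_triple_def)
    show "x [^] (2::int) \<in> ZZ" "y [^] (2::int) \<in> ZZ"
      using xyz by (simp_all add: sq comm_central)
    show "x [^] (4::int) = \<one>" "y [^] (4::int) = \<one>"
      using xyz D by (simp_all add: pow4_eq sq derived_sq)
  qed (use c sq independent_pair[OF g D ne] in simp_all)
qed

lemma group_iiiI:
  assumes g: "gen_triple x y z" and c: "comm y z = \<one>"
    and ne: "comm x y \<noteq> \<one>" "comm x z \<noteq> \<one>" "comm x y \<otimes> comm x z \<noteq> \<one>"
    and sq: "x [^] (2::int) = comm x y" "y [^] (2::int) = comm x y" "z [^] (2::int) = comm x z"
  shows "G \<cong> group_iii"
proof -
  have xyz: "x \<in> carrier G" "y \<in> carrier G" "z \<in> carrier G"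
    using g by (simp_all add: gen_triple_def)
  have D: "comm x y \<in> D" "comm x z \<in> D" using xyz by (simp_all add: comm_in_derived)
  show ?thesis
  proof (rule iso_group_iii[OF xyz])
    show "generate G {x, y, z} = carrier G" using g by (simp add: gen_triple_def)
    show "x [^] (2::int) \<in> ZZ" "z [^] (2::int) \<in> ZZ"
      using xyz by (simp_all add: sq comm_central)
    show "x [^] (4::int) = \<one>" "z [^] (4::int) = \<one>"
      using xyz D by (simp_all add: pow4_eq sq derived_sq)
  qed (use c sq independent_pair[OF g D ne] in simp_all)
qed

text \<open>The derived subgroup is \<open>{1, a, b, ab}\<close>, and the squares of
  \<open>x\<close>, \<open>y\<close>, \<open>z\<close> determine the squares of all products of
  them. Anisotropy leaves few possible tables, and a choice of two among \<open>y\<close>,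
  \<open>z\<close>, \<open>yz\<close> brings each into the shape of one of the two
  presentations.\<close>

lemma classification_1_rank2:
  assumes g: "gen_triple x y z" and c: "comm y z = \<one>"
    and ind: "\<And>i j. comm x y [^] (i::int) \<otimes> comm x z [^] (j::int) = \<one> \<Longrightarrow> even i \<and> even j"
  shows "G \<cong> group_ii \<or> G \<cong> group_iii"
proof -
  have xyz: "x \<in> carrier G" "y \<in> carrier G" "z \<in> carrier G"
    using g by (simp_all add: gen_triple_def)
  define a where "a = comm x y"
  define b where "b = comm x z"
  have ab: "a \<in> carrier G" "b \<in> carrier G" using xyz by (simp_all add: a_def b_def)
  have D: "a \<in> D" "b \<in> D" using xyz by (simp_all add: a_def b_def comm_in_derived)
  have bZ: "b \<in> ZZ" using D(2) by (rule D_central[OF g])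
  have a2: "a [^] (2::int) = \<one>" and b2: "b [^] (2::int) = \<one>"
    using D by (simp_all add: derived_sq)
  have aa: "a \<otimes> a = \<one>" and bb: "b \<otimes> b = \<one>"
    using a2 b2 ab by (simp_all add: square_eq)
  have ba: "b \<otimes> a = a \<otimes> b" using center_comm[OF bZ ab(1)] by simp
  have aab: "a \<otimes> (a \<otimes> b) = b" using aa ab by (simp flip: m_assoc)
  have bab: "b \<otimes> (a \<otimes> b) = a"
    using ba bb ab by (simp flip: m_assoc) (simp add: m_assoc)
  have ne: "a \<noteq> \<one>" "b \<noteq> \<one>" "a \<otimes> b \<noteq> \<one>"
    using ind[of 1 0] ind[of 0 1] ind[of 1 1] ab by (auto simp flip: a_def b_def)
  have "a \<noteq> b" using ne aa by auto
  have "a \<otimes> b \<noteq> a" using ne ab by simp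
  have "a \<otimes> b \<noteq> b" using ne ab by simp
  note tab = aa bb ba aab bab m_assoc ab
  note nes = ne \<open>a \<noteq> b\<close> \<open>a \<noteq> b\<close>[symmetric] \<open>a \<otimes> b \<noteq> a\<close> \<open>a \<otimes> b \<noteq> a\<close>[symmetric] \<open>a \<otimes> b \<noteq> b\<close> \<open>a \<otimes> b \<noteq> b\<close>[symmetric]
  have Dcases: "d = \<one> \<or> d = a \<or> d = b \<or> d = a \<otimes> b" if dD: "d \<in> D" for d
  proof -
    obtain i j k where "d = monom3 G (comm x y) (comm x z) (comm y z) i j k"
      using derived_monom3[OF g dD] by blast
    then have d: "d = a [^] i \<otimes> b [^] j"
      using ab by (simp add: c monom3_def flip: a_def b_def)
    show ?thesis
      using pow_even[OF ab(1) a2, of i] pow_odd[OF ab(1) a2, of i] pow_even[OF ab(2) b2, of j] pow_odd[OF ab(2) b2, of j] ab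
      unfolding d by (cases "even i"; cases "even j") simp_all
  qed
  let ?w = "y \<otimes> z"
  have w: "?w \<in> carrier G" using xyz by simp
  have cxw: "comm x ?w = a \<otimes> b"
    using xyz by (simp add: comm_mult_right comm_central a_def b_def)
  define sx where "sx = x [^] (2::int)"
  define sy where "sy = y [^] (2::int)"
  define sz where "sz = z [^] (2::int)"
  have w2: "?w [^] (2::int) = sy \<otimes> sz" using xyz by (simp add: sq_mult c sy_def sz_def)
  have cyx: "comm (x \<otimes> v) x \<noteq> \<one>" if "comm x v \<noteq> \<one>" "v \<in> carrier G" for v
    using that xyz by (simp add: comm_mult_left comm_central comm_self comm_swap[of x v])
  have cxv: "comm x (x \<otimes> v) = comm x v" if "v \<in> carrier G" for v
    using that xyz by (simp add: comm_mult_right comm_central comm_self)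
  have yx: "comm y x \<noteq> \<one>" using ne(1) xyz by (simp add: comm_swap[of x y] a_def)
  have nX: "sx \<noteq> \<one>" unfolding sx_def using xyz yx by (intro sq_ne_one[of _ y])
  have nY: "sy \<noteq> \<one>"
    unfolding sy_def using xyz ne(1) by (intro sq_ne_one[of _ x]) (simp_all add: a_def)
  have nZ: "sz \<noteq> \<one>"
    unfolding sz_def using xyz ne(2) by (intro sq_ne_one[of _ x]) (simp_all add: b_def)
  have nw: "sy \<otimes> sz \<noteq> \<one>"
    unfolding w2[symmetric] using xyz w ne(3) by (intro sq_ne_one[of _ x]) (simp_all add: cxw)
  have nxv: "sx \<otimes> v [^] (2::int) \<otimes> comm x v \<noteq> \<one>" if v: "comm x v \<noteq> \<one>" "v \<in> carrier G" for v
  proof -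
    have "(x \<otimes> v) [^] (2::int) \<noteq> \<one>"
      by (rule sq_ne_one[of _ x]) (use xyz v in \<open>simp_all add: cxv\<close>)
    then show ?thesis using xyz v by (simp add: sq_mult sx_def)
  qed
  have nxy: "sx \<otimes> sy \<otimes> a \<noteq> \<one>"
    using nxv[of y] ne(1) xyz by (simp add: sy_def a_def)
  have nxz: "sx \<otimes> sz \<otimes> b \<noteq> \<one>"
    using nxv[of z] ne(2) xyz by (simp add: sz_def b_def)
  have nxw: "sx \<otimes> (sy \<otimes> sz) \<otimes> (a \<otimes> b) \<noteq> \<one>"
    using nxv[of ?w] ne(3) w by (simp add: cxw w2)
  have XYZ: "sx = a \<or> sx = b \<or> sx = a \<otimes> b" "sy = a \<or> sy = b \<or> sy = a \<otimes> b" "sz = a \<or> sz = b \<or> sz = a \<otimes> b"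
    using Dcases[OF sq_derived[OF xyz(1)]] Dcases[OF sq_derived[OF xyz(2)]] Dcases[OF sq_derived[OF xyz(3)]] nX nY nZ
    unfolding sx_def sy_def sz_def by blast+
  \<comment> \<open>Of the 27 tables of non-trivial squares of \<open>x\<close>, \<open>y\<close>,
    \<open>z\<close>, these nine also give \<open>yz\<close>, \<open>xy\<close>, \<open>xz\<close>
    and \<open>xyz\<close> non-trivial squares.\<close>
  have "(sy = a \<and> sz = b) \<or> (sy = b \<and> sz = a \<and> (sx = a \<or> sx = b)) \<or>
     (sy = a \<and> sz = a \<otimes> b \<and> (sx = b \<or> sx = a \<otimes> b)) \<or> (sy = a \<otimes> b \<and> sz = b \<and> (sx = a \<or> sx = a \<otimes> b))"
    using XYZ nw nxy nxz nxw by (elim disjE) (simp_all add: tab nes)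
  have zy: "comm z y = \<one>" using c xyz by (simp add: comm_swap[of y z])
  have cw: "comm ?w z = \<one>" "comm z ?w = \<one>" "comm y ?w = \<one>" "comm ?w y = \<one>"
    using xyz c zy by (simp_all add: comm_mult_left comm_mult_right comm_central comm_self)
  have gwz: "gen_triple x ?w z" using gen_triple_mult[OF g, of 1] xyz by simp
  have "gen_triple x (z \<otimes> y) y"
    using gen_triple_mult[OF gen_triple_perm(2)[OF g], of 1] xyz by simp
  moreover have "z \<otimes> y = ?w" using zy xyz by (simp add: comm_eq_one_iff)
  ultimately have gwy: "gen_triple x ?w y" by simp
  note sqs = sx_def[symmetric] sy_def[symmetric] sz_def[symmetric] w2
  note cs = a_def[symmetric] b_def[symmetric] cxw
  \<comment> \<open>Each ordered pair from \<open>y\<close>, \<open>z\<close>, \<open>yz\<close>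
    settles one of the six tables other than \<open>y^2 = a\<close>, \<open>z^2 = b\<close>. Those
    three belong to the other presentation and are listed next, one for each value of
    \<open>x^2\<close>.\<close>
  note iis = group_iiI[OF g c] group_iiI[OF gen_triple_perm(2)[OF g] zy]
    group_iiI[OF gwz cw(1)] group_iiI[OF gen_triple_perm(2)[OF gwz] cw(2)]
    group_iiI[OF gwy cw(4)] group_iiI[OF gen_triple_perm(2)[OF gwy] cw(3)]
  note iiis = group_iiiI[OF g c] group_iiiI[OF gen_triple_perm(2)[OF g] zy] group_iiiI[OF gwz cw(1)]
  from XYZ(1) \<open>(sy = a \<and> sz = b) \<or> _\<close> show ?thesis
    using iis iiis unfolding sqs cs by (elim disjE conjE) (simp_all add: tab nes)
qed

section \<open>Squares when the commutators span a space of dimension three\<close>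

lemma indep3_of_det:
  assumes g: "gen_triple x y z" and ind: "indep3 2 (comm x y) (comm x z) (comm y z)"
    and det: "odd (det3 u1 u2 u3 v1 v2 v3 w1 w2 w3)"
  shows "indep3 2 (monom3 G (comm x y) (comm x z) (comm y z) u1 u2 u3)
    (monom3 G (comm x y) (comm x z) (comm y z) v1 v2 v3)
    (monom3 G (comm x y) (comm x z) (comm y z) w1 w2 w3)"
  unfolding indep3_def
proof (intro allI impI)
  have c: "comm x y \<in> ZZ" "comm x z \<in> ZZ" "comm y z \<in> ZZ"
    using gen_triple_carrier[OF g] by (auto intro: comm_central)
  fix i j k
  assume "monom3 G (monom3 G (comm x y) (comm x z) (comm y z) u1 u2 u3)
    (monom3 G (comm x y) (comm x z) (comm y z) v1 v2 v3)
    (monom3 G (comm x y) (comm x z) (comm y z) w1 w2 w3) i j k = \<one>"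
  then have "monom3 G (comm x y) (comm x z) (comm y z) (u1 * i + v1 * j + w1 * k)
      (u2 * i + v2 * j + w2 * k) (u3 * i + v3 * j + w3 * k) = \<one>"
    by (simp only: monom3_monom3[OF c])
  from indep3D[OF ind this] show "even i \<and> even j \<and> even k"
    by (intro even_if_odd_det3[OF det]) blast+
qed

text \<open>By \<open>nondeg\<close> every generating triple has independent commutators, so a
  change of generators need only make the squares independent. This is decided by determinants of
  the coordinates of the squares in the fixed basis \<open>[x,y]\<close>, \<open>[x,z]\<close>,
  \<open>[y,z]\<close>.\<close>

lemma classification_1_rank3:
  assumes g: "gen_triple x y z"
    and nondeg: "\<And>x y z. gen_triple x y z \<Longrightarrow> indep3 2 (comm x y) (comm x z) (comm y z)"
  shows "\<exists>T \<in> GL3_mod n. G \<cong> group_G 2 r r T"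
proof -
  have xyz: "x \<in> carrier G" "y \<in> carrier G" "z \<in> carrier G"
    using g by (simp_all add: gen_triple_def)
  let ?m = "monom3 G (comm x y) (comm x z) (comm y z)"
  note ind = nondeg[OF g]
  have cc: "comm x y \<in> ZZ" "comm x z \<in> ZZ" "comm y z \<in> ZZ"
    using xyz by (auto intro: comm_central)
  obtain x1 x2 x3 where X: "x [^] (2::int) = ?m x1 x2 x3"
    using derived_monom3[OF g sq_derived[OF xyz(1)]] by blast
  obtain y1 y2 y3 where Y: "y [^] (2::int) = ?m y1 y2 y3"
    using derived_monom3[OF g sq_derived[OF xyz(2)]] by blast
  obtain z1 z2 z3 where Z: "z [^] (2::int) = ?m z1 z2 z3"
    using derived_monom3[OF g sq_derived[OF xyz(3)]] by blast
  have units: "comm x y = ?m 1 0 0" "comm x z = ?m 0 1 0" "comm y z = ?m 0 0 1"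
    using cc by (simp_all add: monom3_def center_closed)
  \<comment> \<open>The added 1 is the polar form: squaring a product contributes the commutator of
    its factors. The same holds for the other products.\<close>
  have XY: "(x \<otimes> y) [^] (2::int) = ?m (x1 + y1 + 1) (x2 + y2) (x3 + y3)"
  proof -
    have "(x \<otimes> y) [^] (2::int) = x [^] (2::int) \<otimes> y [^] (2::int) \<otimes> comm x y"
      using xyz by (intro sq_mult)
    also have "\<dots> = ?m x1 x2 x3 \<otimes> ?m y1 y2 y3 \<otimes> ?m 1 0 0"
      by (simp only: X Y units(1)[symmetric])
    finally show ?thesis by (simp add: monom3_mult[OF cc])
  qed
  have XZ: "(x \<otimes> z) [^] (2::int) = ?m (x1 + z1) (x2 + z2 + 1) (x3 + z3)"
  proof -
    have "(x \<otimes> z) [^] (2::int) = x [^] (2::int) \<otimes> z [^] (2::int) \<otimes> comm x z"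
      using xyz by (intro sq_mult)
    also have "\<dots> = ?m x1 x2 x3 \<otimes> ?m z1 z2 z3 \<otimes> ?m 0 1 0"
      by (simp only: X Z units(2)[symmetric])
    finally show ?thesis by (simp add: monom3_mult[OF cc])
  qed
  have YZ: "(y \<otimes> z) [^] (2::int) = ?m (y1 + z1) (y2 + z2) (y3 + z3 + 1)"
  proof -
    have "(y \<otimes> z) [^] (2::int) = y [^] (2::int) \<otimes> z [^] (2::int) \<otimes> comm y z"
      using xyz by (intro sq_mult)
    also have "\<dots> = ?m y1 y2 y3 \<otimes> ?m z1 z2 z3 \<otimes> ?m 0 0 1"
      by (simp only: Y Z units(3)[symmetric])
    finally show ?thesis by (simp add: monom3_mult[OF cc])
  qed
  have cxyz: "comm (x \<otimes> y) z = ?m 0 1 1"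
  proof -
    have "comm (x \<otimes> y) z = comm x z \<otimes> comm y z"
      using xyz by (simp add: comm_mult_left comm_central)
    also have "\<dots> = ?m 0 1 0 \<otimes> ?m 0 0 1" by (simp only: units(2,3)[symmetric])
    finally show ?thesis by (simp add: monom3_mult[OF cc])
  qed
  have XYZ: "(x \<otimes> y \<otimes> z) [^] (2::int) = ?m (x1 + y1 + z1 + 1) (x2 + y2 + z2 + 1) (x3 + y3 + z3 + 1)"
  proof -
    have "(x \<otimes> y \<otimes> z) [^] (2::int) = (x \<otimes> y) [^] (2::int) \<otimes> z [^] (2::int) \<otimes> comm (x \<otimes> y) z"
      using xyz by (intro sq_mult) simp_all
    also have "\<dots> = ?m (x1 + y1 + 1) (x2 + y2) (x3 + y3) \<otimes> ?m z1 z2 z3 \<otimes> ?m 0 1 1"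
      by (simp only: XY Z cxyz)
    also have "\<dots> = ?m (x1 + y1 + 1 + z1 + 0) (x2 + y2 + z2 + 1) (x3 + y3 + z3 + 1)"
      by (simp only: monom3_mult[OF cc])
    finally show ?thesis by (simp add: add_ac)
  qed
  have even_one: "?m i j k = \<one>" if "even i \<and> even j \<and> even k" for i j k
    using that xyz by (simp add: monom3_def pow_even derived_sq comm_in_derived)
  have odd_one: "?m i j k \<noteq> \<one>" if "\<not> (even i \<and> even j \<and> even k)" for i j k
    using indep3D[OF ind, of i j k] that by blast
  have one_odd: "\<not> (even i \<and> even j \<and> even k)" if "u [^] (2::int) = ?m i j k" "u \<in> carrier G" "v \<in> carrier G"
      "comm v u \<noteq> \<one>" for u v i j k
    using sq_ne_one[of u v] even_one[of i j k] that by auto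
  have ne: "comm x y \<noteq> \<one>" "comm x z \<noteq> \<one>" "comm y z \<noteq> \<one>"
    using odd_one[of 1 0 0] odd_one[of 0 1 0] odd_one[of 0 0 1] by (simp_all flip: units)
  have swap: "comm u v \<noteq> \<one>" if "comm v u \<noteq> \<one>" "u \<in> carrier G" "v \<in> carrier G" for u v
    using that by (simp add: comm_swap[of v u])
  have ne': "comm y x \<noteq> \<one>" by (rule swap[OF ne(1) xyz(2,1)])
  have c1: "comm x (x \<otimes> y) = comm x y" "comm x (x \<otimes> z) = comm x z" "comm y (y \<otimes> z) = comm y z"
    using xyz by (simp_all add: comm_mult_right comm_central comm_self)
  have "comm z (x \<otimes> y \<otimes> z) = comm z (x \<otimes> y)"
    using xyz by (subst comm_mult_right) (simp_all add: comm_central comm_self)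
  moreover have "comm z (x \<otimes> y) \<noteq> \<one>"
    by (rule swap) (use xyz odd_one[of 0 1 1] in \<open>simp_all add: cxyz\<close>)
  ultimately have c2: "comm z (x \<otimes> y \<otimes> z) \<noteq> \<one>" by simp
  have "odd (det3 x1 x2 x3 y1 y2 y3 z1 z2 z3)
    \<or> odd (det3 (x1 + z1) (x2 + z2 + 1) (x3 + z3) y1 y2 y3 z1 z2 z3)
    \<or> odd (det3 x1 x2 x3 (x1 + y1 + 1) (x2 + y2) (x3 + y3) z1 z2 z3)
    \<or> odd (det3 x1 x2 x3 y1 y2 y3 (y1 + z1) (y2 + z2) (y3 + z3 + 1))
    \<or> odd (det3 (x1 + y1 + z1 + 1) (x2 + y2 + z2 + 1) (x3 + y3 + z3 + 1) y1 y2 y3 (y1 + z1) (y2 + z2) (y3 + z3 + 1))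
    \<or> odd (det3 x1 x2 x3 (x1 + y1 + 1) (x2 + y2) (x3 + y3) (x1 + y1 + z1 + 1) (x2 + y2 + z2 + 1) (x3 + y3 + z3 + 1))"
  proof (rule anisotropic_independent_values)
    \<comment> \<open>For each of the seven elements a generator that does not commute with it is
      supplied, so none of their squares is trivial.\<close>
    show "\<not> (even x1 \<and> even x2 \<and> even x3)"
      using xyz ne' by (intro one_odd[OF X, of y])
    show "\<not> (even y1 \<and> even y2 \<and> even y3)"
      using xyz ne by (intro one_odd[OF Y, of x])
    show "\<not> (even z1 \<and> even z2 \<and> even z3)"
      using xyz ne by (intro one_odd[OF Z, of x])
    show "\<not> (even (x1 + y1 + 1) \<and> even (x2 + y2) \<and> even (x3 + y3))"
      using xyz ne by (intro one_odd[OF XY, of x]) (simp_all add: c1)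
    show "\<not> (even (x1 + z1) \<and> even (x2 + z2 + 1) \<and> even (x3 + z3))"
      using xyz ne by (intro one_odd[OF XZ, of x]) (simp_all add: c1)
    show "\<not> (even (y1 + z1) \<and> even (y2 + z2) \<and> even (y3 + z3 + 1))"
      using xyz ne by (intro one_odd[OF YZ, of y]) (simp_all add: c1)
    show "\<not> (even (x1 + y1 + z1 + 1) \<and> even (x2 + y2 + z2 + 1) \<and> even (x3 + y3 + z3 + 1))"
      using xyz c2 by (intro one_odd[OF XYZ, of z]) simp_all
  qed
  note dets = this
  \<comment> \<open>The triples \<open>g1\<close> to \<open>g5\<close>, with the original one, are
    the six bases whose determinants occur in \<open>dets\<close>.\<close>
  have g1: "gen_triple (x \<otimes> z) y z"
    using gen_triple_perm(1)[OF gen_triple_mult[OF gen_triple_perm(1)[OF g], of 1]] xyz by simp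
  have g3: "gen_triple x y (y \<otimes> z)"
  proof (rule gen_tripleI[OF g])
    let ?S = "generate G {x, y, y \<otimes> z}"
    have s: "subgroup ?S G" using xyz by (intro generate_is_subgroup) simp
    show "x \<in> ?S" "y \<in> ?S" by (simp_all add: generate.incl)
    then have "inv y \<in> ?S" by (intro subgroup.m_inv_closed[OF s])
    moreover have "y \<otimes> z \<in> ?S" by (simp add: generate.incl)
    ultimately have "inv y \<otimes> (y \<otimes> z) \<in> ?S" by (rule generate.eng)
    moreover have "inv y \<otimes> (y \<otimes> z) = z" using xyz by (simp flip: m_assoc)
    ultimately show "z \<in> ?S" by simp
  qed (use xyz in simp_all)
  have gr: "gen_triple u (u \<otimes> v) w" if gg: "gen_triple u v w" for u v w
  proof (rule gen_tripleI[OF gg])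
    have uvw: "u \<in> carrier G" "v \<in> carrier G" "w \<in> carrier G"
      using gg by (simp_all add: gen_triple_def)
    let ?S = "generate G {u, u \<otimes> v, w}"
    have s: "subgroup ?S G" using uvw by (intro generate_is_subgroup) simp
    show "u \<in> ?S" "w \<in> ?S" by (simp_all add: generate.incl)
    then have "inv u \<in> ?S" by (intro subgroup.m_inv_closed[OF s])
    moreover have "u \<otimes> v \<in> ?S" by (simp add: generate.incl)
    ultimately have "inv u \<otimes> (u \<otimes> v) \<in> ?S" by (rule generate.eng)
    moreover have "inv u \<otimes> (u \<otimes> v) = v" using uvw by (simp flip: m_assoc)
    ultimately show "v \<in> ?S" by simp
  qed (use gg in \<open>simp_all add: gen_triple_def\<close>)
  have g2: "gen_triple x (x \<otimes> y) z" by (rule gr[OF g])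
  have g4: "gen_triple (x \<otimes> y \<otimes> z) y (y \<otimes> z)"
  proof -
    have "gen_triple (y \<otimes> z) x y" using gen_triple_perm(4)[OF g3] .
    from gen_triple_mult[OF gen_triple_perm(5)[OF this], of 1] have "gen_triple y (x \<otimes> (y \<otimes> z)) (y \<otimes> z)"
      using xyz by simp
    then show ?thesis using xyz gen_triple_perm(1) by (simp add: m_assoc)
  qed
  have g5: "gen_triple x (x \<otimes> y) (x \<otimes> y \<otimes> z)"
    using gen_triple_perm(4)[OF gr[OF gen_triple_perm(3)[OF g2]]] by simp
  have concl: ?thesis if gg: "gen_triple u v w" and sq: "indep3 2 (u [^] (2::int)) (v [^] (2::int)) (w [^] (2::int))" for u v w
    by (rule classification_iv[OF gg]) (use nondeg[OF gg] sq in simp_all)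
  from dets show ?thesis
  proof (elim disjE)
    show ?thesis if "odd (det3 x1 x2 x3 y1 y2 y3 z1 z2 z3)"
      by (rule concl[OF g]) (unfold X Y Z, rule indep3_of_det[OF g ind that])
    show ?thesis if "odd (det3 (x1 + z1) (x2 + z2 + 1) (x3 + z3) y1 y2 y3 z1 z2 z3)"
      by (rule concl[OF g1]) (unfold XZ Y Z, rule indep3_of_det[OF g ind that])
    show ?thesis if "odd (det3 x1 x2 x3 (x1 + y1 + 1) (x2 + y2) (x3 + y3) z1 z2 z3)"
      by (rule concl[OF g2]) (unfold X XY Z, rule indep3_of_det[OF g ind that])
    show ?thesis if "odd (det3 x1 x2 x3 y1 y2 y3 (y1 + z1) (y2 + z2) (y3 + z3 + 1))"
      by (rule concl[OF g3]) (unfold X Y YZ, rule indep3_of_det[OF g ind that])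
    show ?thesis if "odd (det3 (x1 + y1 + z1 + 1) (x2 + y2 + z2 + 1) (x3 + y3 + z3 + 1) y1 y2 y3 (y1 + z1) (y2 + z2) (y3 + z3 + 1))"
      by (rule concl[OF g4]) (unfold XYZ Y YZ, rule indep3_of_det[OF g ind that])
    show ?thesis if "odd (det3 x1 x2 x3 (x1 + y1 + 1) (x2 + y2) (x3 + y3) (x1 + y1 + z1 + 1) (x2 + y2 + z2 + 1) (x3 + y3 + z3 + 1))"
      by (rule concl[OF g5]) (unfold X XY XYZ, rule indep3_of_det[OF g ind that])
  qed
qed

text \<open>The dimension is detected through generating triples: three if none has
  \<open>[y,z] = 1\<close>, two if in such a triple \<open>[x,y]\<close> and \<open>[x,z]\<close>
  are independent modulo 2; otherwise a further base change also makes \<open>[x,z]\<close>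
  trivial.\<close>

lemma classification_1:
  assumes g: "gen_triple x y z"
  shows "G \<cong> quaternion_group \<times>\<times> integer_mod_group 2 \<or> G \<cong> group_ii \<or> G \<cong> group_iii
    \<or> (\<exists>T \<in> GL3_mod n. G \<cong> group_G 2 r r T)"
proof (cases "\<exists>x y z. gen_triple x y z \<and> comm y z = \<one>")
  case False
  have "indep3 2 (comm x y) (comm x z) (comm y z)" if "gen_triple x y z" for x y z
    using indep3_comm_or_degenerate[OF that] False gen_triple_carrier by auto
  then show ?thesis using classification_1_rank3[OF g] by blast
next
  case True
  then obtain x y z where g: "gen_triple x y z" and c: "comm y z = \<one>" by blast
  have xyz: "x \<in> carrier G" "y \<in> carrier G" "z \<in> carrier G"
    using g by (simp_all add: gen_triple_def)
  show ?thesis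
  proof (cases "\<forall>i j. comm x y [^] (i::int) \<otimes> comm x z [^] (j::int) = \<one> \<longrightarrow> even i \<and> even j")
    case True
    then show ?thesis using classification_1_rank2[OF g c] by blast
  next
    case False
    then obtain i j :: int where rel: "comm x y [^] i \<otimes> comm x z [^] j = \<one>" and odd: "\<not> (even i \<and> even j)"
      by blast
    have "\<exists>x y z. gen_triple x y z \<and> comm x z [^] (1::int) = \<one> \<and> comm y z [^] (1::int) = \<one>"
      by (rule exists_gen_triple_comm_xz_yz[OF g _ _ _ _ odd])
        (use c rel xyz in \<open>simp_all add: derived_sq comm_in_derived\<close>)
    then obtain x y z where g': "gen_triple x y z" and "comm x z [^] (1::int) = \<one>" "comm y z [^] (1::int) = \<one>"
      by blast
    then have "comm x z = \<one>" "comm y z = \<one>" using gen_triple_carrier[OF g'] by simp_all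
    then show ?thesis using classification_1_rank1[OF g'] by blast
  qed
qed

end

end

section \<open>The classification\<close>

text \<open>The order of the group is a common exponent, so the least one exists.\<close>

lemma group_exponent_finite:
  assumes "group H" and fin: "finite (carrier H)"
  shows "0 < group_exponent H" and "g \<in> carrier H \<Longrightarrow> g [^]\<^bsub>H\<^esub> group_exponent H = \<one>\<^bsub>H\<^esub>"
proof -
  interpret H: group H by fact
  let ?P = "\<lambda>n. 0 < n \<and> (\<forall>g \<in> carrier H. g [^]\<^bsub>H\<^esub> n = \<one>\<^bsub>H\<^esub>)"
  have "?P (order H)" using fin by (simp add: H.order_gt_0_iff_finite H.pow_order_eq_1)
  then have "?P (group_exponent H)" unfolding group_exponent_def by (rule LeastI)
  then show "0 < group_exponent H" and "g \<in> carrier H \<Longrightarrow> g [^]\<^bsub>H\<^esub> group_exponent H = \<one>\<^bsub>H\<^esub>"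
    by auto
qed

lemma group_exponent_minimal:
  assumes "0 < m" "m < group_exponent H"
  shows "\<exists>g \<in> carrier H. g [^]\<^bsub>H\<^esub> m \<noteq> \<one>\<^bsub>H\<^esub>"
  using not_less_Least[of m "\<lambda>n. 0 < n \<and> (\<forall>g \<in> carrier H. g [^]\<^bsub>H\<^esub> n = \<one>\<^bsub>H\<^esub>)"] assms
  unfolding group_exponent_def by blast

theorem (in group) classification_2E:
  assumes pE: "pE_group 2 G"
    and nab: "\<not> comm_group G"
    and rank: "generator_rank G = 3"
    and exp: "group_exponent (G Mod derived_subgroup G) = 2 ^ r"
    and exp': "group_exponent (G\<lparr>carrier := derived_subgroup G\<rparr>) = 2 ^ r"
  shows "G \<cong> quaternion_group \<times>\<times> integer_mod_group 2
       \<or> G \<cong> group_ii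
       \<or> G \<cong> group_iii
       \<or> (\<exists>T \<in> GL3_mod (2 ^ r). G \<cong> group_G 2 r r T)"
proof -
  have fin: "finite (carrier G)" using pE by (simp add: pE_group_def finite_p_group_def)
  let ?D = "derived_subgroup G"
  have D: "?D \<lhd> G" "subgroup ?D G"
    unfolding derived_subgroup_def by (rule derived_self_is_normal, rule derived_is_subgroup) simp
  have DG: "?D \<subseteq> carrier G" by (rule subgroup.subset[OF D(2)])
  \<comment> \<open>The exponent of the quotient determines \<open>r'\<close>, so it coincides with
    the given \<open>r\<close> and \<open>Omega 2 r G\<close> is central.\<close>
  obtain r' where "group_exponent (G Mod ?D) = 2 ^ r'" "Omega 2 r' G \<subseteq> group_center G"
    using pE by (auto simp: pE_group_def)
  then have Omega: "Omega 2 r G \<subseteq> ZZ" using exp by simp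
  have ip: "g [^] (2 ^ r :: int) = g [^] (2 ^ r :: nat)" for g
    using int_pow_int[of G g "2 ^ r"] by simp
  have pow1: "g \<in> ZZ" if "g \<in> carrier G" "g [^] (2 ^ r :: nat) = \<one>" for g
    using Omega that by (auto simp: Omega_def intro: generate.incl)
  have "group (G\<lparr>carrier := ?D\<rparr>)"
    by (rule subgroup.subgroup_is_group[OF D(2) group_axioms])
  moreover have finD: "finite ?D" using DG fin by (rule finite_subset)
  ultimately have Dpow: "c [^] (2 ^ r :: nat) = \<one>" if "c \<in> ?D" for c
    using group_exponent_finite(2)[of "G\<lparr>carrier := ?D\<rparr>" c] that exp'
    by (simp flip: nat_pow_consistent)
  have Dmin: "\<exists>c \<in> ?D. c [^] m \<noteq> \<one>" if "0 < m" "m < 2 ^ r" for m :: nat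
    using group_exponent_minimal[of m "G\<lparr>carrier := ?D\<rparr>"] that exp'
    by (simp flip: nat_pow_consistent)
  have central: "comm g h \<in> ZZ" if "g \<in> carrier G" "h \<in> carrier G" for g h
    using that by (intro pow1 Dpow comm_in_derived) simp_all
  have powD: "g [^] (2 ^ r :: nat) \<in> ?D" if g: "g \<in> carrier G" for g
  proof -
    have "carrier (G Mod ?D) = (\<lambda>g. ?D #> g) ` carrier G" by (simp add: carrier_FactGroup)
    then have "finite (carrier (G Mod ?D))" "?D #> g \<in> carrier (G Mod ?D)" using fin g by auto
    then have "(?D #> g) [^]\<^bsub>G Mod ?D\<^esub> (2 ^ r :: nat) = \<one>\<^bsub>G Mod ?D\<^esub>"
      using group_exponent_finite(2)[OF normal.factorgroup_is_group[OF D(1)]] exp by metis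
    then have "?D #> (g [^] (2 ^ r :: nat)) = ?D"
      using normal.FactGroup_pow[OF D(1) g] by simp
    then show ?thesis by (rule coset_join1) (use g D(2) in simp_all)
  qed
  \<comment> \<open>For \<open>r = 0\<close> the derived subgroup has exponent 1, which would make
    \<open>G\<close> abelian.\<close>
  have r0: "0 < r"
  proof (rule ccontr)
    assume "\<not> 0 < r"
    then have "comm g h = \<one>" if "g \<in> carrier G" "h \<in> carrier G" for g h
      using Dpow[OF comm_in_derived[OF that]] that by simp
    then have "comm_group G" by (intro group_comm_groupI) (simp add: comm_eq_one_iff)
    with nab show False by simp
  qed
  have gens: "\<exists>S \<subseteq> carrier G. finite S \<and> card S = 3 \<and> generate G S = carrier G"
  proof -
    let ?P = "\<lambda>n. \<exists>S \<subseteq> carrier G. finite S \<and> card S = n \<and> generate G S = carrier G"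
    have "generate G (carrier G) = carrier G"
      using generate_incl[of "carrier G"] by (auto intro: generate.incl)
    then have "?P (card (carrier G))" using fin by blast
    then have "?P (generator_rank G)" unfolding generator_rank_def by (rule LeastI)
    then show ?thesis by (simp only: rank)
  qed
  interpret engel_group G r "2 ^ r"
  proof unfold_locales
    show "\<exists>c \<in> ?D. c [^] ((2 ^ r :: int) div 2) \<noteq> \<one>"
    proof -
      \<comment> \<open>\<open>2 ^ (r - 1)\<close> is positive and below the exponent, so by
        minimality some element of the derived subgroup survives this power.\<close>
      have "(2 ^ r :: int) div 2 = int (2 ^ (r - 1))" using r0 by (cases r) simp_all
      moreover obtain c where "c \<in> ?D" "c [^] (2 ^ (r - 1) :: nat) \<noteq> \<one>"
        using Dmin[of "2 ^ (r - 1)"] r0 by auto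
      ultimately show ?thesis by (metis int_pow_int)
    qed
    fix u v assume uv: "u \<in> carrier G" "v \<in> carrier G"
    show "generate G {u, v} \<noteq> carrier G"
    proof
      assume "generate G {u, v} = carrier G"
      \<comment> \<open>The set \<open>{u, v}\<close> may be a singleton; a bound of 2 on its
        cardinality is enough.\<close>
      then have "generator_rank G \<le> card {u, v}"
        unfolding generator_rank_def using uv by (intro Least_le exI[of _ "{u, v}"]) auto
      also have "\<dots> \<le> 2" by (simp add: card_insert_if)
      finally show False using rank by simp
    qed
  qed (use central powD Dpow pow1 r0 in \<open>simp_all only: ip\<close>)
  obtain x y z where g: "gen_triple x y z"
    using gens by (auto simp: card_3_iff gen_triple_def)
  show ?thesis
  proof (cases "r = 1")
    case True
    show ?thesis by (rule classification_1[OF True g])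
  next
    case False
    then show ?thesis using classification_ge2[OF _ g] r0 by auto
  qed
qed

theorem theorem2p5:
  fixes G :: "('a, 'b) monoid_scheme" and r :: nat
  assumes "pE_group 2 G"
    and "\<not> comm_group G"
    and "generator_rank G = 3"
    and "group_exponent (G Mod derived_subgroup G) = 2 ^ r"
    and "group_exponent (G\<lparr>carrier := derived_subgroup G\<rparr>) = 2 ^ r"
  shows "G \<cong> quaternion_group \<times>\<times> integer_mod_group 2
       \<or> G \<cong> group_ii
       \<or> G \<cong> group_iii
       \<or> (\<exists>T \<in> GL3_mod (2 ^ r). G \<cong> group_G 2 r r T)"
proof -
  have "group G" using assms(1) by (simp add: pE_group_def finite_p_group_def)
  then show ?thesis using assms by (rule group.classification_2E)
qed

end
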